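(* Let $\Omega\subset\mathbb{R}^d$ be a domain satisfying the segment condition, and let $\Omega'\subset\mathbb{R}^d$ be an auxiliary domain such that $\overline\Omega\subset\Omega'$. Let $h_k>0$ be a sequence with $h_k\to0$, and let $\{I_k,W_k,P_k\}$ be a sequence of LME approximation schemes in $\Omega'$ for which there are constants $\tau,\gamma>0$, independent of $k$, such that for every $k$: the point set $P_k$ is an $h_k$-covering of $\Omega'$, $P_k$ has $h_k$-density bounded by $\tau$, and the parameter of the LME scheme is $\beta_k=\gamma/h_k^2$. Let $1\le p<\infty$. Then for every $u\in W^{1,p}(\Omega)$ there exists a sequence $u_k\in X_k$ such that $u_k|_\Omega\to u$ in $W^{1,p}(\Omega)$.
   Context: A domain is an open and bounded subset of $\mathbb{R}^d$. A domain $\Omega$ satisfies the segment condition if for every $x\in\partial\Omega$ there exist a neighborhood $U_x$ of $x$ and a vector $y_x\ne0$ such that for every $z\in\overline\Omega\cap U_x$ the point $z+ty_x$ belongs to $\Omega$ for all $0<t<1$. A point set is a finite set of points of $\mathbb{R}^d$; $\overline{\operatorname{conv}}(P)$ is the closed convex hull of $P$ and $\operatorname{conv}(P)$ is its interior. The size of a bounded set is the diameter of the smallest ball containing it. A $d$-simplex is the convex hull of $d+1$ affinely independent points. For $h>0$, a point set $P$ is an $h$-covering of a set $A\subset\mathbb{R}^d$ if for every $x\in A$ there is a $d$-simplex of size $<h$ with vertices in $P$ that contains $x$ (in particular $A\subset\overline{\operatorname{conv}}(P)$). $P$ has $h$-density bounded by $\tau$ if $\#(P\cap\bar B(x,h))\le\tau$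 for every $x\in\mathbb{R}^d$, where $\bar B(x,h)$ is the closed ball of radius $h$ centered at $x$. The LME (Local Maximum-Entropy) approximation scheme $\{I,W,P\}$ with node set $P=\{x_a:a\in I\}$ and parameter $\beta>0$ has shape functions $W=\{w_a^*:a\in I\}$ defined as follows: for each $x\in\overline{\operatorname{conv}}(P)$, $(w_a^*(x))_{a\in I}$ is the unique minimizer of $\sum_{a\in I} w_a|x-x_a|^2+\frac1\beta\sum_{a\in I} w_a\log w_a$ (with $0\log0=0$) subject to $w_a\ge0$ for all $a\in I$, $\sum_{a\in I}w_a=1$, $\sum_{a\in I}w_ax_a=x$. For $x\in\operatorname{conv}(P)$, $$w_a^*(x)=\frac{e^{-\beta|x-x_a|^2+\langle\lambda^*(x),x-x_a\rangle}}{Z(x,\lambda^*(x))},\qquad Z(x,\lambda)=\sum_{b\in I}e^{-\beta|x-x_b|^2+\langle\lambda,x-x_b\rangle},$$ where $\lambda^*(x)\in\mathbb{R}^d$ minimizes $\lambda\mapsto\log Z(x,\lambda)$. $X_k$ denotes the linear span of the shape functions in $W_k$. *)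

theory Defs
  imports "HOL-Analysis.Analysis"
begin

text \<open>Neither connectedness nor nonemptiness is part of the notion of a domain used here.\<close>

definition is_domain :: "'a::euclidean_space set \<Rightarrow> bool" where
  "is_domain \<Omega> \<longleftrightarrow> open \<Omega> \<and> bounded \<Omega>"

definition segment_condition :: "'a::euclidean_space set \<Rightarrow> bool" where
  "segment_condition \<Omega> \<longleftrightarrow>
     (\<forall>x\<in>frontier \<Omega>. \<exists>U y. open U \<and> x \<in> U \<and> y \<noteq> 0 \<and>
        (\<forall>z\<in>closure \<Omega> \<inter> U. \<forall>t. 0 < t \<and> t < 1 \<longrightarrow> z + t *\<^sub>R y \<in> \<Omega>))"

text \<open>
  The diameter of the smallest ball containing a bounded set. The smallest enclosing closed ball
  exists by compactness, so the infimum is attained for bounded sets.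
\<close>

definition set_size :: "'a::euclidean_space set \<Rightarrow> real" where
  "set_size S = Inf {2 * r | r. r \<ge> 0 \<and> (\<exists>c. S \<subseteq> cball c r)}"

definition h_covering :: "real \<Rightarrow> 'a::euclidean_space set \<Rightarrow> 'a set \<Rightarrow> bool" where
  "h_covering h P A \<longleftrightarrow>
     (\<forall>x\<in>A. \<exists>C\<subseteq>P. \<not> affine_dependent C \<and> card C = DIM('a) + 1 \<and>
        set_size (convex hull C) < h \<and> x \<in> convex hull C)"

definition h_density_bounded :: "real \<Rightarrow> 'a::euclidean_space set \<Rightarrow> real \<Rightarrow> bool" where
  "h_density_bounded h P \<tau> \<longleftrightarrow> (\<forall>x. real (card (P \<inter> cball x h)) \<le> \<tau>)"

definition lme_feasible :: "'i set \<Rightarrow> ('i \<Rightarrow> 'a::euclidean_space) \<Rightarrow> 'a \<Rightarrow> ('i \<Rightarrow> real) \<Rightarrow> bool" where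
  "lme_feasible I X x w \<longleftrightarrow>
     (\<forall>a\<in>I. 0 \<le> w a) \<and> (\<Sum>a\<in>I. w a) = 1 \<and> (\<Sum>a\<in>I. w a *\<^sub>R X a) = x"

definition lme_objective ::
  "real \<Rightarrow> 'i set \<Rightarrow> ('i \<Rightarrow> 'a::euclidean_space) \<Rightarrow> 'a \<Rightarrow> ('i \<Rightarrow> real) \<Rightarrow> real" where
  "lme_objective \<beta> I X x w =
     (\<Sum>a\<in>I. w a * (norm (x - X a))\<^sup>2) + (1 / \<beta>) * (\<Sum>a\<in>I. w a * ln (w a))"

definition lme_minimizer ::
  "real \<Rightarrow> 'i set \<Rightarrow> ('i \<Rightarrow> 'a::euclidean_space) \<Rightarrow> 'a \<Rightarrow> ('i \<Rightarrow> real) \<Rightarrow> bool" where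
  "lme_minimizer \<beta> I X x w \<longleftrightarrow> lme_feasible I X x w \<and>
     (\<forall>v. lme_feasible I X x v \<longrightarrow> lme_objective \<beta> I X x w \<le> lme_objective \<beta> I X x v)"

text \<open>
  The nodes \<open>X a\<close> are pairwise distinct and the node set is \<open>X ` I\<close>. The shape functions live on the
  closed convex hull of the node set, which is the convex hull since \<open>I\<close> is finite; their values
  elsewhere are left arbitrary.
\<close>

definition lme_scheme ::
  "real \<Rightarrow> 'i set \<Rightarrow> ('i \<Rightarrow> 'a::euclidean_space \<Rightarrow> real) \<Rightarrow> ('i \<Rightarrow> 'a) \<Rightarrow> bool" where
  "lme_scheme \<beta> I W X \<longleftrightarrow> finite I \<and> inj_on X I \<and> 0 < \<beta> \<and>
     (\<forall>x\<in>convex hull (X ` I). lme_minimizer \<beta> I X x (\<lambda>a. W a x))"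

definition shape_span :: "'i set \<Rightarrow> ('i \<Rightarrow> 'a::euclidean_space \<Rightarrow> real) \<Rightarrow> ('a \<Rightarrow> real) set" where
  "shape_span I W = {u. \<exists>c. u = (\<lambda>x. \<Sum>a\<in>I. c a * W a x)}"

definition partial_deriv :: "'a::euclidean_space \<Rightarrow> ('a \<Rightarrow> real) \<Rightarrow> 'a \<Rightarrow> real" where
  "partial_deriv i f x = frechet_derivative f (at x) i"

primrec C_k :: "nat \<Rightarrow> ('a::euclidean_space \<Rightarrow> real) \<Rightarrow> bool" where
  "C_k 0 f \<longleftrightarrow> continuous_on UNIV f"
| "C_k (Suc n) f \<longleftrightarrow> f differentiable_on UNIV \<and> (\<forall>i\<in>Basis. C_k n (partial_deriv i f))"

text \<open>
  Smooth functions with compact support in \<open>\<Omega>\<close>, extended by zero to the whole space.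
\<close>

definition test_function :: "'a::euclidean_space set \<Rightarrow> ('a \<Rightarrow> real) \<Rightarrow> bool" where
  "test_function \<Omega> \<phi> \<longleftrightarrow> (\<forall>n. C_k n \<phi>) \<and>
     compact (closure {x. \<phi> x \<noteq> 0}) \<and> closure {x. \<phi> x \<noteq> 0} \<subseteq> \<Omega>"

definition locally_integrable :: "'a::euclidean_space set \<Rightarrow> ('a \<Rightarrow> real) \<Rightarrow> bool" where
  "locally_integrable \<Omega> u \<longleftrightarrow> (\<forall>K. compact K \<and> K \<subseteq> \<Omega> \<longrightarrow> set_integrable lebesgue K u)"

definition is_weak_partial ::
  "'a::euclidean_space set \<Rightarrow> 'a \<Rightarrow> ('a \<Rightarrow> real) \<Rightarrow> ('a \<Rightarrow> real) \<Rightarrow> bool" where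
  "is_weak_partial \<Omega> i u v \<longleftrightarrow> locally_integrable \<Omega> u \<and> locally_integrable \<Omega> v \<and>
     (\<forall>\<phi>. test_function \<Omega> \<phi> \<longrightarrow>
        (LINT x:\<Omega>|lebesgue. u x * partial_deriv i \<phi> x) = - (LINT x:\<Omega>|lebesgue. v x * \<phi> x))"

text \<open>
  Functions are representatives of their classes modulo almost-everywhere equality on \<open>\<Omega>\<close>; nothing
  below depends on values outside \<open>\<Omega>\<close>, so restriction to \<open>\<Omega>\<close> is implicit. Weak derivatives are
  unique almost everywhere on an open \<open>\<Omega>\<close>, so the choice of representative does not matter.
\<close>

definition weak_partial :: "'a::euclidean_space set \<Rightarrow> 'a \<Rightarrow> ('a \<Rightarrow> real) \<Rightarrow> 'a \<Rightarrow> real" where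
  "weak_partial \<Omega> i u = (SOME v. is_weak_partial \<Omega> i u v)"

definition Lp_space :: "real \<Rightarrow> 'a::euclidean_space set \<Rightarrow> ('a \<Rightarrow> real) set" where
  "Lp_space p \<Omega> = {u. set_borel_measurable lebesgue \<Omega> u \<and>
     set_integrable lebesgue \<Omega> (\<lambda>x. \<bar>u x\<bar> powr p)}"

definition W1p_space :: "real \<Rightarrow> 'a::euclidean_space set \<Rightarrow> ('a \<Rightarrow> real) set" where
  "W1p_space p \<Omega> =
     {u \<in> Lp_space p \<Omega>. \<forall>i\<in>Basis. \<exists>v\<in>Lp_space p \<Omega>. is_weak_partial \<Omega> i u v}"

definition W1p_norm :: "real \<Rightarrow> 'a::euclidean_space set \<Rightarrow> ('a \<Rightarrow> real) \<Rightarrow> real" where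
  "W1p_norm p \<Omega> u =
     ((LINT x:\<Omega>|lebesgue. \<bar>u x\<bar> powr p) +
      (\<Sum>i\<in>Basis. LINT x:\<Omega>|lebesgue. \<bar>weak_partial \<Omega> i u x\<bar> powr p)) powr (1 / p)"

definition W1p_tendsto ::
  "real \<Rightarrow> 'a::euclidean_space set \<Rightarrow> (nat \<Rightarrow> 'a \<Rightarrow> real) \<Rightarrow> ('a \<Rightarrow> real) \<Rightarrow> bool" where
  "W1p_tendsto p \<Omega> v u \<longleftrightarrow> (\<forall>k. v k \<in> W1p_space p \<Omega>) \<and> u \<in> W1p_space p \<Omega> \<and>
     (\<lambda>k. W1p_norm p \<Omega> (\<lambda>x. v k x - u x)) \<longlonglongrightarrow> 0"

end

theory Submission
  imports Defs
begin

text \<open>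
Two independent facts carry the theorem.

The first is density. Under the segment condition, functions on the whole space with bounded and
Lipschitz gradient are dense in \<open>W\<^sup>1\<^sup>,\<^sup>p(\<Omega>)\<close> (\<open>sobolev_pair_C11_approximable\<close>). A finite partition by
smooth cutoffs reduces to \<open>u\<close> supported in a small ball in which one vector \<open>y\<close> points into \<open>\<Omega>\<close>.
There \<open>u\<close>, extended by zero, is averaged against a kernel concentrated near \<open>t y\<close>. For \<open>x \<in> \<Omega>\<close> close to
the ball the translated kernel is supported inside \<open>\<Omega>\<close>, hence is a test function there, so the gradient
of the average is the average of the weak gradient; elsewhere both vanish. Convergence in \<open>L\<^sup>p\<close>
is Jensen's inequality together with the continuity of translations.

The second is consistency. If \<open>\<phi>\<close> has bounded and Lipschitz gradient, the interpolant \<open>\<Sum>\<^sub>a \<phi>(x\<^sub>a) w\<^sub>a\<close> and its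
gradient differ from \<open>\<phi>\<close> and \<open>\<nabla>\<phi>\<close> by \<open>O(h\<^sup>2)\<close> and \<open>O(h)\<close>, uniformly at all points whose closed
\<open>3h\<close>-ball lies in the covered set (\<open>lme_interpolant_error\<close>). The shape functions at \<open>x\<close>
are the Gibbs weights of an exponential family whose mean is \<open>x\<close>. Hence \<open>x \<mapsto> w(x)\<close> is the inverse of the
mean map, whose derivative is the covariance matrix, and everything follows from two bounds: the moments
of order \<open>m\<close> about \<open>x\<close> are at most a constant times \<open>h\<^sup>m\<close>, and the covariance is at least a constant times
\<open>h\<^sup>2\<close>. Both follow from a bound of order \<open>1/h\<close> on the dual variable. The density bound gives \<open>Z(x,0) = O(1)\<close>,
whereas the covering condition puts a node at distance about \<open>h\<close> in every direction from \<open>x\<close>, so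
\<open>Z(x,\<lambda>)\<close> is at least a constant times \<open>exp(h |\<lambda>|)\<close>.

Since \<open>\<Omega>\<close> has a positive distance from the complement of \<open>\<Omega>'\<close>, for large \<open>k\<close> the second fact applies on
all of \<open>\<Omega>\<close>; so the distance from \<open>u\<close> to \<open>X\<^sub>k\<close> in \<open>W\<^sup>1\<^sup>,\<^sup>p(\<Omega>)\<close> tends to \<open>0\<close>. The norm involves weak
derivatives selected by a choice operator, and uniqueness almost everywhere (\<open>weak_partial_AE_eq\<close>)
identifies them with the derivatives that occur in the estimates.
\<close>

section \<open>Smooth bumps and cutoffs\<close>

lemma C_k_SucD: "C_k (Suc n) f \<Longrightarrow> C_k n f"
proof (induction n arbitrary: f)
  case 0
  then show ?case by (auto intro: differentiable_imp_continuous_on)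
next
  case (Suc n)
  from Suc.prems show ?case using Suc.IH by (auto simp del: C_k.simps(1) simp: C_k.simps(2))
qed

lemma frechet_derivativeI:
  "(f has_derivative f') (at x) \<Longrightarrow> frechet_derivative f (at x) = f'"
  using frechet_derivative_at by fastforce

lemma C_k_differentiable: "C_k (Suc n) f \<Longrightarrow> (f has_derivative (frechet_derivative f (at x))) (at x)"
  by (simp add: differentiable_on_def frechet_derivative_works)

lemma C_k_SucI:
  assumes "\<And>x. (f has_derivative f' x) (at x)" "\<And>i. i \<in> Basis \<Longrightarrow> C_k n (\<lambda>x. f' x i)"
  shows "C_k (Suc n) f"
proof -
  have "partial_deriv i f = (\<lambda>x. f' x i)" for i
    using frechet_derivativeI[OF assms(1)] by (auto simp: partial_deriv_def fun_eq_iff)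
  then show ?thesis using assms by (auto simp: differentiable_on_def differentiable_def intro: has_derivative_at_withinI)
qed

lemma C_k_const: "C_k n (\<lambda>x. c)"
proof (induction n arbitrary: c)
  case (Suc n) show ?case by (rule C_k_SucI[where f'="\<lambda>x h. 0"]) (auto intro: Suc)
qed simp

lemma C_k_add: "C_k n f \<Longrightarrow> C_k n g \<Longrightarrow> C_k n (\<lambda>x. f x + g x)"
proof (induction n arbitrary: f g)
  case (Suc n)
  show ?case
    by (rule C_k_SucI[OF has_derivative_add[OF C_k_differentiable[OF Suc.prems(1)] C_k_differentiable[OF Suc.prems(2)]]])
      (use Suc in \<open>auto simp: partial_deriv_def[abs_def]\<close>)
qed (auto intro: continuous_intros)

lemma C_k_mult: "C_k n f \<Longrightarrow> C_k n g \<Longrightarrow> C_k n (\<lambda>x. f x * g x)"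
proof (induction n arbitrary: f g)
  case (Suc n)
  show ?case
    by (rule C_k_SucI[OF has_derivative_mult[OF C_k_differentiable[OF Suc.prems(1)] C_k_differentiable[OF Suc.prems(2)]]])
      (use Suc.prems C_k_SucD[OF Suc.prems(1)] C_k_SucD[OF Suc.prems(2)] in 
        \<open>auto simp: partial_deriv_def[abs_def] intro!: C_k_add Suc.IH\<close>)
qed (auto intro: continuous_intros)

lemma C_k_inner: "C_k n (\<lambda>x. x \<bullet> b)"
proof (cases n)
  case (Suc m) show ?thesis unfolding Suc
    by (rule C_k_SucI[where f'="\<lambda>x h. h \<bullet> b"]) (auto intro!: C_k_const derivative_eq_intros)
qed (auto intro: continuous_intros)

lemma C_k_sum: "finite A \<Longrightarrow> (\<And>i. i \<in> A \<Longrightarrow> C_k n (f i)) \<Longrightarrow> C_k n (\<lambda>x. \<Sum>i\<in>A. f i x)"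
  by (induction A rule: finite_induct) (auto intro: C_k_const C_k_add)

lemma C_k_norm_sq: "C_k n (\<lambda>x. (norm (x - c))\<^sup>2)"
proof -
  have "(norm (x - c))\<^sup>2 = (\<Sum>i\<in>Basis. (x \<bullet> i + (- (c \<bullet> i))) * (x \<bullet> i + (- (c \<bullet> i))))" for x
    unfolding power2_norm_eq_inner by (subst euclidean_inner) (simp add: inner_diff_left)
  then show ?thesis by (simp only:) (intro C_k_sum C_k_mult C_k_add C_k_inner C_k_const finite_Basis)
qed

text \<open>
The classical function \<open>exp (- 1/t)\<close>, flat at the origin, times a polynomial in \<open>1/t\<close>. The polynomial
factor makes the family closed under differentiation, so that smoothness of any composition with a smooth
function is a single induction over all polynomials at once.
\<close>

definition flat :: "real poly \<Rightarrow> real \<Rightarrow> real" where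
  "flat P t = (if t > 0 then poly P (1 / t) * exp (- (1 / t)) else 0)"

lemma poly_exp_tendsto_0: "((\<lambda>s. poly (P::real poly) s * exp (- s)) \<longlongrightarrow> 0) at_top"
proof -
  have eq: "(\<lambda>s. poly P s * exp (- s)) = (\<lambda>s. \<Sum>i\<le>degree P. coeff P i * (s ^ i / exp s))"
    by (auto simp: fun_eq_iff poly_altdef sum_distrib_right exp_minus divide_inverse mult.assoc intro!: sum.cong)
  have "((\<lambda>s. \<Sum>i\<le>degree P. coeff P i * (s ^ i / exp s)) \<longlongrightarrow> (\<Sum>i\<le>degree P. coeff P i * 0)) at_top"
    by (intro tendsto_intros tendsto_power_div_exp_0)
  then show ?thesis by (simp add: eq)
qed

text \<open>
With \<open>s = 1/t\<close>, the derivative of \<open>P(s) exp(-s)\<close> in \<open>t\<close> is \<open>(P - P')(s) s\<^sup>2 exp(-s)\<close>, again a member of the family.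
At the origin the difference quotient is \<open>s P(s) exp(-s)\<close>, which vanishes as \<open>s\<close> tends to infinity.
\<close>

lemma flat_has_derivative:
  "(flat P has_field_derivative flat ((P - pderiv P) * [:0, 0, 1:]) t) (at t)"
proof (cases t "0::real" rule: linorder_cases)
  case greater
  have "((\<lambda>t. poly P (1 / t) * exp (- (1 / t))) has_field_derivative flat ((P - pderiv P) * [:0, 0, 1:]) t) (at t)"
    using greater by (auto intro!: derivative_eq_intros DERIV_chain2[OF poly_DERIV] simp: flat_def field_simps power2_eq_square)
  then show ?thesis
    by (rule has_field_derivative_transform_within_open[where S="{0<..}"]) (use greater in \<open>auto simp: flat_def\<close>)
next
  case less
  have "((\<lambda>t. 0) has_field_derivative 0) (at t)" by simp
  then have "(flat P has_field_derivative 0) (at t)"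
    by (rule has_field_derivative_transform_within_open[where S="{..<0}"]) (use less in \<open>auto simp: flat_def\<close>)
  then show ?thesis using less by (simp add: flat_def)
next
  case equal
  have R: "((\<lambda>h. flat P h / h) \<longlongrightarrow> 0) (at_right 0)"
  proof -
    have "((\<lambda>h. poly (P * [:0, 1:]) (inverse h) * exp (- (inverse h))) \<longlongrightarrow> 0) (at_right 0)"
      by (rule filterlim_compose[OF poly_exp_tendsto_0 filterlim_inverse_at_top_right])
    then show ?thesis
      by (rule Lim_transform_eventually) (auto simp: eventually_at_filter flat_def field_simps)
  qed
  have L: "((\<lambda>h. flat P h / h) \<longlongrightarrow> 0) (at_left 0)"
    by (rule Lim_transform_eventually[where f="\<lambda>_. 0"]) (auto simp: eventually_at_filter flat_def)
  have "((\<lambda>h. flat P h / h) \<longlongrightarrow> 0) (at 0)" using L R by (simp add: filterlim_at_split)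
  then show ?thesis using equal by (simp add: DERIV_def flat_def)
qed

lemma C_k_flat: assumes q: "\<And>n. C_k n q" shows "C_k n (\<lambda>x. flat P (q x))"
proof (induction n arbitrary: P)
  case 0
  have "continuous_on UNIV (flat P)"
    by (meson DERIV_isCont continuous_at_imp_continuous_on flat_has_derivative)
  then show ?case using q[of 0] continuous_on_compose2[of UNIV "flat P" UNIV q] by simp
next
  case (Suc n)
  let ?Q = "(P - pderiv P) * [:0, 0, 1:]"
  have "((\<lambda>x. flat P (q x)) has_derivative (\<lambda>h. frechet_derivative q (at x) h * flat ?Q (q x))) (at x)" for x
    using has_derivative_compose[OF C_k_differentiable[OF q] flat_has_derivative[unfolded has_field_derivative_def]]
    by (simp only: mult.commute)
  moreover have "C_k n (\<lambda>x. frechet_derivative q (at x) i * flat ?Q (q x))" if "i \<in> Basis" for i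
    using q[of "Suc n"] that Suc[of ?Q] by (intro C_k_mult) (auto simp: partial_deriv_def[abs_def])
  ultimately show ?case by (rule C_k_SucI)
qed

lemma C_k_inverse_power:
  assumes q: "\<And>n. C_k n q" and pos: "\<And>x. q x > 0"
  shows "C_k n (\<lambda>x. c * inverse (q x) ^ Suc m)"
proof (induction n arbitrary: c m)
  case 0
  have "continuous_on UNIV q" using q[of 0] by simp
  then show ?case using pos by (auto intro!: continuous_intros simp: less_imp_neq[symmetric])
next
  case (Suc n)
  have "((\<lambda>x. c * inverse (q x) ^ Suc m) has_derivative
     (\<lambda>h. frechet_derivative q (at x) h * (- (real (Suc m) * c) * inverse (q x) ^ Suc (Suc m)))) (at x)" for x
  proof -
    have "((\<lambda>t. c * inverse t ^ Suc m) has_field_derivative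
        (- (real (Suc m) * c) * inverse (q x) ^ Suc (Suc m))) (at (q x))"
    proof -
      have "(inverse has_field_derivative - (inverse (q x) * 1 * inverse (q x))) (at (q x))"
        using pos[of x] by (intro DERIV_inverse') (auto intro: DERIV_ident)
      from DERIV_cmult[OF DERIV_power_Suc[OF this, of m], of c]
      show ?thesis by (simp add: algebra_simps)
    qed
    from has_derivative_compose[OF C_k_differentiable[OF q] this[unfolded has_field_derivative_def]]
    show ?thesis by (simp only: mult.commute)
  qed
  moreover have "C_k n (\<lambda>x. frechet_derivative q (at x) i * (- (real (Suc m) * c) * inverse (q x) ^ Suc (Suc m)))" 
    if "i \<in> Basis" for i
    using q[of "Suc n"] that by (intro C_k_mult[OF _ Suc]) (auto simp: partial_deriv_def[abs_def])
  ultimately show ?case by (rule C_k_SucI)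
qed

definition bump :: "'a::euclidean_space \<Rightarrow> real \<Rightarrow> 'a \<Rightarrow> real" where
  "bump c r x = flat 1 (1 - (norm (x - c))\<^sup>2 / r\<^sup>2)"

text \<open>
One of the arguments \<open>4 - s\<close> and \<open>s - 1\<close> is always positive, so the denominator never vanishes; the
quotient is \<open>1\<close> for \<open>s \<le> 1\<close> and \<open>0\<close> for \<open>s \<ge> 4\<close>, that is, on the ball of radius \<open>r\<close> and off the ball of radius
\<open>2r\<close>.
\<close>

definition cutoff :: "'a::euclidean_space \<Rightarrow> real \<Rightarrow> 'a \<Rightarrow> real" where
  "cutoff c r x = (let s = (norm (x - c))\<^sup>2 / r\<^sup>2 in flat 1 (4 - s) / (flat 1 (4 - s) + flat 1 (s - 1)))"

lemma flat_1: "flat 1 t = (if t > 0 then exp (- (1 / t)) else 0)"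
  by (simp add: flat_def)

lemma flat_1_nonneg: "flat 1 t \<ge> 0" by (simp add: flat_1)

lemma C_k_quadratic: "C_k n (\<lambda>x. a - (norm (x - c))\<^sup>2 / r)"
proof -
  have "(\<lambda>x. a - (norm (x - c))\<^sup>2 / r) = (\<lambda>x. a + (- 1 / r) * (norm (x - c))\<^sup>2)"
    by (auto simp: fun_eq_iff)
  then show ?thesis by (simp only:) (intro C_k_add C_k_mult C_k_const C_k_norm_sq)
qed

lemma C_k_bump: "C_k n (bump c r)"
  unfolding bump_def[abs_def] by (intro C_k_flat C_k_quadratic)

lemma bump_eq_0: "r > 0 \<Longrightarrow> norm (x - c) \<ge> r \<Longrightarrow> bump c r x = 0"
  by (auto simp: bump_def flat_1 not_less field_simps power_mono)

lemma bump_nonneg: "bump c r x \<ge> 0"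
  by (simp add: bump_def flat_1_nonneg)

lemma C_k_cutoff: "C_k n (cutoff c r)"
proof -
  let ?s = "\<lambda>x. (norm (x - c))\<^sup>2 / r\<^sup>2"
  have pos: "flat 1 (4 - t) + flat 1 (t - 1) > 0" for t :: real
    by (auto simp: flat_1 add_pos_pos)
  have C1: "C_k n (\<lambda>x. flat 1 (4 - ?s x))" for n
    by (intro C_k_flat C_k_quadratic)
  have "C_k n (\<lambda>x. (-1) - (norm (x - c))\<^sup>2 / (- r\<^sup>2))" for n
    by (rule C_k_quadratic)
  then have "C_k n (\<lambda>x. ?s x - 1)" for n
    by (simp add: add.commute)
  then have C2: "C_k n (\<lambda>x. flat 1 (?s x - 1))" for n
    by (rule C_k_flat)
  have "C_k n (\<lambda>x. flat 1 (4 - ?s x) * (1 * inverse (flat 1 (4 - ?s x) + flat 1 (?s x - 1)) ^ Suc 0))"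
    by (intro C_k_mult C1 C_k_inverse_power[OF _ pos] C_k_add C2)
  then show ?thesis by (simp add: cutoff_def[abs_def] Let_def divide_inverse)
qed

lemma cutoff_eq_1: "r > 0 \<Longrightarrow> norm (x - c) \<le> r \<Longrightarrow> cutoff c r x = 1"
proof -
  assume r: "r > 0" "norm (x - c) \<le> r"
  then have "(norm (x - c))\<^sup>2 / r\<^sup>2 \<le> 1" by (simp add: field_simps power_mono)
  then show ?thesis unfolding cutoff_def Let_def by (auto simp: flat_1)
qed

lemma cutoff_eq_0: "r > 0 \<Longrightarrow> norm (x - c) \<ge> 2 * r \<Longrightarrow> cutoff c r x = 0"
proof -
  assume r: "r > 0" "norm (x - c) \<ge> 2 * r"
  then have "(2 * r)\<^sup>2 \<le> (norm (x - c))\<^sup>2" by (intro power_mono) auto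
  then have "(norm (x - c))\<^sup>2 / r\<^sup>2 \<ge> 4" using r by (simp add: field_simps)
  then show ?thesis by (simp add: cutoff_def Let_def flat_1)
qed

section \<open>Continuity of translations and averaging\<close>

lemma nn_integral_lborel_shift:
  fixes z :: "'a::euclidean_space"
  assumes [measurable]: "f \<in> borel_measurable borel"
  shows "(\<integral>\<^sup>+x. f (x + z) \<partial>lborel) = (\<integral>\<^sup>+x. f x \<partial>lborel)"
proof -
  have "(\<integral>\<^sup>+x. f x \<partial>lborel) = (\<integral>\<^sup>+x. f x \<partial>distr lborel borel ((+) z))"
    by (simp add: lborel_distr_plus)
  also have "\<dots> = (\<integral>\<^sup>+x. f (x + z) \<partial>lborel)"
    by (subst nn_integral_distr) (auto simp: add.commute)
  finally show ?thesis ..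
qed

lemma integral_lborel_shift:
  fixes z :: "'a::euclidean_space" and f :: "'a \<Rightarrow> real"
  assumes [measurable]: "f \<in> borel_measurable borel"
  shows "(LINT x|lborel. f (x + z)) = (LINT x|lborel. f x)"
    and "integrable lborel (\<lambda>x. f (x + z)) \<longleftrightarrow> integrable lborel f"
proof -
  have "(LINT x|lborel. f x) = (LINT x|distr lborel borel ((+) z). f x)"
    by (simp add: lborel_distr_plus)
  also have "\<dots> = (LINT x|lborel. f (x + z))"
    by (subst integral_distr) (auto simp: add.commute)
  finally show "(LINT x|lborel. f (x + z)) = (LINT x|lborel. f x)" ..
  have "integrable lborel f \<longleftrightarrow> integrable (distr lborel borel ((+) z)) f"
    by (simp add: lborel_distr_plus)
  also have "\<dots> \<longleftrightarrow> integrable lborel (\<lambda>x. f (x + z))"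
    by (subst integrable_distr_eq) (auto simp: add.commute)
  finally show "integrable lborel (\<lambda>x. f (x + z)) \<longleftrightarrow> integrable lborel f" ..
qed

text \<open>
The \<open>p\<close>-th power of the \<open>L\<^sup>p\<close> norm. Working with the power and the quasi-triangle inequality
\<open>pmass_add\<close> avoids Minkowski's inequality, and values in the extended reals make Tonelli's theorem applicable
without integrability conditions.
\<close>

definition pmass :: "real \<Rightarrow> ('a::euclidean_space \<Rightarrow> real) \<Rightarrow> ennreal" where
  "pmass p f = (\<integral>\<^sup>+x. ennreal (\<bar>f x\<bar> powr p) \<partial>lborel)"

lemma abs_add_powr_le:
  fixes a b p :: real assumes "p \<ge> 0"
  shows "\<bar>a + b\<bar> powr p \<le> 2 powr p * (\<bar>a\<bar> powr p + \<bar>b\<bar> powr p)"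
proof -
  have "\<bar>a + b\<bar> powr p \<le> (2 * max \<bar>a\<bar> \<bar>b\<bar>) powr p"
    using assms by (intro powr_mono2) auto
  also have "\<dots> = 2 powr p * max \<bar>a\<bar> \<bar>b\<bar> powr p"
    by (simp add: powr_mult)
  also have "\<dots> \<le> 2 powr p * (\<bar>a\<bar> powr p + \<bar>b\<bar> powr p)"
    by (intro mult_left_mono) (auto simp: max_def)
  finally show ?thesis .
qed

lemma pmass_add:
  assumes [measurable]: "f \<in> borel_measurable borel" "g \<in> borel_measurable borel" and p: "p \<ge> 0"
  shows "pmass p (\<lambda>x. f x + g x) \<le> ennreal (2 powr p) * (pmass p f + pmass p g)"
proof -
  have "pmass p (\<lambda>x. f x + g x) \<le> (\<integral>\<^sup>+x. ennreal (2 powr p) * (ennreal (\<bar>f x\<bar> powr p) + ennreal (\<bar>g x\<bar> powr p)) \<partial>lborel)"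
    unfolding pmass_def
    by (intro nn_integral_mono) (auto simp flip: ennreal_plus ennreal_mult' intro!: ennreal_leI abs_add_powr_le p)
  also have "\<dots> = ennreal (2 powr p) * (pmass p f + pmass p g)"
    unfolding pmass_def by (subst nn_integral_cmult, simp, subst nn_integral_add) auto
  finally show ?thesis .
qed

lemma pmass_shift:
  assumes [measurable]: "f \<in> borel_measurable borel"
  shows "pmass p (\<lambda>x. f (x + z)) = pmass p f"
  unfolding pmass_def using nn_integral_lborel_shift[of "\<lambda>x. ennreal (\<bar>f x\<bar> powr p)" z] by simp

lemma pmass_minus: "pmass p (\<lambda>x. - f x) = pmass p f"
  by (simp add: pmass_def)

lemma powr_above_tangent:
  fixes t m p :: real assumes "p \<ge> 1" "t \<ge> 0" "m > 0"
  shows "t powr p \<ge> m powr p + p * m powr (p - 1) * (t - m)"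
proof (cases "t = 0")
  case True
  have m: "m powr (p - 1) * m = m powr p" using assms by (simp add: powr_diff)
  have "p * m powr (p - 1) * (t - m) = - (p * (m powr (p - 1) * m))" using True by simp
  then have e: "p * m powr (p - 1) * (t - m) = - (p * m powr p)" unfolding m .
  have "1 * m powr p \<le> p * m powr p" using assms by (intro mult_right_mono) auto
  then show ?thesis using True unfolding e by simp
next
  case False
  have "t powr p - m powr p \<ge> (p * m powr (p - 1)) * (t - m)"
    by (rule convex_on_imp_above_tangent[OF powr_convex[OF assms(1)]])
      (use assms False in \<open>auto intro!: derivative_eq_intros simp: interior_open\<close>)
  then show ?thesis by simp
qed

text \<open>
Jensen's inequality for the probability density \<open>\<rho>\<close>: integrate the tangent inequality of \<open>t powr p\<close>
at the mean of \<open>\<bar>f\<bar>\<close>.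
\<close>

lemma jensen_powr:
  fixes f \<rho> :: "'a::euclidean_space \<Rightarrow> real"
  assumes p: "p \<ge> 1" and [measurable]: "f \<in> borel_measurable borel" "\<rho> \<in> borel_measurable borel"
    and \<rho>: "\<And>x. \<rho> x \<ge> 0" "integrable lborel \<rho>" "(LINT x|lborel. \<rho> x) = 1"
    and int: "integrable lborel (\<lambda>x. f x * \<rho> x)"
  shows "ennreal (\<bar>LINT x|lborel. f x * \<rho> x\<bar> powr p) \<le> (\<integral>\<^sup>+x. ennreal (\<bar>f x\<bar> powr p * \<rho> x) \<partial>lborel)"
proof (cases "(\<integral>\<^sup>+x. ennreal (\<bar>f x\<bar> powr p * \<rho> x) \<partial>lborel) = \<infinity>")
  case False
  then have ip: "integrable lborel (\<lambda>x. \<bar>f x\<bar> powr p * \<rho> x)"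
    using \<rho>(1) by (intro integrableI_nonneg) (auto simp: top.not_eq_extremum)
  define m where "m = (LINT x|lborel. \<bar>f x\<bar> * \<rho> x)"
  have ia: "integrable lborel (\<lambda>x. \<bar>f x\<bar> * \<rho> x)"
    using integrable_abs[OF int] \<rho>(1) by (simp add: abs_mult)
  have le: "\<bar>LINT x|lborel. f x * \<rho> x\<bar> \<le> m"
    unfolding m_def using integral_abs_bound[of lborel "\<lambda>x. f x * \<rho> x"] \<rho>(1) by (simp add: abs_mult)
  have "m powr p \<le> (LINT x|lborel. \<bar>f x\<bar> powr p * \<rho> x)"
  proof (cases "m > 0")
    case True
    have eq: "(m powr p + p * m powr (p - 1) * (\<bar>f x\<bar> - m)) * \<rho> x
       = m powr p * \<rho> x + p * m powr (p - 1) * (\<bar>f x\<bar> * \<rho> x) - p * m powr (p - 1) * m * \<rho> x" for x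
      by (simp add: algebra_simps)
    have "m powr p = (LINT x|lborel. (m powr p + p * m powr (p - 1) * (\<bar>f x\<bar> - m)) * \<rho> x)"
      unfolding eq using ia \<rho> by (simp add: m_def[symmetric])
    also have "\<dots> \<le> (LINT x|lborel. \<bar>f x\<bar> powr p * \<rho> x)"
    proof (rule integral_mono[OF _ ip])
      show "integrable lborel (\<lambda>x. (m powr p + p * m powr (p - 1) * (\<bar>f x\<bar> - m)) * \<rho> x)"
        unfolding eq using ia \<rho> by auto
    qed (use powr_above_tangent[OF p _ True] \<rho>(1) in \<open>auto intro!: mult_right_mono\<close>)
    finally show ?thesis .
  next
    case False
    then have "m powr p = 0" using le by auto
    then show ?thesis using \<rho>(1) by (simp add: integral_nonneg_AE)
  qed
  then have "\<bar>LINT x|lborel. f x * \<rho> x\<bar> powr p \<le> (LINT x|lborel. \<bar>f x\<bar> powr p * \<rho> x)"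
    using le p by (meson powr_mono2 abs_ge_zero order_trans zero_le_one)
  then show ?thesis
    using ip \<rho>(1) by (subst nn_integral_eq_integral) (auto intro: ennreal_leI)
qed simp

definition shift_continuous_L1 :: "('a::euclidean_space \<Rightarrow> real) \<Rightarrow> bool" where
  "shift_continuous_L1 f \<longleftrightarrow> (\<forall>e>0. \<exists>d>0. \<forall>z. norm z < d \<longrightarrow> (\<integral>\<^sup>+x. ennreal \<bar>f (x + z) - f x\<bar> \<partial>lborel) \<le> ennreal e)"

lemma shift_continuous_L1D:
  assumes "shift_continuous_L1 f" "e > 0"
  obtains d where "d > 0" "\<And>z. norm z < d \<Longrightarrow> (\<integral>\<^sup>+x. ennreal \<bar>f (x + z) - f x\<bar> \<partial>lborel) \<le> ennreal e"
  using assms unfolding shift_continuous_L1_def by blast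

lemma compact_open_approx:
  fixes A :: "'a::euclidean_space set"
  assumes A: "A \<in> sets borel" "emeasure lborel A < \<infinity>" and e: "e > (0::real)"
  obtains K U where "compact K" "open U" "K \<subseteq> A" "A \<subseteq> U" "emeasure lborel (U - K) < ennreal e"
proof -
  obtain U where U: "open U" "A \<subseteq> U" "emeasure lborel (U - A) < ennreal (e/3)"
    using outer_regular_lborel[OF A(1), of "e/3"] e by auto
  obtain T where T: "closed T" "T \<subseteq> A" "A - T \<in> lmeasurable" "emeasure lebesgue (A - T) < ennreal (e/3)"
    using sets_lebesgue_inner_closed[of A "e/3"] A e by auto
  have T3: "emeasure lborel (A - T) < ennreal (e/3)"
    using T A by (simp add: borel_closed)
  define D where "D n = T - cball 0 (real n)" for n
  have [measurable]: "A \<in> sets borel" "T \<in> sets borel" using A T by auto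
  have Df: "emeasure lborel (D n) < \<infinity>" for n
  proof -
    have "emeasure lborel (D n) \<le> emeasure lborel A" by (rule emeasure_mono) (use T(2) in \<open>auto simp: D_def\<close>)
    from le_less_trans[OF this A(2)] show ?thesis .
  qed
  have "(\<lambda>n. emeasure lborel (D n)) \<longlonglongrightarrow> emeasure lborel (\<Inter>n. D n)"
    by (rule Lim_emeasure_decseq) (use Df in \<open>auto simp: D_def decseq_def less_top[symmetric]\<close>)
  moreover have "(\<Inter>n. D n) = {}"
    by (auto simp: D_def) (meson real_arch_simple)
  ultimately have "(\<lambda>n. emeasure lborel (D n)) \<longlonglongrightarrow> 0" by simp
  then have "eventually (\<lambda>n. emeasure lborel (D n) < ennreal (e/3)) sequentially"
    using e by (intro order_tendstoD(2)[of _ 0]) auto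
  then obtain n where n: "emeasure lborel (D n) < ennreal (e/3)"
    by (auto simp: eventually_sequentially)
  let ?K = "T \<inter> cball 0 (real n)"
  have [measurable]: "U \<in> sets borel" "D n \<in> sets borel" using U by (auto simp: D_def)
  have "emeasure lborel (U - ?K) \<le> emeasure lborel ((U - A) \<union> ((A - T) \<union> D n))"
    by (intro emeasure_mono) (auto simp: D_def)
  also have "\<dots> \<le> emeasure lborel (U - A) + emeasure lborel ((A - T) \<union> D n)"
    by (intro emeasure_subadditive) auto
  also have "\<dots> \<le> emeasure lborel (U - A) + (emeasure lborel (A - T) + emeasure lborel (D n))"
    by (intro add_mono emeasure_subadditive) auto
  also have "\<dots> < ennreal (e/3) + (ennreal (e/3) + ennreal (e/3))"
    by (intro add_strict_mono U T3 n)
  also have "\<dots> = ennreal e" using e by (simp flip: ennreal_plus)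
  finally have "emeasure lborel (U - ?K) < ennreal e" .
  then show ?thesis using that[of ?K U] U T closed_Int_compact[OF T(1) compact_cball] by blast
qed

text \<open>
Sandwich \<open>A\<close> between a compact \<open>K\<close> and an open \<open>U\<close> with \<open>U - K\<close> small. A shift by less than the distance
from \<open>K\<close> to the complement of \<open>U\<close> moves no point of \<open>K\<close> out of \<open>U\<close>, so the indicator of \<open>A\<close> can only change at
points that lie in \<open>U - K\<close> before or after the shift.
\<close>

lemma shift_continuous_L1_indicator:
  fixes A :: "'a::euclidean_space set"
  assumes A: "A \<in> sets borel" "emeasure lborel A < \<infinity>"
  shows "shift_continuous_L1 (indicator A)"
  unfolding shift_continuous_L1_def
proof (intro allI impI)
  fix e :: real assume e: "e > 0"
  obtain K U where KU: "compact K" "open U" "K \<subseteq> A" "A \<subseteq> U" "emeasure lborel (U - K) < ennreal (e/2)"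
    using compact_open_approx[OF A, of "e/2"] e by auto
  obtain d where d: "d > 0" "\<And>x y. x \<in> K \<Longrightarrow> y \<in> - U \<Longrightarrow> d \<le> dist x y"
    using separate_compact_closed[of K "- U"] KU(1-4) by (meson Compl_disjoint closed_Compl disjoint_eq_subset_Compl double_compl subset_trans)
  have [measurable]: "U - K \<in> sets borel" using KU by (auto intro: borel_open borel_compact)
  show "\<exists>d>0. \<forall>z. norm z < d \<longrightarrow> (\<integral>\<^sup>+x. ennreal \<bar>indicator A (x + z) - indicator A x\<bar> \<partial>lborel) \<le> ennreal e"
  proof (intro exI[of _ d] conjI allI impI d(1))
    fix z :: 'a assume z: "norm z < d"
    have near: "y \<in> U" if "x \<in> K" "dist x y < d" for x y
      using d(2)[of x y] that by force
    have "(\<integral>\<^sup>+x. ennreal \<bar>indicator A (x + z) - indicator A x\<bar> \<partial>lborel)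
        \<le> (\<integral>\<^sup>+x. indicator (U - K) (x + z) + indicator (U - K) x \<partial>lborel)"
    proof (rule nn_integral_mono)
      fix x
      have "dist x (x + z) < d" "dist (x + z) x < d" using z by (auto simp: dist_norm)
      then show "ennreal \<bar>indicator A (x + z) - indicator A x\<bar> \<le> indicator (U - K) (x + z) + indicator (U - K) x"
        using near[of x "x + z"] near[of "x + z" x] KU(3,4)
        by (auto simp: indicator_def split: if_splits)
    qed
    also have "\<dots> = emeasure lborel (U - K) + emeasure lborel (U - K)"
      using nn_integral_lborel_shift[of "indicator (U - K)" z] by (subst nn_integral_add) auto
    also have "\<dots> \<le> ennreal (e/2) + ennreal (e/2)"
      using KU(5) by (intro add_mono) auto
    also have "\<dots> = ennreal e" using e by (simp flip: ennreal_plus)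
    finally show "(\<integral>\<^sup>+x. ennreal \<bar>indicator A (x + z) - indicator A x\<bar> \<partial>lborel) \<le> ennreal e" .
  qed
qed

lemma shift_diff_le:
  fixes f g :: "'a::euclidean_space \<Rightarrow> real"
  assumes [measurable]: "f \<in> borel_measurable borel" "g \<in> borel_measurable borel"
  shows "(\<integral>\<^sup>+x. ennreal \<bar>f (x + z) - f x\<bar> \<partial>lborel) \<le>
    (\<integral>\<^sup>+x. ennreal \<bar>g (x + z) - g x\<bar> \<partial>lborel) + 2 * (\<integral>\<^sup>+x. ennreal \<bar>f x - g x\<bar> \<partial>lborel)"
proof -
  have "(\<integral>\<^sup>+x. ennreal \<bar>f (x + z) - f x\<bar> \<partial>lborel) \<le>
     (\<integral>\<^sup>+x. ennreal \<bar>g (x + z) - g x\<bar> + (ennreal \<bar>f (x + z) - g (x + z)\<bar> + ennreal \<bar>f x - g x\<bar>) \<partial>lborel)"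
    by (intro nn_integral_mono) (auto simp flip: ennreal_plus intro!: ennreal_leI)
  also have "\<dots> = (\<integral>\<^sup>+x. ennreal \<bar>g (x + z) - g x\<bar> \<partial>lborel) + 
     ((\<integral>\<^sup>+x. ennreal \<bar>f (x + z) - g (x + z)\<bar> \<partial>lborel) + (\<integral>\<^sup>+x. ennreal \<bar>f x - g x\<bar> \<partial>lborel))"
    by (subst nn_integral_add; (subst nn_integral_add)?; simp)
  also have "(\<integral>\<^sup>+x. ennreal \<bar>f (x + z) - g (x + z)\<bar> \<partial>lborel) = (\<integral>\<^sup>+x. ennreal \<bar>f x - g x\<bar> \<partial>lborel)"
    using nn_integral_lborel_shift[of "\<lambda>x. ennreal \<bar>f x - g x\<bar>" z] by simp
  finally show ?thesis by (simp add: mult_2)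
qed

lemma shift_continuous_L1_integrable:
  fixes f :: "'a::euclidean_space \<Rightarrow> real"
  assumes "integrable lborel f" shows "shift_continuous_L1 f"
  using assms
proof (induction f rule: integrable_induct)
  case (base A c)
  show ?case unfolding shift_continuous_L1_def
  proof (intro allI impI)
    fix e :: real assume e: "e > 0"
    obtain d where d: "d > 0" "\<And>z. norm z < d \<Longrightarrow> 
        (\<integral>\<^sup>+x. ennreal \<bar>indicator A (x + z) - indicator A x\<bar> \<partial>lborel) \<le> ennreal (e / (\<bar>c\<bar> + 1))"
      using shift_continuous_L1_indicator[of A] base e unfolding shift_continuous_L1_def
      by (auto dest: spec[of _ "e / (\<bar>c\<bar> + 1)"])
    have [measurable]: "A \<in> sets borel" using base by simp
    have "(\<integral>\<^sup>+x. ennreal \<bar>indicator A (x + z) *\<^sub>R c - indicator A x *\<^sub>R c\<bar> \<partial>lborel) \<le> ennreal e" if "norm z < d" for z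
    proof -
      have "(\<integral>\<^sup>+x. ennreal \<bar>indicator A (x + z) *\<^sub>R c - indicator A x *\<^sub>R c\<bar> \<partial>lborel)
        = (\<integral>\<^sup>+x. ennreal \<bar>c\<bar> * ennreal \<bar>indicator A (x + z) - indicator A x\<bar> \<partial>lborel)"
        by (intro nn_integral_cong) (simp flip: ennreal_mult add: indicator_def)
      also have "\<dots> = ennreal \<bar>c\<bar> * (\<integral>\<^sup>+x. ennreal \<bar>indicator A (x + z) - indicator A x\<bar> \<partial>lborel)"
        by (rule nn_integral_cmult) simp
      also have "\<dots> \<le> ennreal \<bar>c\<bar> * ennreal (e / (\<bar>c\<bar> + 1))"
        by (intro mult_left_mono d that) auto
      also have "\<dots> \<le> ennreal e"
        using e by (auto simp flip: ennreal_mult intro!: ennreal_leI simp: field_simps)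
      finally show ?thesis .
    qed
    then show "\<exists>d>0. \<forall>z. norm z < d \<longrightarrow> (\<integral>\<^sup>+x. ennreal \<bar>indicator A (x + z) *\<^sub>R c - indicator A x *\<^sub>R c\<bar> \<partial>lborel) \<le> ennreal e"
      using d(1) by blast
  qed
next
  case (add f g)
  show ?case unfolding shift_continuous_L1_def
  proof (intro allI impI)
    fix e :: real assume e: "e > 0"
    have [measurable]: "f \<in> borel_measurable borel" "g \<in> borel_measurable borel"
      using add.hyps[THEN borel_measurable_integrable] by simp_all
    obtain d1 where d1: "d1 > 0" "\<And>z. norm z < d1 \<Longrightarrow> (\<integral>\<^sup>+x. ennreal \<bar>f (x + z) - f x\<bar> \<partial>lborel) \<le> ennreal (e/2)"
      using shift_continuous_L1D[OF add.IH(1), of "e/2"] e by auto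
    obtain d2 where d2: "d2 > 0" "\<And>z. norm z < d2 \<Longrightarrow> (\<integral>\<^sup>+x. ennreal \<bar>g (x + z) - g x\<bar> \<partial>lborel) \<le> ennreal (e/2)"
      using shift_continuous_L1D[OF add.IH(2), of "e/2"] e by auto
    have "(\<integral>\<^sup>+x. ennreal \<bar>f (x + z) + g (x + z) - (f x + g x)\<bar> \<partial>lborel) \<le> ennreal e" if "norm z < min d1 d2" for z
    proof -
      have "(\<integral>\<^sup>+x. ennreal \<bar>f (x + z) + g (x + z) - (f x + g x)\<bar> \<partial>lborel)
        \<le> (\<integral>\<^sup>+x. ennreal \<bar>f (x + z) - f x\<bar> + ennreal \<bar>g (x + z) - g x\<bar> \<partial>lborel)"
        by (intro nn_integral_mono) (auto simp flip: ennreal_plus intro!: ennreal_leI)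
      also have "\<dots> = (\<integral>\<^sup>+x. ennreal \<bar>f (x + z) - f x\<bar> \<partial>lborel) + (\<integral>\<^sup>+x. ennreal \<bar>g (x + z) - g x\<bar> \<partial>lborel)"
        by (rule nn_integral_add) auto
      also have "\<dots> \<le> ennreal (e/2) + ennreal (e/2)"
        using that by (intro add_mono d1 d2) auto
      also have "\<dots> = ennreal e" using e by (simp flip: ennreal_plus)
      finally show ?thesis .
    qed
    then show "\<exists>d>0. \<forall>z. norm z < d \<longrightarrow> (\<integral>\<^sup>+x. ennreal \<bar>f (x + z) + g (x + z) - (f x + g x)\<bar> \<partial>lborel) \<le> ennreal e"
      using d1(1) d2(1) by (intro exI[of _ "min d1 d2"]) auto
  qed
next
  case (lim f s)
  show ?case unfolding shift_continuous_L1_def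
  proof (intro allI impI)
    fix e :: real assume e: "e > 0"
    have [measurable]: "f \<in> borel_measurable borel" "s j \<in> borel_measurable borel" for j using lim.hyps(1,4)[THEN borel_measurable_integrable] by simp_all
    have "(\<lambda>i. (\<integral>\<^sup>+x. norm (f x - s i x) \<partial>lborel)) \<longlonglongrightarrow> 0"
      by (rule nn_integral_dominated_convergence_norm[where w="\<lambda>x. 2 * norm (f x)"])
        (use lim in \<open>auto simp: integrable_iff_bounded nn_integral_cmult ennreal_mult ennreal_mult_less_top\<close>)
    then have "eventually (\<lambda>i. (\<integral>\<^sup>+x. norm (f x - s i x) \<partial>lborel) < ennreal (e/4)) sequentially"
      using e by (intro order_tendstoD(2)[of _ 0]) auto
    then obtain i where i: "(\<integral>\<^sup>+x. ennreal \<bar>f x - s i x\<bar> \<partial>lborel) < ennreal (e/4)"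
      by (auto simp: eventually_sequentially)
    obtain d where d: "d > 0" "\<And>z. norm z < d \<Longrightarrow> (\<integral>\<^sup>+x. ennreal \<bar>s i (x + z) - s i x\<bar> \<partial>lborel) \<le> ennreal (e/2)"
      using shift_continuous_L1D[OF lim.IH[of i], of "e/2"] e by auto
    have "(\<integral>\<^sup>+x. ennreal \<bar>f (x + z) - f x\<bar> \<partial>lborel) \<le> ennreal e" if "norm z < d" for z
    proof -
      have "(\<integral>\<^sup>+x. ennreal \<bar>f (x + z) - f x\<bar> \<partial>lborel) \<le> ennreal (e/2) + 2 * ennreal (e/4)"
        by (rule order_trans[OF shift_diff_le[of f "s i"]]) (use i d that in \<open>auto intro!: add_mono mult_left_mono\<close>)
      also have "\<dots> = ennreal e" using e by (simp flip: ennreal_plus ennreal_mult'' ennreal_numeral)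
      finally show ?thesis .
    qed
    then show "\<exists>d>0. \<forall>z. norm z < d \<longrightarrow> (\<integral>\<^sup>+x. ennreal \<bar>f (x + z) - f x\<bar> \<partial>lborel) \<le> ennreal e"
      using d(1) by blast
  qed
qed

lemma pmass_bounded_le:
  assumes [measurable]: "f \<in> borel_measurable borel" and p: "p \<ge> 1" and B: "\<And>x. \<bar>f x\<bar> \<le> B"
  shows "pmass p f \<le> ennreal (B powr (p - 1)) * (\<integral>\<^sup>+x. ennreal \<bar>f x\<bar> \<partial>lborel)"
proof -
  have "\<bar>f x\<bar> powr p \<le> B powr (p - 1) * \<bar>f x\<bar>" for x
  proof -
    have "\<bar>f x\<bar> powr p = \<bar>f x\<bar> powr (p - 1) * \<bar>f x\<bar>"
      by (cases "f x = 0") (auto simp: powr_diff)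
    also have "\<dots> \<le> B powr (p - 1) * \<bar>f x\<bar>"
      using B[of x] p by (intro mult_right_mono powr_mono2) auto
    finally show ?thesis .
  qed
  then have "pmass p f \<le> (\<integral>\<^sup>+x. ennreal (B powr (p - 1)) * ennreal \<bar>f x\<bar> \<partial>lborel)"
    unfolding pmass_def by (intro nn_integral_mono) (auto simp flip: ennreal_mult intro!: ennreal_leI)
  also have "\<dots> = ennreal (B powr (p - 1)) * (\<integral>\<^sup>+x. ennreal \<bar>f x\<bar> \<partial>lborel)"
    by (rule nn_integral_cmult) simp
  finally show ?thesis .
qed

lemma pmass_truncation_tendsto:
  fixes f :: "'a::euclidean_space \<Rightarrow> real"
  assumes [measurable]: "f \<in> borel_measurable borel" and p: "p \<ge> 1" and fin: "pmass p f < \<infinity>"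
  shows "(\<lambda>n. pmass p (\<lambda>x. f x - max (- real n) (min (real n) (f x)))) \<longlonglongrightarrow> 0"
proof -
  have "(\<lambda>n. pmass p (\<lambda>x. f x - max (- real n) (min (real n) (f x)))) \<longlonglongrightarrow> (\<integral>\<^sup>+x. 0 \<partial>(lborel :: 'a measure))"
    unfolding pmass_def
  proof (rule nn_integral_dominated_convergence[where w="\<lambda>x. ennreal (\<bar>f x\<bar> powr p)"])
    show "AE x in lborel. ennreal (\<bar>f x - max (- real j) (min (real j) (f x))\<bar> powr p) \<le> ennreal (\<bar>f x\<bar> powr p)" for j
      using p by (intro AE_I2 ennreal_leI powr_mono2) (auto simp: max_def min_def)
    show "AE x in lborel. (\<lambda>i. ennreal (\<bar>f x - max (- real i) (min (real i) (f x))\<bar> powr p)) \<longlonglongrightarrow> 0"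
    proof (rule AE_I2)
      fix x
      obtain N where N: "\<bar>f x\<bar> \<le> real N" using real_arch_simple by blast
      have "eventually (\<lambda>i. ennreal (\<bar>f x - max (- real i) (min (real i) (f x))\<bar> powr p) = 0) sequentially"
        using N by (intro eventually_sequentiallyI[of N]) (auto simp: max_def min_def)
      then show "(\<lambda>i. ennreal (\<bar>f x - max (- real i) (min (real i) (f x))\<bar> powr p)) \<longlonglongrightarrow> 0"
        by (rule tendsto_eventually)
    qed
  qed (use fin in \<open>auto simp: pmass_def\<close>)
  then show ?thesis by simp
qed

lemma integrable_bounded_support:
  fixes f :: "'a::euclidean_space \<Rightarrow> real"
  assumes [measurable]: "f \<in> borel_measurable borel" and B: "\<And>x. \<bar>f x\<bar> \<le> B"
    and S: "bounded S" "\<And>x. x \<notin> S \<Longrightarrow> f x = 0"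
  shows "integrable lborel f"
proof -
  obtain r where r: "\<And>x. x \<in> S \<Longrightarrow> norm x \<le> r" using S(1) unfolding bounded_iff by blast
  have "integrable lborel (\<lambda>x. indicator (cball 0 r) x *\<^sub>R f x)"
  proof (rule integrableI_bounded_set_indicator[where B=B])
    show "emeasure lborel (cball (0::'a) r) < \<infinity>" using emeasure_bounded_finite[of "cball (0::'a) r"] by simp
  qed (use B in auto)
  also have "(\<lambda>x. indicator (cball 0 r) x *\<^sub>R f x) = f"
    using r S(2) by (force simp: fun_eq_iff indicator_def)
  finally show ?thesis .
qed

lemma pmass_diff_shift_le:
  fixes f g :: "'a::euclidean_space \<Rightarrow> real"
  assumes [measurable]: "f \<in> borel_measurable borel" "g \<in> borel_measurable borel" and p: "p \<ge> 0"
  shows "pmass p (\<lambda>x. f (x + z) - f x) \<le>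
    ennreal (2 powr p) * pmass p (\<lambda>x. g (x + z) - g x)
    + ennreal (2 powr p * 2 powr p * 2) * pmass p (\<lambda>x. f x - g x)"
proof -
  let ?b = "\<lambda>x. f x - g x"
  have "pmass p (\<lambda>x. ?b (x + z) + - ?b x) \<le> ennreal (2 powr p) * (pmass p (\<lambda>x. ?b (x + z)) + pmass p (\<lambda>x. - ?b x))"
    by (rule pmass_add) (use p in auto)
  also have "\<dots> = ennreal (2 powr p) * (2 * pmass p ?b)"
    by (subst pmass_shift, simp, subst pmass_minus) (simp add: mult_2)
  finally have 1: "pmass p (\<lambda>x. ?b (x + z) + - ?b x) \<le> ennreal (2 powr p) * (2 * pmass p ?b)" .
  have "pmass p (\<lambda>x. f (x + z) - f x) = pmass p (\<lambda>x. (g (x + z) - g x) + (?b (x + z) + - ?b x))"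
    by (simp add: pmass_def)
  also have "\<dots> \<le> ennreal (2 powr p) * (pmass p (\<lambda>x. g (x + z) - g x) + pmass p (\<lambda>x. ?b (x + z) + - ?b x))"
    by (rule pmass_add) (use p in auto)
  also have "\<dots> \<le> ennreal (2 powr p) * (pmass p (\<lambda>x. g (x + z) - g x) + ennreal (2 powr p) * (2 * pmass p ?b))"
    by (intro mult_left_mono add_left_mono 1) auto
  also have "\<dots> = ennreal (2 powr p) * pmass p (\<lambda>x. g (x + z) - g x)
    + ennreal (2 powr p * 2 powr p * 2) * pmass p ?b"
    by (simp add: distrib_left ennreal_mult mult.assoc)
  finally show ?thesis .
qed

text \<open>
Translations are continuous in \<open>L\<^sup>p\<close>. Truncation at height \<open>n\<close> changes \<open>f\<close> little in \<open>L\<^sup>p\<close>, and the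
truncated function is bounded with bounded support; for bounded functions the \<open>p\<close>-th power is dominated by a
multiple of the first, so that continuity in \<open>L\<^sup>1\<close> suffices.
\<close>

lemma shift_continuous_Lp:
  fixes f :: "'a::euclidean_space \<Rightarrow> real"
  assumes [measurable]: "f \<in> borel_measurable borel" and p: "p \<ge> 1" and fin: "pmass p f < \<infinity>"
    and S: "bounded S" "\<And>x. x \<notin> S \<Longrightarrow> f x = 0" and e: "e > 0"
  obtains d where "d > 0" "\<And>z. norm z < d \<Longrightarrow> pmass p (\<lambda>x. f (x + z) - f x) \<le> ennreal e"
proof -
  define C where "C = 2 powr p * 2 powr p * (2::real)"
  have C: "C > 0" by (simp add: C_def)
  have "eventually (\<lambda>n. pmass p (\<lambda>x. f x - max (- real n) (min (real n) (f x))) < ennreal (e / (2 * C))) sequentially"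
    using e C by (intro order_tendstoD(2)[OF pmass_truncation_tendsto] p fin) auto
  then obtain n where n: "pmass p (\<lambda>x. f x - max (- real n) (min (real n) (f x))) < ennreal (e / (2 * C))"
    by (auto simp: eventually_sequentially)
  define g where "g x = max (- real n) (min (real n) (f x))" for x
  have [measurable]: "g \<in> borel_measurable borel" unfolding g_def by simp
  have gB: "\<bar>g x\<bar> \<le> real n" for x by (auto simp: g_def max_def min_def)
  have "integrable lborel g"
    by (rule integrable_bounded_support[OF _ gB S(1)]) (auto simp: g_def S(2))
  define M where "M = 2 powr p * (2 * real n) powr (p - 1) + 1"
  have M: "M > 0" by (auto simp: M_def add_nonneg_pos)
  obtain d where d: "d > 0" "\<And>z. norm z < d \<Longrightarrow> (\<integral>\<^sup>+x. ennreal \<bar>g (x + z) - g x\<bar> \<partial>lborel) \<le> ennreal (e / (2 * M))"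
    using shift_continuous_L1D[OF shift_continuous_L1_integrable[OF \<open>integrable lborel g\<close>], of "e / (2 * M)"] e M by auto
  have "pmass p (\<lambda>x. f (x + z) - f x) \<le> ennreal e" if z: "norm z < d" for z
  proof -
    have "pmass p (\<lambda>x. g (x + z) - g x) \<le> ennreal ((2 * real n) powr (p - 1)) * ennreal (e / (2 * M))"
    proof (rule order_trans[OF pmass_bounded_le[where B="2 * real n"]])
      show "\<bar>g (x + z) - g x\<bar> \<le> 2 * real n" for x using gB[of "x + z"] gB[of x] by linarith
    qed (use p d z in \<open>auto intro!: mult_left_mono\<close>)
    then have 1: "ennreal (2 powr p) * pmass p (\<lambda>x. g (x + z) - g x) \<le> ennreal (2 powr p) * (ennreal ((2 * real n) powr (p - 1)) * ennreal (e / (2 * M)))"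
      by (intro mult_left_mono) auto
    have "ennreal (2 powr p) * (ennreal ((2 * real n) powr (p - 1)) * ennreal (e / (2 * M))) = ennreal ((M - 1) * (e / (2 * M)))"
      using e M by (simp flip: ennreal_mult add: M_def)
    also have "\<dots> \<le> ennreal (e / 2)"
      using e M by (intro ennreal_leI) (simp add: field_simps)
    finally have 2: "ennreal (2 powr p) * pmass p (\<lambda>x. g (x + z) - g x) \<le> ennreal (e / 2)" using 1 by order
    have "ennreal C * pmass p (\<lambda>x. f x - g x) \<le> ennreal C * ennreal (e / (2 * C))"
      using n by (intro mult_left_mono) (auto simp: g_def)
    also have "\<dots> = ennreal (e / 2)" using e C by (simp flip: ennreal_mult)
    finally have 3: "ennreal C * pmass p (\<lambda>x. f x - g x) \<le> ennreal (e / 2)" .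
    have "pmass p (\<lambda>x. f (x + z) - f x) \<le> ennreal (e / 2) + ennreal (e / 2)"
      by (rule order_trans[OF pmass_diff_shift_le[of f g]]) (use 2 3 p in \<open>auto simp: C_def[symmetric] intro!: add_mono\<close>)
    also have "\<dots> = ennreal e" using e by (simp flip: ennreal_plus)
    finally show ?thesis .
  qed
  then show ?thesis using that d(1) by blast
qed

text \<open>
Averaging \<open>f\<close> over shifts of length less than \<open>d\<close> costs no more than the worst single shift: Jensen's
inequality inside and Tonelli's theorem outside.
\<close>

lemma pmass_average_le:
  fixes f \<rho> :: "'a::euclidean_space \<Rightarrow> real"
  assumes f: "integrable lborel f" and p: "p \<ge> 1"
    and [measurable]: "\<rho> \<in> borel_measurable borel"
    and \<rho>: "\<And>x. \<rho> x \<ge> 0" "\<And>x. \<rho> x \<le> B" "integrable lborel \<rho>" "(LINT x|lborel. \<rho> x) = 1"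
    and supp: "\<And>w. \<rho> w \<noteq> 0 \<Longrightarrow> norm w < d"
    and E: "\<And>z. norm z < d \<Longrightarrow> pmass p (\<lambda>x. f (x + z) - f x) \<le> E"
  shows "pmass p (\<lambda>x. (LINT z|lborel. f z * \<rho> (z - x)) - f x) \<le> E"
proof -
  have [measurable]: "f \<in> borel_measurable borel" using f by auto
  have int1: "integrable lborel (\<lambda>w. f (w + x) * \<rho> w)" for x
  proof (rule Bochner_Integration.integrable_bound[where f="\<lambda>w. B * f (w + x)"])
    show "integrable lborel (\<lambda>w. B * f (w + x))" using f integral_lborel_shift(2)[of f x] by simp
    show "AE w in lborel. norm (f (w + x) * \<rho> w) \<le> norm (B * f (w + x))"
    proof (rule AE_I2)
      fix w show "norm (f (w + x) * \<rho> w) \<le> norm (B * f (w + x))"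
        using \<rho>(1,2)[of w] by (auto simp: abs_mult mult.commute[of "\<bar>f _\<bar>"] intro!: mult_right_mono)
    qed
  qed simp
  have eq: "(LINT z|lborel. f z * \<rho> (z - x)) - f x = (LINT w|lborel. (f (x + w) - f x) * \<rho> w)" for x
  proof -
    have "(LINT z|lborel. f z * \<rho> (z - x)) = (LINT w|lborel. f (w + x) * \<rho> w)"
      using integral_lborel_shift(1)[of "\<lambda>z. f z * \<rho> (z - x)" x] by simp
    moreover have "(LINT w|lborel. f x * \<rho> w) = f x" using \<rho>(4) by simp
    ultimately show ?thesis using int1[of x] \<rho>(3)
      by (simp add: left_diff_distrib add.commute)
  qed
  have int2: "integrable lborel (\<lambda>w. (f (x + w) - f x) * \<rho> w)" for x
    using int1[of x] \<rho>(3) by (simp add: left_diff_distrib add.commute)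
  have "pmass p (\<lambda>x. (LINT z|lborel. f z * \<rho> (z - x)) - f x)
      \<le> (\<integral>\<^sup>+x. (\<integral>\<^sup>+w. ennreal (\<bar>f (x + w) - f x\<bar> powr p * \<rho> w) \<partial>lborel) \<partial>lborel)"
    unfolding pmass_def eq by (intro nn_integral_mono jensen_powr p \<rho> int2) auto
  also have "\<dots> = (\<integral>\<^sup>+w. (\<integral>\<^sup>+x. ennreal (\<bar>f (x + w) - f x\<bar> powr p * \<rho> w) \<partial>lborel) \<partial>lborel)"
    by (rule lborel_pair.Fubini'[symmetric]) simp
  also have "\<dots> = (\<integral>\<^sup>+w. pmass p (\<lambda>x. f (x + w) - f x) * ennreal (\<rho> w) \<partial>lborel)"
    unfolding pmass_def using \<rho>(1) by (simp add: ennreal_mult nn_integral_multc)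
  also have "\<dots> \<le> (\<integral>\<^sup>+w. E * ennreal (\<rho> w) \<partial>lborel)"
  proof (rule nn_integral_mono)
    fix w show "pmass p (\<lambda>x. f (x + w) - f x) * ennreal (\<rho> w) \<le> E * ennreal (\<rho> w)"
      using supp[of w] E[of w] by (cases "\<rho> w = 0") (auto intro!: mult_right_mono)
  qed
  also have "\<dots> = E" using \<rho> by (simp add: nn_integral_cmult nn_integral_eq_integral)
  finally show ?thesis .
qed

section \<open>Compactly supported smooth functions and second-order remainders\<close>

text \<open>
Test functions without reference to a domain. Allowing any \<open>K\<close> off which the function vanishes, instead of the
support itself, keeps the same \<open>K\<close> for products and, if \<open>K\<close> is closed, for partial derivatives.
\<close>

definition smooth_on_supp :: "'a::euclidean_space set \<Rightarrow> ('a \<Rightarrow> real) \<Rightarrow> bool" where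
  "smooth_on_supp K \<phi> \<longleftrightarrow> (\<forall>n. C_k n \<phi>) \<and> (\<forall>x. x \<notin> K \<longrightarrow> \<phi> x = 0)"

definition grad :: "('a::euclidean_space \<Rightarrow> real) \<Rightarrow> 'a \<Rightarrow> 'a" where
  "grad f x = (\<Sum>i\<in>Basis. partial_deriv i f x *\<^sub>R i)"

lemma grad_inner_Basis: "i \<in> Basis \<Longrightarrow> grad f x \<bullet> i = partial_deriv i f x"
  by (simp add: grad_def)

lemma norm_grad_le: "norm (grad f x) \<le> (\<Sum>i\<in>Basis. \<bar>partial_deriv i f x\<bar>)"
  unfolding grad_def by (rule order_trans[OF norm_sum]) (auto intro!: sum_mono)

lemma has_derivative_grad:
  assumes "C_k (Suc n) f"
  shows "(f has_derivative (\<lambda>h. grad f x \<bullet> h)) (at x)"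
proof -
  have d: "(f has_derivative (frechet_derivative f (at x))) (at x)" by (rule C_k_differentiable[OF assms])
  then have lin: "linear (frechet_derivative f (at x))" by (simp add: has_derivative_linear)
  have "frechet_derivative f (at x) h = grad f x \<bullet> h" for h
  proof -
    have "frechet_derivative f (at x) h = frechet_derivative f (at x) (\<Sum>i\<in>Basis. (h \<bullet> i) *\<^sub>R i)"
      by (simp add: euclidean_representation)
    also have "\<dots> = (\<Sum>i\<in>Basis. (h \<bullet> i) * partial_deriv i f x)"
      by (simp add: linear_sum[OF lin] linear_scale[OF lin] partial_deriv_def)
    also have "\<dots> = grad f x \<bullet> h"
      by (simp add: grad_def inner_sum_left inner_commute[of h] mult.commute)
    finally show ?thesis .
  qed
  then have "frechet_derivative f (at x) = (\<lambda>h. grad f x \<bullet> h)" by (rule ext)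
  with d show ?thesis by simp
qed

lemma partial_deriv_eqI:
  assumes "(f has_derivative (\<lambda>h. G \<bullet> h)) (at x)"
  shows "partial_deriv i f x = G \<bullet> i"
  using frechet_derivativeI[OF assms] by (simp add: partial_deriv_def)

lemma smooth_on_supp_partial_deriv:
  assumes "smooth_on_supp K f" "closed K" "i \<in> Basis"
  shows "smooth_on_supp K (partial_deriv i f)"
  unfolding smooth_on_supp_def
proof (intro conjI allI impI)
  fix n show "C_k n (partial_deriv i f)"
    using assms(1,3) C_k.simps(2)[of n f] by (auto simp: smooth_on_supp_def)
next
  fix x assume x: "x \<notin> K"
  have "((\<lambda>x. 0) has_derivative (\<lambda>h. 0 \<bullet> h)) (at x)" by simp
  then have "(f has_derivative (\<lambda>h. 0 \<bullet> h)) (at x)"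
    by (rule has_derivative_transform_within_open[where s="- K"])
      (use assms x in \<open>auto simp: smooth_on_supp_def open_Compl\<close>)
  from partial_deriv_eqI[OF this, of i] show "partial_deriv i f x = 0" by simp
qed

lemma smooth_on_supp_continuous: "smooth_on_supp K f \<Longrightarrow> continuous_on UNIV f"
  unfolding smooth_on_supp_def using C_k.simps(1) by blast

lemma smooth_on_supp_bounded:
  assumes "smooth_on_supp K f" "compact K"
  obtains B where "B > 0" "\<And>x. \<bar>f x\<bar> \<le> B"
proof -
  have "compact (f ` K)"
    using assms continuous_on_subset[OF smooth_on_supp_continuous[OF assms(1)]] by (intro compact_continuous_image) auto
  then obtain B where B: "\<And>y. y \<in> f ` K \<Longrightarrow> norm y \<le> B"
    using compact_imp_bounded bounded_iff by metis
  have "\<bar>f x\<bar> \<le> \<bar>B\<bar> + 1" for x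
    using B[of "f x"] assms(1) by (cases "x \<in> K") (auto simp: smooth_on_supp_def)
  then show ?thesis using that[of "\<bar>B\<bar> + 1"] by auto
qed

lemma smooth_on_supp_grad_bounded:
  assumes "smooth_on_supp K f" "compact K"
  obtains B where "B > 0" "\<And>x. norm (grad f x) \<le> B"
proof -
  have "\<exists>B. \<forall>x. \<bar>partial_deriv i f x\<bar> \<le> B" if "i \<in> Basis" for i
    by (rule smooth_on_supp_bounded[OF smooth_on_supp_partial_deriv[OF assms(1) compact_imp_closed[OF assms(2)] that] assms(2)]) blast
  then obtain B where B: "\<And>i x. i \<in> Basis \<Longrightarrow> \<bar>partial_deriv i f x\<bar> \<le> B i" by metis
  have "norm (grad f x) \<le> \<bar>\<Sum>i\<in>Basis. B i\<bar> + 1" for x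
    using norm_grad_le[of f x] sum_mono[of Basis "\<lambda>i. \<bar>partial_deriv i f x\<bar>" B] B by fastforce
  then show ?thesis using that[of "\<bar>\<Sum>i\<in>Basis. B i\<bar> + 1"] by auto
qed

lemma test_function_smooth_on_supp:
  "test_function \<Omega> \<phi> \<longleftrightarrow> (\<exists>K. compact K \<and> K \<subseteq> \<Omega> \<and> smooth_on_supp K \<phi>)"
proof
  assume "test_function \<Omega> \<phi>"
  then show "\<exists>K. compact K \<and> K \<subseteq> \<Omega> \<and> smooth_on_supp K \<phi>"
    using closure_subset[of "{x. \<phi> x \<noteq> 0}"]
    by (intro exI[of _ "closure {x. \<phi> x \<noteq> 0}"]) (auto simp: test_function_def smooth_on_supp_def)
next
  assume "\<exists>K. compact K \<and> K \<subseteq> \<Omega> \<and> smooth_on_supp K \<phi>"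
  then obtain K where K: "compact K" "K \<subseteq> \<Omega>" "smooth_on_supp K \<phi>" by blast
  then have sub: "closure {x. \<phi> x \<noteq> 0} \<subseteq> K"
    by (intro closure_minimal compact_imp_closed) (auto simp: smooth_on_supp_def)
  then have "compact (closure {x. \<phi> x \<noteq> 0})"
    using K(1) compact_closure bounded_subset compact_imp_bounded closure_subset by meson
  then show "test_function \<Omega> \<phi>" using K sub by (auto simp: test_function_def smooth_on_supp_def)
qed

lemma lipschitz_if_grad_bounded:
  assumes "\<And>x. (f has_derivative (\<lambda>h. G x \<bullet> h)) (at x)" "\<And>x. norm (G x) \<le> B"
  shows "\<bar>f x - f y\<bar> \<le> B * norm (x - y :: 'a::euclidean_space)"
proof -
  have "onorm (\<lambda>h. G x \<bullet> h) \<le> B" for x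
    by (rule onorm_le) (metis Cauchy_Schwarz_ineq2 assms(2) mult_right_mono norm_ge_zero order_trans real_norm_def)
  then show ?thesis
    using differentiable_bound[of UNIV f "\<lambda>x h. G x \<bullet> h" B x y] assms(1) by (auto simp: norm_minus_commute)
qed

text \<open>
The form in which a bounded and Lipschitz gradient enters the error analysis of the interpolant. Being linear
in \<open>f\<close> and \<open>D\<close>, it passes to averages over a parameter by integrating the inequality, which replaces
differentiation under the integral sign.
\<close>

definition taylor2 :: "('a::euclidean_space \<Rightarrow> real) \<Rightarrow> ('a \<Rightarrow> 'a) \<Rightarrow> real \<Rightarrow> bool" where
  "taylor2 f D C \<longleftrightarrow> (\<forall>x. norm (D x) \<le> C) \<and> (\<forall>x y. \<bar>f y - f x - D x \<bullet> (y - x)\<bar> \<le> C * (norm (y - x))\<^sup>2)"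

lemma taylor2_if_lipschitz_grad:
  fixes f :: "'a::euclidean_space \<Rightarrow> real"
  assumes der: "\<And>x. (f has_derivative (\<lambda>h. G x \<bullet> h)) (at x)" and "\<And>x. norm (G x) \<le> C"
    and lip: "\<And>x y. norm (G x - G y) \<le> C * norm (x - y)"
  shows "taylor2 f G C"
  unfolding taylor2_def
proof (intro conjI allI)
  fix x y :: 'a
  have C: "C \<ge> 0" using assms(2) norm_ge_zero order_trans by blast
  let ?\<gamma> = "\<lambda>t. x + t *\<^sub>R (y - x)"
  have "((\<lambda>t. f (?\<gamma> t)) has_derivative (\<lambda>h. G (?\<gamma> t) \<bullet> (h *\<^sub>R (y - x)))) (at t within {0..1})" for t :: real
    by (rule has_derivative_compose[OF _ der]) (auto intro!: derivative_eq_intros)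
  then obtain t where t: "t \<in> {0<..<1}" "f (?\<gamma> 1) - f (?\<gamma> 0) = G (?\<gamma> t) \<bullet> ((1 - 0) *\<^sub>R (y - x))"
    using mvt_simple[of 0 1 "\<lambda>t. f (?\<gamma> t)" "\<lambda>t h. G (?\<gamma> t) \<bullet> (h *\<^sub>R (y - x))"] by auto
  then have "f y - f x - G x \<bullet> (y - x) = (G (?\<gamma> t) - G x) \<bullet> (y - x)"
    by (simp add: inner_diff_left)
  also have "\<bar>\<dots>\<bar> \<le> norm (G (?\<gamma> t) - G x) * norm (y - x)" by (rule Cauchy_Schwarz_ineq2)
  also have "\<dots> \<le> (C * norm (y - x)) * norm (y - x)"
  proof (rule mult_right_mono)
    have "norm (G (?\<gamma> t) - G x) \<le> C * (t * norm (y - x))" using lip[of "?\<gamma> t" x] t(1) by simp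
    also have "\<dots> \<le> C * (1 * norm (y - x))" using t(1) C by (intro mult_left_mono mult_right_mono) auto
    finally show "norm (G (?\<gamma> t) - G x) \<le> C * norm (y - x)" by simp
  qed auto
  finally show "\<bar>f y - f x - G x \<bullet> (y - x)\<bar> \<le> C * (norm (y - x))\<^sup>2" by (simp add: power2_eq_square mult.assoc)
qed (rule assms)

lemma smooth_on_supp_taylor2:
  assumes "smooth_on_supp K f" "compact K"
  obtains C where "taylor2 f (grad f) C"
proof -
  have S: "smooth_on_supp K (partial_deriv i f)" if "i \<in> Basis" for i
    using smooth_on_supp_partial_deriv[OF assms(1) compact_imp_closed[OF assms(2)] that] .
  have der: "(g has_derivative (\<lambda>h. grad g x \<bullet> h)) (at x)" if "smooth_on_supp K g" for g x
    using that has_derivative_grad[of 0 g x] by (auto simp: smooth_on_supp_def)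
  obtain B where B: "B > 0" "\<And>x. norm (grad f x) \<le> B" using smooth_on_supp_grad_bounded[OF assms] by metis 
  have "\<exists>L. \<forall>x y. \<bar>partial_deriv i f x - partial_deriv i f y\<bar> \<le> L * norm (x - y)" if i: "i \<in> Basis" for i
  proof -
    obtain B where "\<And>x. norm (grad (partial_deriv i f) x) \<le> B"
      using smooth_on_supp_grad_bounded[OF S[OF i] assms(2)] by metis
    from lipschitz_if_grad_bounded[OF der[OF S[OF i]] this] show ?thesis by blast
  qed
  then obtain L where L: "\<And>i x y. i \<in> Basis \<Longrightarrow> \<bar>partial_deriv i f x - partial_deriv i f y\<bar> \<le> L i * norm (x - y)"
    by metis
  have lip: "norm (grad f x - grad f y) \<le> (\<Sum>i\<in>Basis. L i) * norm (x - y)" for x y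
  proof -
    have "norm (grad f x - grad f y) = norm (\<Sum>i\<in>Basis. (partial_deriv i f x - partial_deriv i f y) *\<^sub>R i)"
      by (simp add: grad_def sum_subtractf scaleR_diff_left)
    also have "\<dots> \<le> (\<Sum>i\<in>Basis. L i * norm (x - y))"
      by (rule order_trans[OF norm_sum]) (use L in \<open>auto intro!: sum_mono\<close>)
    finally show ?thesis by (simp add: sum_distrib_right)
  qed
  define C where "C = max B (\<Sum>i\<in>Basis. L i)"
  have "taylor2 f (grad f) C"
  proof (rule taylor2_if_lipschitz_grad[OF der[OF assms(1)]])
    show "norm (grad f x) \<le> C" for x using B(2)[of x] by (simp add: C_def)
    show "norm (grad f x - grad f y) \<le> C * norm (x - y)" for x y
      by (rule order_trans[OF lip]) (auto simp: C_def intro!: mult_right_mono)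
  qed
  then show ?thesis using that by blast
qed

section \<open>Integration by parts\<close>

lemma difference_quotient_LIMSEQ:
  fixes f :: "'a::euclidean_space \<Rightarrow> real"
  assumes "(f has_derivative D) (at x)"
  shows "(\<lambda>n. real (Suc n) * (f (x + inverse (real (Suc n)) *\<^sub>R i) - f x)) \<longlonglongrightarrow> D i"
proof -
  have lin: "linear D" using assms by (rule has_derivative_linear)
  have "((\<lambda>t. f (x + t *\<^sub>R i)) has_derivative (\<lambda>h. D (h *\<^sub>R i))) (at 0)"
    by (rule has_derivative_compose[of "\<lambda>t. x + t *\<^sub>R i" "\<lambda>h. h *\<^sub>R i"]) (use assms in \<open>auto intro!: derivative_eq_intros\<close>)
  then have "((\<lambda>t. f (x + t *\<^sub>R i)) has_field_derivative D i) (at 0)"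
    by (simp add: has_field_derivative_def linear_scale[OF lin] mult.commute[of _ "D i"] mult_commute_abs)
  then have "((\<lambda>h. (f (x + h *\<^sub>R i) - f x) / h) \<longlongrightarrow> D i) (at 0)"
    by (simp add: DERIV_def)
  moreover have "filterlim (\<lambda>n. inverse (real (Suc n))) (at 0) sequentially"
    using LIMSEQ_inverse_real_of_nat by (auto simp: filterlim_at simp del: of_nat_Suc)
  ultimately have "(\<lambda>n. (f (x + inverse (real (Suc n)) *\<^sub>R i) - f x) / inverse (real (Suc n))) \<longlonglongrightarrow> D i"
    by (rule filterlim_compose)
  then show ?thesis by (simp add: divide_inverse mult.commute)
qed

text \<open>
The integral of a directional derivative of a compactly supported Lipschitz function is zero:
by translation invariance every difference quotient has integral zero, and the Lipschitz bound dominates them.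
\<close>

lemma integral_directional_derivative_eq_0:
  fixes f :: "'a::euclidean_space \<Rightarrow> real"
  assumes der: "\<And>x. (f has_derivative (\<lambda>h. G x \<bullet> h)) (at x)" and B: "\<And>x. norm (G x) \<le> B"
    and S: "bounded S" "\<And>x. x \<notin> S \<Longrightarrow> f x = 0"
  shows "integrable lborel (\<lambda>x. G x \<bullet> i)" "(LINT x|lborel. G x \<bullet> i) = 0"
proof -
  obtain r where r: "\<And>x. x \<in> S \<Longrightarrow> norm x \<le> r" using S(1) unfolding bounded_iff by blast
  have "continuous_on UNIV f" using der by (meson has_derivative_continuous continuous_at_imp_continuous_on)
  then have [measurable]: "f \<in> borel_measurable borel" by (rule borel_measurable_continuous_onI)
  have B0: "B \<ge> 0" using B norm_ge_zero order_trans by blast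
  have lip: "\<bar>f x - f y\<bar> \<le> B * norm (x - y)" for x y by (rule lipschitz_if_grad_bounded[OF der B])
  have "S \<noteq> UNIV" using S(1) not_bounded_UNIV by auto
  then obtain z where z: "z \<notin> S" by blast
  have "\<bar>f x\<bar> \<le> B * (\<bar>r\<bar> + norm z)" for x
  proof (cases "x \<in> S")
    case True
    have "\<bar>f x\<bar> \<le> B * norm (x - z)" using lip[of x z] S(2)[OF z] by simp
    also have "\<dots> \<le> B * (\<bar>r\<bar> + norm z)" using B0 r[OF True] norm_triangle_ineq4[of x z] by (intro mult_left_mono) auto
    finally show ?thesis .
  qed (use S(2)[of x] B0 in simp)
  note bd = this
  have If: "integrable lborel f" by (rule integrable_bounded_support[OF _ bd S]) measurable
  define q where "q n x = real (Suc n) * (f (x + inverse (real (Suc n)) *\<^sub>R i) - f x)" for n x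
  have [measurable]: "q n \<in> borel_measurable borel" for n unfolding q_def by simp
  have lim: "(\<lambda>n. q n x) \<longlonglongrightarrow> G x \<bullet> i" for x
    unfolding q_def by (rule difference_quotient_LIMSEQ[OF der])
  have [measurable]: "(\<lambda>x. G x \<bullet> i) \<in> borel_measurable borel"
    by (rule borel_measurable_LIMSEQ_real[OF lim]) simp
  let ?w = "\<lambda>x. indicator (cball (0::'a) (r + norm i)) x *\<^sub>R (B * norm i)"
  have "integrable lborel ?w"
    using emeasure_bounded_finite[of "cball (0::'a) (r + norm i)"] by (auto intro!: integrable_mult_left integrable_real_indicator)
  moreover have bnd: "norm (q n x) \<le> ?w x" for n x
  proof (cases "norm x \<le> r + norm i")
    case True
    have "\<bar>f (x + inverse (real (Suc n)) *\<^sub>R i) - f x\<bar> \<le> B * (inverse (real (Suc n)) * norm i)"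
      using lip[of "x + inverse (real (Suc n)) *\<^sub>R i" x] by simp
    then have "real (Suc n) * \<bar>f (x + inverse (real (Suc n)) *\<^sub>R i) - f x\<bar> \<le> real (Suc n) * (B * (inverse (real (Suc n)) * norm i))"
      by (rule mult_left_mono) simp
    also have "\<dots> = B * norm i" by (simp add: field_simps)
    finally show ?thesis using True by (simp add: q_def abs_mult)
  next
    case False
    have "inverse (real (Suc n)) * norm i \<le> 1 * norm i" by (intro mult_right_mono) (auto simp: field_simps)
    then have "norm x - norm i \<le> norm (x + inverse (real (Suc n)) *\<^sub>R i)"
      using norm_diff_ineq[of x "inverse (real (Suc n)) *\<^sub>R i"] by auto
    then have "x + inverse (real (Suc n)) *\<^sub>R i \<notin> S" "x \<notin> S"
      using r False norm_ge_zero[of i] by (fastforce)+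
    then show ?thesis using False S(2) by (simp add: q_def)
  qed
  ultimately have *: "integrable lborel (\<lambda>x. G x \<bullet> i)" "(\<lambda>n. LINT x|lborel. q n x) \<longlonglongrightarrow> (LINT x|lborel. G x \<bullet> i)"
    using integrable_dominated_convergence[of "\<lambda>x. G x \<bullet> i" lborel q ?w] integral_dominated_convergence[of "\<lambda>x. G x \<bullet> i" lborel q ?w] lim by auto
  show "integrable lborel (\<lambda>x. G x \<bullet> i)" by fact
  have "(LINT x|lborel. q n x) = 0" for n
  proof -
    have "integrable lborel (\<lambda>x. f (x + inverse (real (Suc n)) *\<^sub>R i))"
      by (subst integral_lborel_shift(2)) (use If in simp_all)
    moreover have "(LINT x|lborel. f (x + inverse (real (Suc n)) *\<^sub>R i)) = (LINT x|lborel. f x)"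
      by (rule integral_lborel_shift(1)) simp
    ultimately show ?thesis unfolding q_def using If by (simp del: of_nat_Suc)
  qed
  then show "(LINT x|lborel. G x \<bullet> i) = 0" using *(2) by (simp add: LIMSEQ_const_iff)
qed

lemma LINT_lebesgue_eq_lborel:
  fixes f :: "'a::euclidean_space \<Rightarrow> real"
  assumes [measurable]: "f \<in> borel_measurable borel"
  shows "(LINT x|lebesgue. f x) = (LINT x|lborel. f x)" "integrable lebesgue f \<longleftrightarrow> integrable lborel f"
  using assms by (auto intro: integral_completion simp: integrable_completion)

lemma bounded_measurable_Lp_space:
  fixes \<Omega> :: "'a::euclidean_space set"
  assumes \<Omega>: "open \<Omega>" "bounded \<Omega>" and m: "set_borel_measurable lebesgue \<Omega> f" 
    and B: "\<And>x. x \<in> \<Omega> \<Longrightarrow> \<bar>f x\<bar> \<le> B" and p: "p \<ge> 0"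
  shows "f \<in> Lp_space p \<Omega>"
  unfolding Lp_space_def
proof (intro CollectI conjI m)
  have [measurable]: "(\<lambda>x. indicator \<Omega> x *\<^sub>R f x) \<in> borel_measurable lebesgue" "(\<lambda>x. indicator \<Omega> x * f x) \<in> borel_measurable lebesgue" "\<Omega> \<in> sets lebesgue"
    using m \<Omega>(1) by (simp_all add: set_borel_measurable_def)
  have meas: "(\<lambda>x. indicator \<Omega> x *\<^sub>R (\<bar>indicator \<Omega> x *\<^sub>R f x\<bar> powr p)) \<in> borel_measurable lebesgue"
    by measurable
  have fin: "emeasure lebesgue \<Omega> < \<infinity>"
    using emeasure_bounded_finite[OF \<Omega>(2)] \<Omega>(1) by (simp add: borel_open)
  have "integrable lebesgue (\<lambda>x. indicator \<Omega> x *\<^sub>R (\<bar>indicator \<Omega> x *\<^sub>R f x\<bar> powr p))"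
  proof (rule integrableI_bounded_set_indicator[where B="B powr p"])
    show "AE x in lebesgue. x \<in> \<Omega> \<longrightarrow> norm (\<bar>indicator \<Omega> x *\<^sub>R f x\<bar> powr p) \<le> B powr p"
      using B p by (intro AE_I2) (auto intro!: powr_mono2)
  qed (use fin in auto)
  also have "(\<lambda>x. indicator \<Omega> x *\<^sub>R (\<bar>indicator \<Omega> x *\<^sub>R f x\<bar> powr p)) = (\<lambda>x. indicator \<Omega> x *\<^sub>R (\<bar>f x\<bar> powr p))"
    by (auto simp: indicator_def fun_eq_iff)
  finally show "set_integrable lebesgue \<Omega> (\<lambda>x. \<bar>f x\<bar> powr p)" by (simp add: set_integrable_def)
qed

lemma locally_integrable_if_bounded:
  fixes \<Omega> :: "'a::euclidean_space set"
  assumes \<Omega>: "open \<Omega>" "bounded \<Omega>" and m: "set_borel_measurable lebesgue \<Omega> f" 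
    and B: "\<And>x. x \<in> \<Omega> \<Longrightarrow> \<bar>f x\<bar> \<le> B"
  shows "locally_integrable \<Omega> f"
  unfolding locally_integrable_def set_integrable_def
proof (intro allI impI)
  fix K assume K: "compact K \<and> K \<subseteq> \<Omega>"
  have [measurable]: "(\<lambda>x. indicator \<Omega> x *\<^sub>R f x) \<in> borel_measurable lebesgue" "(\<lambda>x. indicator \<Omega> x * f x) \<in> borel_measurable lebesgue"
    using m by (simp_all add: set_borel_measurable_def)
  have [measurable]: "K \<in> sets lebesgue" using K by (simp add: borel_compact)
  have "integrable lebesgue (\<lambda>x. indicator K x *\<^sub>R (indicator \<Omega> x *\<^sub>R f x))"
  proof (rule integrableI_bounded_set_indicator[where B=B])
    show "emeasure lebesgue K < \<infinity>" using K emeasure_compact_finite[of K] by (simp add: borel_compact)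
    show "AE x in lebesgue. x \<in> K \<longrightarrow> norm (indicator \<Omega> x *\<^sub>R f x) \<le> B"
      using B K by (intro AE_I2) auto
  qed auto
  also have "(\<lambda>x. indicator K x *\<^sub>R (indicator \<Omega> x *\<^sub>R f x)) = (\<lambda>x. indicator K x *\<^sub>R f x)"
    using K by (auto simp: indicator_def fun_eq_iff)
  finally show "integrable lebesgue (\<lambda>x. indicator K x *\<^sub>R f x)" .
qed

text \<open>
The gradient is a pointwise limit of difference quotients. As \<open>v\<close> is arbitrary outside \<open>\<Omega>\<close>, the quotients
are formed with \<open>v\<close> cut off outside \<open>\<Omega>\<close>; since \<open>\<Omega>\<close> is open this does not affect the limit.
\<close>

lemma gradient_measurable:
  fixes v :: "'a::euclidean_space \<Rightarrow> real"
  assumes \<Omega>: "open \<Omega>" and der: "\<And>x. x \<in> \<Omega> \<Longrightarrow> (v has_derivative (\<lambda>h. G x \<bullet> h)) (at x)"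
  shows "(\<lambda>x. indicator \<Omega> x * v x) \<in> borel_measurable borel" 
    and "(\<lambda>x. indicator \<Omega> x * (G x \<bullet> i)) \<in> borel_measurable borel"
proof -
  have cv: "continuous_on \<Omega> v" using der by (meson has_derivative_continuous continuous_at_imp_continuous_on)
  show vm: "(\<lambda>x. indicator \<Omega> x * v x) \<in> borel_measurable borel"
    using borel_measurable_continuous_on_indicator[OF borel_open[OF \<Omega>] cv] by simp
  define w where "w x = indicator \<Omega> x * v x" for x
  have [measurable]: "w \<in> borel_measurable borel" "\<Omega> \<in> sets borel" using vm \<Omega> by (auto simp: w_def[abs_def])
  have "(\<lambda>n. indicator \<Omega> x * (real (Suc n) * (w (x + inverse (real (Suc n)) *\<^sub>R i) - w x))) \<longlonglongrightarrow> indicator \<Omega> x * (G x \<bullet> i)" for x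
  proof (cases "x \<in> \<Omega>")
    case True
    have "(w has_derivative (\<lambda>h. G x \<bullet> h)) (at x)"
      by (rule has_derivative_transform_within_open[OF der[OF True] \<Omega> True]) (simp add: w_def)
    from difference_quotient_LIMSEQ[OF this, of i] show ?thesis by (intro tendsto_mult tendsto_const)
  qed simp
  then show "(\<lambda>x. indicator \<Omega> x * (G x \<bullet> i)) \<in> borel_measurable borel"
    by (rule borel_measurable_LIMSEQ_real) measurable
qed

lemma set_borel_measurable_lebesgueI:
  fixes f :: "'a::euclidean_space \<Rightarrow> real"
  shows "(\<lambda>x. indicator \<Omega> x * f x) \<in> borel_measurable borel \<Longrightarrow> set_borel_measurable lebesgue \<Omega> f"
  by (simp add: set_borel_measurable_def measurable_completion)

text \<open>
The product of \<open>v\<close> with a test function, extended by zero, is differentiable on the whole space with bounded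
gradient, so \<open>integral_directional_derivative_eq_0\<close> applies to it and the product rule gives integration by parts.
\<close>

lemma is_weak_partial_if_differentiable:
  fixes v :: "'a::euclidean_space \<Rightarrow> real"
  assumes \<Omega>: "open \<Omega>" "bounded \<Omega>" and der: "\<And>x. x \<in> \<Omega> \<Longrightarrow> (v has_derivative (\<lambda>h. G x \<bullet> h)) (at x)"
    and B: "\<And>x. x \<in> \<Omega> \<Longrightarrow> norm (G x) \<le> B" "\<And>x. x \<in> \<Omega> \<Longrightarrow> \<bar>v x\<bar> \<le> B" and i: "i \<in> Basis"
  shows "is_weak_partial \<Omega> i v (\<lambda>x. G x \<bullet> i)"
  unfolding is_weak_partial_def
proof (intro conjI allI impI)
  note [measurable] = gradient_measurable(1)[OF \<Omega>(1) der] gradient_measurable(2)[OF \<Omega>(1) der, of i]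
  have Bi: "\<bar>G x \<bullet> i\<bar> \<le> B" if "x \<in> \<Omega>" for x
    using B(1)[OF that] Basis_le_norm[OF i] order_trans by blast
  show "locally_integrable \<Omega> v" "locally_integrable \<Omega> (\<lambda>x. G x \<bullet> i)"
    using B(2) Bi by (auto intro!: locally_integrable_if_bounded[where B=B] \<Omega> set_borel_measurable_lebesgueI)
  fix \<phi> assume "test_function \<Omega> \<phi>"
  then obtain K where K: "compact K" "K \<subseteq> \<Omega>" "smooth_on_supp K \<phi>" by (auto simp: test_function_smooth_on_supp)
  have S: "smooth_on_supp K (partial_deriv i \<phi>)"
    by (rule smooth_on_supp_partial_deriv[OF K(3) compact_imp_closed[OF K(1)] i])
  have d\<phi>: "(\<phi> has_derivative (\<lambda>h. grad \<phi> x \<bullet> h)) (at x)" for x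
    using K(3) has_derivative_grad[of 0 \<phi> x] by (auto simp: smooth_on_supp_def)
  obtain B1 where B1: "\<And>x. \<bar>\<phi> x\<bar> \<le> B1" using smooth_on_supp_bounded[OF K(3,1)] by metis
  obtain B2 where B2: "\<And>x. norm (grad \<phi> x) \<le> B2" using smooth_on_supp_grad_bounded[OF K(3,1)] by metis
  have [measurable]: "\<phi> \<in> borel_measurable borel" "partial_deriv i \<phi> \<in> borel_measurable borel" "\<Omega> \<in> sets borel"
    using smooth_on_supp_continuous[OF K(3)] smooth_on_supp_continuous[OF S] \<Omega>(1) by (auto intro: borel_measurable_continuous_onI)
  have z: "\<phi> x = 0" "partial_deriv i \<phi> x = 0" if "x \<notin> K" for x using that K(3) S by (auto simp: smooth_on_supp_def)
  define f where "f x = indicator \<Omega> x * v x * \<phi> x" for x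
  define H where "H x = (if x \<in> K then v x *\<^sub>R grad \<phi> x + \<phi> x *\<^sub>R G x else 0)" for x
  have derf: "(f has_derivative (\<lambda>h. H x \<bullet> h)) (at x)" for x
  proof (cases "x \<in> K")
    case True
    have "((\<lambda>x. v x * \<phi> x) has_derivative (\<lambda>h. H x \<bullet> h)) (at x)"
      using has_derivative_mult[OF der[of x] d\<phi>[of x]] True K(2)
      by (auto simp: H_def inner_add_left mult.commute)
    then show ?thesis
      by (rule has_derivative_transform_within_open[OF _ \<Omega>(1)]) (use True K in \<open>auto simp: f_def\<close>)
  next
    case False
    have "((\<lambda>x. 0) has_derivative (\<lambda>h. H x \<bullet> h)) (at x)" using False by (simp add: H_def)
    then show ?thesis
      by (rule has_derivative_transform_within_open[where s="- K"]) (use False K z in \<open>auto simp: f_def compact_imp_closed open_Compl\<close>)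
  qed
  have "norm (H x) \<le> \<bar>B\<bar> * \<bar>B2\<bar> + \<bar>B1\<bar> * \<bar>B\<bar>" for x
  proof (cases "x \<in> K")
    case True
    then have x: "x \<in> \<Omega>" using K by auto
    have "norm (H x) \<le> \<bar>v x\<bar> * norm (grad \<phi> x) + \<bar>\<phi> x\<bar> * norm (G x)"
      using True norm_triangle_ineq[of "v x *\<^sub>R grad \<phi> x" "\<phi> x *\<^sub>R G x"] by (simp add: H_def)
    also have "\<dots> \<le> \<bar>B\<bar> * \<bar>B2\<bar> + \<bar>B1\<bar> * \<bar>B\<bar>"
      using B(1)[OF x] B(2)[OF x] B1[of x] B2[of x] by (intro add_mono mult_mono) auto
    finally show ?thesis .
  qed (simp add: H_def)
  from integral_directional_derivative_eq_0[OF derf this compact_imp_bounded[OF K(1)], of i]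
  have I: "integrable lborel (\<lambda>x. H x \<bullet> i)" "(LINT x|lborel. H x \<bullet> i) = 0" by (auto simp: f_def z)
  define F1 where "F1 x = indicator \<Omega> x * v x * partial_deriv i \<phi> x" for x
  define F2 where "F2 x = indicator \<Omega> x * (G x \<bullet> i) * \<phi> x" for x
  have [measurable]: "F1 \<in> borel_measurable borel" "F2 \<in> borel_measurable borel"
    unfolding F1_def F2_def by measurable
  have Heq: "H x \<bullet> i = F1 x + F2 x" for x
    using K(2) z[of x] i by (auto simp: H_def F1_def F2_def inner_add_left grad_inner_Basis indicator_def)
  have "integrable lborel F2"
  proof (rule integrable_bounded_support[OF _ _ compact_imp_bounded[OF K(1)]])
    show "\<bar>F2 x\<bar> \<le> \<bar>B\<bar> * \<bar>B1\<bar>" for x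
    proof (cases "x \<in> \<Omega>")
      case True
      have "\<bar>G x \<bullet> i\<bar> * \<bar>\<phi> x\<bar> \<le> \<bar>B\<bar> * \<bar>B1\<bar>" using Bi[OF True] B1[of x] by (intro mult_mono) auto
      then show ?thesis using True by (simp add: F2_def abs_mult)
    qed (simp add: F2_def)
  qed (auto simp: F2_def z)
  moreover have "integrable lborel (\<lambda>x. F1 x + F2 x)" using I(1) by (simp add: Heq)
  ultimately have "integrable lborel F1" "integrable lborel F2" "(LINT x|lborel. F1 x + F2 x) = 0"
    using Bochner_Integration.integrable_diff[of lborel "\<lambda>x. F1 x + F2 x" F2] I(2) by (auto simp: Heq)
  then have "(LINT x|lborel. F1 x) = - (LINT x|lborel. F2 x)" by simp
  moreover have "(LINT x:\<Omega>|lebesgue. v x * partial_deriv i \<phi> x) = (LINT x|lborel. F1 x)"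
    using LINT_lebesgue_eq_lborel(1)[of F1] by (simp add: set_lebesgue_integral_def F1_def mult.assoc)
  moreover have "(LINT x:\<Omega>|lebesgue. G x \<bullet> i * \<phi> x) = (LINT x|lborel. F2 x)"
    using LINT_lebesgue_eq_lborel(1)[of F2] by (simp add: set_lebesgue_integral_def F2_def mult.assoc)
  ultimately show "(LINT x:\<Omega>|lebesgue. v x * partial_deriv i \<phi> x) = - (LINT x:\<Omega>|lebesgue. (G x \<bullet> i) * \<phi> x)"
    by simp
qed

section \<open>Mollifiers and uniqueness of weak derivatives\<close>

definition mollifier :: "real \<Rightarrow> 'a::euclidean_space \<Rightarrow> real" where
  "mollifier r x = bump 0 r x / (LINT w|lborel. bump (0::'a) r w)"

lemma smooth_on_supp_bump: "r > 0 \<Longrightarrow> smooth_on_supp (cball c r) (bump c r)"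
  by (auto simp: smooth_on_supp_def C_k_bump dist_norm norm_minus_commute intro!: bump_eq_0)

lemma bump_shift: "bump c r x = bump 0 r (x - c)"
  by (simp add: bump_def)

lemma integrable_bump: "r > 0 \<Longrightarrow> integrable lborel (bump (c::'a::euclidean_space) r)"
proof -
  assume r: "r > 0"
  have S: "smooth_on_supp (cball c r) (bump c r)" by (rule smooth_on_supp_bump[OF r])
  obtain B where B: "\<And>x. \<bar>bump c r x\<bar> \<le> B" using smooth_on_supp_bounded[OF S compact_cball] by metis
  have "bump c r \<in> borel_measurable borel"
    using smooth_on_supp_continuous[OF S] by (rule borel_measurable_continuous_onI)
  then show ?thesis
    by (rule integrable_bounded_support[OF _ B bounded_cball[of c r]]) (use S in \<open>auto simp: smooth_on_supp_def\<close>)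
qed

lemma integral_bump_pos: "r > 0 \<Longrightarrow> (LINT w|lborel. bump (0::'a::euclidean_space) r w) > 0"
proof -
  assume r: "r > 0"
  let ?A = "cball (0::'a) (r / 2)"
  have fin: "emeasure lborel ?A < \<infinity>" using emeasure_bounded_finite[of ?A] by simp
  have "0 < exp (- (4/3)) * measure lborel ?A"
    using content_cball_pos[of "r/2" "0::'a"] r by simp
  also have "\<dots> = (LINT w|lborel. indicator ?A w *\<^sub>R exp (- (4/3)))"
    using fin by simp
  also have "\<dots> \<le> (LINT w|lborel. bump (0::'a) r w)"
  proof (rule integral_mono)
    show "integrable lborel (\<lambda>w. indicator ?A w *\<^sub>R exp (- (4/3::real)))"
      using fin by (auto intro!: integrable_real_indicator integrable_mult_left)
    fix w :: 'a
    show "indicator ?A w *\<^sub>R exp (- (4/3)) \<le> bump 0 r w"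
    proof (cases "w \<in> ?A")
      case True
      then have "(norm w)\<^sup>2 \<le> (r/2)\<^sup>2" by (intro power_mono) auto
      then have *: "(norm w)\<^sup>2 / r\<^sup>2 \<le> 1/4" using r by (simp add: field_simps)
      \<comment> \<open>On the half-radius ball the bump is at least its value at the boundary of that ball.\<close>
      have "1 / (1 - (norm w)\<^sup>2 / r\<^sup>2) \<le> 1 / (3/4)"
        using * by (intro divide_left_mono) auto
      moreover have "(norm w)\<^sup>2 / r\<^sup>2 < 1" using * by linarith
      ultimately show ?thesis using True by (simp add: bump_def flat_1)
    qed (simp add: bump_nonneg)
  qed (rule integrable_bump[OF r])
  finally show ?thesis .
qed

lemma mollifier_props:
  assumes r: "r > 0"
  shows mollifier_nonneg: "mollifier r (x::'a::euclidean_space) \<ge> 0"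
    and mollifier_supp: "mollifier r x \<noteq> 0 \<Longrightarrow> norm x < r"
    and mollifier_integrable: "integrable lborel (mollifier r :: 'a \<Rightarrow> real)"
    and "(LINT x|lborel. mollifier r (x::'a)) = 1"
    and mollifier_smooth: "smooth_on_supp (cball c r) (\<lambda>z::'a. mollifier r (z - c))"
proof -
  note pos = integral_bump_pos[OF r, where 'a='a]
  show "mollifier r x \<ge> 0" using pos by (simp add: mollifier_def bump_nonneg)
  show "mollifier r x \<noteq> 0 \<Longrightarrow> norm x < r" using bump_eq_0[OF r, of x 0] by (auto simp: mollifier_def not_le[symmetric])
  show "integrable lborel (mollifier r :: 'a \<Rightarrow> real)"
    unfolding mollifier_def[abs_def] by (intro integrable_divide integrable_bump r)
  show "(LINT x|lborel. mollifier r (x::'a)) = 1"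
    using pos by (simp add: mollifier_def[abs_def])
  have eq: "(\<lambda>z. mollifier r (z - c)) = (\<lambda>z. inverse (LINT w|lborel. bump (0::'a) r w) * bump c r z)"
    by (auto simp: mollifier_def fun_eq_iff bump_shift[of c] divide_inverse)
  show "smooth_on_supp (cball c r) (\<lambda>z::'a. mollifier r (z - c))"
    unfolding eq using smooth_on_supp_bump[OF r, of c]
    by (auto simp: smooth_on_supp_def intro!: C_k_mult C_k_const)
qed

lemma mollifier_bounded: 
  assumes r: "r > 0" obtains B where "\<And>x::'a::euclidean_space. mollifier r x \<le> B"
proof -
  have "smooth_on_supp (cball 0 r) (mollifier r :: 'a \<Rightarrow> real)" using mollifier_smooth[OF r, of 0] by simp
  from smooth_on_supp_bounded[OF this compact_cball] show ?thesis using that abs_le_iff by metis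
qed

lemma mollifier_measurable [measurable]: "r > 0 \<Longrightarrow> (mollifier r :: 'a::euclidean_space \<Rightarrow> real) \<in> borel_measurable borel"
  using mollifier_integrable[of r, where 'a='a] by auto

text \<open>
If all averages of \<open>g\<close> at small scales vanish on \<open>A\<close>, then the \<open>L\<^sup>1\<close> distance of \<open>g\<close> from its averages
bounds the integral of \<open>\<bar>g\<bar>\<close> over \<open>A\<close>, and it is arbitrarily small.
\<close>

lemma mollify_L1_zero:
  fixes g :: "'a::euclidean_space \<Rightarrow> real"
  assumes g: "integrable lborel g" and r: "r > 0"
    and zero: "\<And>x \<epsilon>. x \<in> A \<Longrightarrow> 0 < \<epsilon> \<Longrightarrow> \<epsilon> < r \<Longrightarrow> (LINT z|lborel. g z * mollifier \<epsilon> (z - x)) = 0"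
    and A[measurable]: "A \<in> sets borel"
  shows "AE x in lborel. x \<in> A \<longrightarrow> g x = 0"
proof -
  have [measurable]: "g \<in> borel_measurable borel" using g by auto
  have le: "(\<integral>\<^sup>+x. ennreal \<bar>indicator A x * g x\<bar> \<partial>lborel) \<le> ennreal e" if e: "e > 0" for e
  proof -
    obtain d where d: "d > 0" "\<And>z. norm z < d \<Longrightarrow> (\<integral>\<^sup>+x. ennreal \<bar>g (x + z) - g x\<bar> \<partial>lborel) \<le> ennreal e"
      using shift_continuous_L1D[OF shift_continuous_L1_integrable[OF g] e] by metis
    define \<epsilon> where "\<epsilon> = min d r / 2"
    have \<epsilon>: "0 < \<epsilon>" "\<epsilon> < d" "\<epsilon> < r" using d r by (auto simp: \<epsilon>_def)
    obtain B where B: "\<And>x::'a. mollifier \<epsilon> x \<le> B" using mollifier_bounded[OF \<epsilon>(1)] by metis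
    have "pmass 1 (\<lambda>x. (LINT z|lborel. g z * mollifier \<epsilon> (z - x)) - g x) \<le> ennreal e"
    proof (rule pmass_average_le[where d=\<epsilon> and B=B])
      show "pmass 1 (\<lambda>x. g (x + z) - g x) \<le> ennreal e" if "norm z < \<epsilon>" for z
        using d(2)[of z] that \<epsilon> by (simp add: pmass_def)
    qed (use g \<epsilon> B mollifier_props[OF \<epsilon>(1)] in auto)
    moreover have "(\<integral>\<^sup>+x. ennreal \<bar>indicator A x * g x\<bar> \<partial>lborel) \<le> pmass 1 (\<lambda>x. (LINT z|lborel. g z * mollifier \<epsilon> (z - x)) - g x)"
      unfolding pmass_def using zero[OF _ \<epsilon>(1,3)]
      by (intro nn_integral_mono) (auto simp: indicator_def)
    ultimately show ?thesis by order
  qed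
  have "(\<integral>\<^sup>+x. ennreal \<bar>indicator A x * g x\<bar> \<partial>lborel) = 0"
  proof (rule ccontr)
    assume "(\<integral>\<^sup>+x. ennreal \<bar>indicator A x * g x\<bar> \<partial>lborel) \<noteq> 0"
    then have "0 < (\<integral>\<^sup>+x. ennreal \<bar>indicator A x * g x\<bar> \<partial>lborel)" by (simp add: zero_less_iff_neq_zero)
    then obtain m where m: "0 < m" "m < (\<integral>\<^sup>+x. ennreal \<bar>indicator A x * g x\<bar> \<partial>lborel)"
      using dense by blast
    then obtain e where "m = ennreal e" "e \<ge> 0" by (cases m) auto
    then have "0 < e" "ennreal e < (\<integral>\<^sup>+x. ennreal \<bar>indicator A x * g x\<bar> \<partial>lborel)" using m by auto
    then show False using le[of e] by (simp add: not_le[symmetric])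
  qed
  then have "AE x in lborel. ennreal \<bar>indicator A x * g x\<bar> = 0"
    by (subst (asm) nn_integral_0_iff_AE) auto
  then show ?thesis by eventually_elim auto
qed

lemma locally_integrable_mult_smooth:
  assumes f: "locally_integrable \<Omega> f" and K: "compact K" "K \<subseteq> \<Omega>" "smooth_on_supp K \<phi>"
  shows "set_integrable lebesgue \<Omega> (\<lambda>x. f x * \<phi> x)"
proof -
  obtain B where B: "\<And>x. \<bar>\<phi> x\<bar> \<le> B" using smooth_on_supp_bounded[OF K(3,1)] by metis
  have fK: "integrable lebesgue (\<lambda>x. indicator K x * f x)"
    using f K by (simp add: locally_integrable_def set_integrable_def)
  have "\<phi> \<in> borel_measurable borel" 
    using smooth_on_supp_continuous[OF K(3)] by (rule borel_measurable_continuous_onI)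
  then have [measurable]: "\<phi> \<in> borel_measurable lebesgue" by (simp add: measurable_completion)
  have "integrable lebesgue (\<lambda>x. (indicator K x * f x) * \<phi> x)"
  proof (rule Bochner_Integration.integrable_bound[where f="\<lambda>x. B * (indicator K x * f x)"])
    show "AE x in lebesgue. norm ((indicator K x * f x) * \<phi> x) \<le> norm (B * (indicator K x * f x))"
    proof (intro AE_I2)
      fix x show "norm ((indicator K x * f x) * \<phi> x) \<le> norm (B * (indicator K x * f x))"
        using B[of x] by (auto simp: abs_mult mult.commute[of B] indicator_def intro!: mult_left_mono)
    qed
  qed (use fK in auto)
  also have "(\<lambda>x. (indicator K x * f x) * \<phi> x) = (\<lambda>x. indicator \<Omega> x *\<^sub>R (f x * \<phi> x))"
    using K(2,3) by (auto simp: fun_eq_iff indicator_def smooth_on_supp_def)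
  finally show ?thesis by (simp add: set_integrable_def)
qed

text \<open>
The fundamental lemma of the calculus of variations. The claim is local because negligibility is; near a point
the mollifiers are themselves test functions, so the averages of \<open>f\<close> vanish. Averages of Lebesgue measurable
functions are computed through a Borel representative, as Tonelli's theorem lives on the Borel product.
\<close>

lemma AE_zero_if_orthogonal_test_functions:
  fixes f :: "'a::euclidean_space \<Rightarrow> real"
  assumes \<Omega>: "open \<Omega>" and f: "locally_integrable \<Omega> f"
    and orth: "\<And>\<phi>. test_function \<Omega> \<phi> \<Longrightarrow> (LINT x:\<Omega>|lebesgue. f x * \<phi> x) = 0"
  shows "AE x in lebesgue. x \<in> \<Omega> \<longrightarrow> f x = 0"
proof -
  let ?S = "{x \<in> \<Omega>. f x \<noteq> 0}"
  have "\<exists>U. openin (top_of_set ?S) U \<and> x \<in> U \<and> negligible U" if x: "x \<in> ?S" for x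
  proof -
    obtain r0 where r0: "r0 > 0" "cball x r0 \<subseteq> \<Omega>" using \<Omega> x open_contains_cball by blast
    define r where "r = r0 / 2"
    let ?K = "cball x (2 * r)"
    have r: "r > 0" "?K \<subseteq> \<Omega>" using r0 by (auto simp: r_def)
    have I: "integrable lebesgue (\<lambda>x. indicator ?K x * f x)"
      using f r(2) by (simp add: locally_integrable_def set_integrable_def)
    then obtain g where g[measurable]: "g \<in> borel_measurable lborel" and geq: "AE x in lborel. indicator ?K x * f x = g x"
      using completion_ex_borel_measurable_real borel_measurable_integrable by blast
    have geq': "AE x in lebesgue. indicator ?K x * f x = g x" using geq by (rule AE_completion)
    have gm: "g \<in> borel_measurable lebesgue" using g by (rule measurable_completion)
    have "integrable lebesgue g" using I geq' gm integrable_cong_AE borel_measurable_integrable by blast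
    then have ig: "integrable lborel g" using LINT_lebesgue_eq_lborel(2)[of g] g by simp
    have zero: "(LINT z|lborel. g z * mollifier \<epsilon> (z - y)) = 0" if y: "y \<in> ball x r" and \<epsilon>: "0 < \<epsilon>" "\<epsilon> < r" for y \<epsilon>
    proof -
      have sm: "smooth_on_supp (cball y \<epsilon>) (\<lambda>z. mollifier \<epsilon> (z - y))" by (rule mollifier_smooth[OF \<epsilon>(1)])
      have sub: "cball y \<epsilon> \<subseteq> ?K"
      proof
        fix z assume "z \<in> cball y \<epsilon>"
        then show "z \<in> ?K" using y \<epsilon> dist_triangle[of x z y] by auto
      qed
      have z0: "mollifier \<epsilon> (z - y) = 0" if "z \<notin> ?K" for z
        using sm subsetD[OF sub, of z] that unfolding smooth_on_supp_def by blast
      have [measurable]: "(\<lambda>z. mollifier \<epsilon> (z - y)) \<in> borel_measurable borel"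
        using mollifier_measurable[OF \<epsilon>(1)] by measurable
      have m1: "(\<lambda>z. mollifier \<epsilon> (z - y)) \<in> borel_measurable lebesgue" by (intro measurable_completion) simp
      have "(LINT z|lborel. g z * mollifier \<epsilon> (z - y)) = (LINT z|lebesgue. g z * mollifier \<epsilon> (z - y))"
        using g by (subst LINT_lebesgue_eq_lborel(1)) auto
      also have "\<dots> = (LINT z|lebesgue. indicator ?K z * f z * mollifier \<epsilon> (z - y))"
      proof (rule integral_cong_AE)
        show "AE z in lebesgue. g z * mollifier \<epsilon> (z - y) = indicator ?K z * f z * mollifier \<epsilon> (z - y)"
          using geq' by eventually_elim simp
      qed (use gm m1 borel_measurable_integrable[OF I] in \<open>auto intro!: borel_measurable_times\<close>)
      also have "\<dots> = (LINT z:\<Omega>|lebesgue. f z * mollifier \<epsilon> (z - y))"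
        unfolding set_lebesgue_integral_def using r(2) z0
        by (intro Bochner_Integration.integral_cong) (auto simp: indicator_def)
      also have "\<dots> = 0"
        by (rule orth) (use sm sub r(2) compact_cball in \<open>unfold test_function_smooth_on_supp, blast\<close>)
      finally show ?thesis .
    qed
    have "AE z in lborel. z \<in> ball x r \<longrightarrow> g z = 0"
      by (rule mollify_L1_zero[OF ig r(1) zero]) auto
    then have "AE z in lebesgue. z \<in> ball x r \<longrightarrow> g z = 0" by (rule AE_completion)
    then have "AE z in lebesgue. z \<in> ball x r \<longrightarrow> f z = 0"
      using geq' by eventually_elim (use r(1) in \<open>auto simp: indicator_def split: if_splits\<close>)
    then obtain N where N: "N \<in> null_sets lebesgue" "{z \<in> space lebesgue. \<not> (z \<in> ball x r \<longrightarrow> f z = 0)} \<subseteq> N"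
      unfolding eventually_ae_filter by blast
    then have "negligible N" by (simp add: negligible_iff_null_sets)
    then have "negligible (?S \<inter> ball x r)" by (rule negligible_subset) (use N(2) in auto)
    then show ?thesis using r(1) x by (intro exI[of _ "?S \<inter> ball x r"]) auto
  qed
  then have "negligible ?S" by (subst locally_negligible_alt) auto
  then have "?S \<in> null_sets lebesgue" by (simp add: negligible_iff_null_sets)
  then show ?thesis by (rule AE_I') auto
qed

lemma weak_partial_AE_unique:
  fixes u :: "'a::euclidean_space \<Rightarrow> real"
  assumes \<Omega>: "open \<Omega>" and v: "is_weak_partial \<Omega> i u v" and w: "is_weak_partial \<Omega> i u w"
  shows "AE x in lebesgue. x \<in> \<Omega> \<longrightarrow> v x = w x"
proof -
  have L: "locally_integrable \<Omega> v" "locally_integrable \<Omega> w" using v w by (auto simp: is_weak_partial_def)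
  then have "locally_integrable \<Omega> (\<lambda>x. v x - w x)" by (auto simp: locally_integrable_def)
  moreover have "(LINT x:\<Omega>|lebesgue. (v x - w x) * \<phi> x) = 0" if t: "test_function \<Omega> \<phi>" for \<phi>
  proof -
    obtain K where K: "compact K" "K \<subseteq> \<Omega>" "smooth_on_supp K \<phi>" using t by (auto simp: test_function_smooth_on_supp)
    have "(LINT x:\<Omega>|lebesgue. (v x - w x) * \<phi> x) = (LINT x:\<Omega>|lebesgue. v x * \<phi> x) - (LINT x:\<Omega>|lebesgue. w x * \<phi> x)"
      unfolding left_diff_distrib
      by (rule set_integral_diff(2)[OF locally_integrable_mult_smooth[OF L(1) K] locally_integrable_mult_smooth[OF L(2) K]])
    also have "\<dots> = 0" using v w t unfolding is_weak_partial_def by auto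
    finally show ?thesis .
  qed
  ultimately have "AE x in lebesgue. x \<in> \<Omega> \<longrightarrow> v x - w x = 0"
    by (rule AE_zero_if_orthogonal_test_functions[OF \<Omega>])
  then show ?thesis by eventually_elim auto
qed

lemma weak_partial_AE_eq:
  fixes u :: "'a::euclidean_space \<Rightarrow> real"
  assumes \<Omega>: "open \<Omega>" and v: "is_weak_partial \<Omega> i u v"
  shows "AE x in lebesgue. x \<in> \<Omega> \<longrightarrow> weak_partial \<Omega> i u x = v x"
proof -
  have "is_weak_partial \<Omega> i u (weak_partial \<Omega> i u)" unfolding weak_partial_def by (rule someI[where P="is_weak_partial \<Omega> i u", OF v])
  from weak_partial_AE_unique[OF \<Omega> this v] show ?thesis .
qed

section \<open>Pairs of a function and its weak gradient\<close>

lemma pmass_mult_bounded: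
  assumes [measurable]: "f \<in> borel_measurable borel" and p: "p \<ge> 0" and B: "\<And>x. \<bar>g x\<bar> \<le> B"
  shows "pmass p (\<lambda>x. g x * f x) \<le> ennreal (B powr p) * pmass p f"
proof -
  have "\<bar>g x * f x\<bar> powr p \<le> B powr p * \<bar>f x\<bar> powr p" for x
  proof -
    have "\<bar>g x * f x\<bar> powr p = \<bar>g x\<bar> powr p * \<bar>f x\<bar> powr p" by (simp add: abs_mult powr_mult)
    also have "\<dots> \<le> B powr p * \<bar>f x\<bar> powr p" using B[of x] p by (intro mult_right_mono powr_mono2) auto
    finally show ?thesis .
  qed
  then have "pmass p (\<lambda>x. g x * f x) \<le> (\<integral>\<^sup>+x. ennreal (B powr p) * ennreal (\<bar>f x\<bar> powr p) \<partial>lborel)"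
    unfolding pmass_def by (intro nn_integral_mono) (auto simp flip: ennreal_mult intro!: ennreal_leI)
  also have "\<dots> = ennreal (B powr p) * pmass p f"
    unfolding pmass_def by (rule nn_integral_cmult) simp
  finally show ?thesis .
qed

lemma pmass_add_finite:
  assumes "f \<in> borel_measurable borel" "g \<in> borel_measurable borel" "p \<ge> 0" "pmass p f < \<infinity>" "pmass p g < \<infinity>"
  shows "pmass p (\<lambda>x. f x + g x) < \<infinity>"
  using pmass_add[OF assms(1-3)] assms(4,5) by (simp add: le_less_trans ennreal_mult_less_top)

lemma pmass_mult_bounded_finite:
  assumes "f \<in> borel_measurable borel" "p \<ge> 0" "\<And>x. \<bar>g x\<bar> \<le> B" "pmass p f < \<infinity>"
  shows "pmass p (\<lambda>x. g x * f x) < \<infinity>"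
  using pmass_mult_bounded[OF assms(1,2), of g B] assms(3,4) by (simp add: le_less_trans ennreal_mult_less_top)

lemma pmass_mono: "p \<ge> 0 \<Longrightarrow> (\<And>x. \<bar>f x\<bar> \<le> \<bar>g x\<bar>) \<Longrightarrow> pmass p f \<le> pmass p g"
  unfolding pmass_def by (intro nn_integral_mono ennreal_leI powr_mono2) auto

lemma integrable_if_pmass_finite:
  fixes f :: "'a::euclidean_space \<Rightarrow> real"
  assumes [measurable]: "f \<in> borel_measurable borel" and p: "p \<ge> 1" and fin: "pmass p f < \<infinity>"
    and S: "bounded S" "\<And>x. x \<notin> S \<Longrightarrow> f x = 0"
  shows "integrable lborel f"
proof (rule integrableI_bounded)
  obtain r where r: "\<And>x. x \<in> S \<Longrightarrow> norm x \<le> r" using S(1) unfolding bounded_iff by blast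
  let ?C = "cball (0::'a) r"
  have "(\<integral>\<^sup>+x. ennreal (norm (f x)) \<partial>lborel) \<le> (\<integral>\<^sup>+x. indicator ?C x + ennreal (\<bar>f x\<bar> powr p) \<partial>lborel)"
  proof (rule nn_integral_mono)
    fix x
    show "ennreal (norm (f x)) \<le> indicator ?C x + ennreal (\<bar>f x\<bar> powr p)"
    proof (cases "\<bar>f x\<bar> \<le> 1")
      case True
      show ?thesis
      proof (cases "x \<in> S")
        case xS: True
        then have "indicator ?C x = (1::ennreal)" using r by simp
        moreover have "ennreal (norm (f x)) \<le> 1" using True by (simp add: ennreal_le_1)
        ultimately show ?thesis by (simp add: add_increasing2)
      qed (simp add: S)
    next
      case False
      then have "\<bar>f x\<bar> powr 1 \<le> \<bar>f x\<bar> powr p" using p by (intro powr_mono) auto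
      then have "ennreal (norm (f x)) \<le> 0 + ennreal (\<bar>f x\<bar> powr p)" using False by (auto intro!: ennreal_leI)
      then show ?thesis by (rule order_trans) (intro add_mono, auto)
    qed
  qed
  also have "\<dots> = emeasure lborel ?C + pmass p f"
    unfolding pmass_def by (subst nn_integral_add) (auto intro!: borel_measurable_indicator)
  also have "\<dots> < \<infinity>" using emeasure_bounded_finite[of ?C] fin by simp
  finally show "(\<integral>\<^sup>+x. ennreal (norm (f x)) \<partial>lborel) < \<infinity>" .
qed simp

text \<open>
\<open>L\<^sup>p(\<Omega>)\<close> in the form suited to averaging: Borel measurability is what Tonelli's theorem asks for, and the
extension by zero gives a meaning to shifts.
\<close>

definition Lp_supp :: "real \<Rightarrow> 'a::euclidean_space set \<Rightarrow> ('a \<Rightarrow> real) \<Rightarrow> bool" where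
  "Lp_supp p \<Omega> f \<longleftrightarrow> f \<in> borel_measurable borel \<and> (\<forall>x. x \<notin> \<Omega> \<longrightarrow> f x = 0) \<and> pmass p f < \<infinity>"

text \<open>
\<open>U \<in> W\<^sup>1\<^sup>,\<^sup>p(\<Omega>)\<close> with the weak partial derivatives \<open>V i\<close>, all extended by zero. The pair is carried along
explicitly because the localised functions must be approximated together with these derivatives, and
the zero extension of \<open>U\<close> has in general no weak derivative across the boundary of \<open>\<Omega>\<close>.
\<close>

definition sobolev_pair :: "real \<Rightarrow> 'a::euclidean_space set \<Rightarrow> ('a \<Rightarrow> real) \<Rightarrow> ('a \<Rightarrow> 'a \<Rightarrow> real) \<Rightarrow> bool" where
  "sobolev_pair p \<Omega> U V \<longleftrightarrow> Lp_supp p \<Omega> U \<and> (\<forall>i\<in>Basis. Lp_supp p \<Omega> (V i) \<and>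
     (\<forall>\<phi>. test_function \<Omega> \<phi> \<longrightarrow> (LINT x|lborel. U x * partial_deriv i \<phi> x) = - (LINT x|lborel. V i x * \<phi> x)))"

lemma integrable_mult_smooth_on_supp:
  assumes U: "integrable lborel U" and K: "smooth_on_supp K \<phi>" "compact K"
  shows "integrable lborel (\<lambda>x. U x * \<phi> x)"
proof -
  obtain B where B: "\<And>x. \<bar>\<phi> x\<bar> \<le> B" using smooth_on_supp_bounded[OF K] by metis
  have [measurable]: "\<phi> \<in> borel_measurable borel" "U \<in> borel_measurable borel"
    using smooth_on_supp_continuous[OF K(1)] U by (auto intro: borel_measurable_continuous_onI)
  show ?thesis
  proof (rule Bochner_Integration.integrable_bound[where f="\<lambda>x. B * U x"])
    show "AE x in lborel. norm (U x * \<phi> x) \<le> norm (B * U x)"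
    proof (intro AE_I2)
      fix x show "norm (U x * \<phi> x) \<le> norm (B * U x)"
        using B[of x] by (auto simp: abs_mult mult.commute[of B] intro!: mult_left_mono)
    qed
  qed (use U in auto)
qed

lemma partial_deriv_mult:
  assumes "C_k (Suc 0) f" "C_k (Suc 0) g"
  shows "partial_deriv i (\<lambda>x. f x * g x) x = f x * partial_deriv i g x + partial_deriv i f x * g x"
  using frechet_derivativeI[OF has_derivative_mult[OF C_k_differentiable[OF assms(1)] C_k_differentiable[OF assms(2)]]]
  by (simp add: partial_deriv_def)

lemma Lp_supp_mult:
  assumes "Lp_supp p \<Omega> f" "g \<in> borel_measurable borel" "p \<ge> 0" "\<And>x. \<bar>g x\<bar> \<le> B"
  shows "Lp_supp p \<Omega> (\<lambda>x. g x * f x)"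
  using assms pmass_mult_bounded_finite[of f p g B] by (auto simp: Lp_supp_def)

lemma Lp_supp_add:
  assumes "Lp_supp p \<Omega> f" "Lp_supp p \<Omega> g" "p \<ge> 0"
  shows "Lp_supp p \<Omega> (\<lambda>x. f x + g x)"
  using assms pmass_add_finite[of f g p] by (auto simp: Lp_supp_def)

lemma Lp_supp_integrable: "Lp_supp p \<Omega> f \<Longrightarrow> bounded \<Omega> \<Longrightarrow> p \<ge> 1 \<Longrightarrow> integrable lborel f"
  unfolding Lp_supp_def using integrable_if_pmass_finite[of f p \<Omega>] by blast

text \<open>
The product rule, obtained by testing against \<open>\<eta> \<phi>\<close>.
\<close>

lemma sobolev_pair_mult:
  fixes U :: "'a::euclidean_space \<Rightarrow> real"
  assumes UV: "sobolev_pair p \<Omega> U V" and \<Omega>: "bounded \<Omega>" and p: "p \<ge> 1"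
    and \<eta>: "\<And>n. C_k n \<eta>" "\<And>x. \<bar>\<eta> x\<bar> \<le> B" "\<And>i x. i \<in> Basis \<Longrightarrow> \<bar>partial_deriv i \<eta> x\<bar> \<le> B"
  shows "sobolev_pair p \<Omega> (\<lambda>x. \<eta> x * U x) (\<lambda>i x. \<eta> x * V i x + partial_deriv i \<eta> x * U x)"
  unfolding sobolev_pair_def
proof (intro conjI ballI allI impI)
  have m\<eta>: "\<eta> \<in> borel_measurable borel" using \<eta>(1)[of 0] by (auto intro: borel_measurable_continuous_onI)
  have U: "Lp_supp p \<Omega> U" using UV by (simp add: sobolev_pair_def)
  show "Lp_supp p \<Omega> (\<lambda>x. \<eta> x * U x)" using p by (intro Lp_supp_mult[OF U m\<eta> _ \<eta>(2)]) auto
  fix i :: 'a assume i: "i \<in> Basis"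
  have V: "Lp_supp p \<Omega> (V i)" using UV i by (simp add: sobolev_pair_def)
  have md\<eta>: "partial_deriv i \<eta> \<in> borel_measurable borel" 
    using \<eta>(1)[of "Suc 0"] i by (auto intro: borel_measurable_continuous_onI)
  show "Lp_supp p \<Omega> (\<lambda>x. \<eta> x * V i x + partial_deriv i \<eta> x * U x)"
    using p by (intro Lp_supp_add Lp_supp_mult[OF U md\<eta> _ \<eta>(3)[OF i]] Lp_supp_mult[OF V m\<eta> _ \<eta>(2)]) auto
  fix \<phi> assume "test_function \<Omega> \<phi>"
  then obtain K where K: "compact K" "K \<subseteq> \<Omega>" "smooth_on_supp K \<phi>" by (auto simp: test_function_smooth_on_supp)
  have S1: "smooth_on_supp K (\<lambda>x. \<eta> x * \<phi> x)" 
    using K(3) \<eta>(1) by (auto simp: smooth_on_supp_def intro!: C_k_mult)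
  have C: "C_k n (partial_deriv i \<eta>)" for n using \<eta>(1)[of "Suc n"] i by simp
  have S2: "smooth_on_supp K (\<lambda>x. partial_deriv i \<eta> x * \<phi> x)" 
    using K(3) C by (auto simp: smooth_on_supp_def intro!: C_k_mult)
  have S3: "smooth_on_supp K (\<lambda>x. \<eta> x * partial_deriv i \<phi> x)" 
    using smooth_on_supp_partial_deriv[OF K(3) compact_imp_closed[OF K(1)] i] \<eta>(1) by (auto simp: smooth_on_supp_def intro!: C_k_mult)
  have iU: "integrable lborel U" and iV: "integrable lborel (V i)" 
    using Lp_supp_integrable[OF U \<Omega> p] Lp_supp_integrable[OF V \<Omega> p] .
  note I = integrable_mult_smooth_on_supp[OF iU S1 K(1)] integrable_mult_smooth_on_supp[OF iU S2 K(1)] 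
     integrable_mult_smooth_on_supp[OF iU S3 K(1)] integrable_mult_smooth_on_supp[OF iV S1 K(1)]
  have "test_function \<Omega> (\<lambda>x. \<eta> x * \<phi> x)" using S1 K unfolding test_function_smooth_on_supp by blast
  then have "(LINT x|lborel. U x * partial_deriv i (\<lambda>x. \<eta> x * \<phi> x) x) = - (LINT x|lborel. V i x * (\<eta> x * \<phi> x))"
    using UV i by (simp add: sobolev_pair_def)
  moreover have "partial_deriv i (\<lambda>x. \<eta> x * \<phi> x) x = \<eta> x * partial_deriv i \<phi> x + partial_deriv i \<eta> x * \<phi> x" for x
    using K(3) \<eta>(1) by (intro partial_deriv_mult) (simp_all only: smooth_on_supp_def)
  moreover have "(LINT x|lborel. U x * (\<eta> x * partial_deriv i \<phi> x + partial_deriv i \<eta> x * \<phi> x)) =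
     (LINT x|lborel. U x * (\<eta> x * partial_deriv i \<phi> x)) + (LINT x|lborel. U x * (partial_deriv i \<eta> x * \<phi> x))"
    unfolding distrib_left by (rule Bochner_Integration.integral_add[OF I(3,2)])
  moreover have "(LINT x|lborel. (\<eta> x * V i x + partial_deriv i \<eta> x * U x) * \<phi> x) =
     (LINT x|lborel. V i x * (\<eta> x * \<phi> x) + U x * (partial_deriv i \<eta> x * \<phi> x))"
    by (intro Bochner_Integration.integral_cong) (auto simp: algebra_simps)
  moreover have "\<dots> = (LINT x|lborel. V i x * (\<eta> x * \<phi> x)) + (LINT x|lborel. U x * (partial_deriv i \<eta> x * \<phi> x))"
    by (rule Bochner_Integration.integral_add[OF I(4,2)])
  moreover have "(LINT x|lborel. \<eta> x * U x * partial_deriv i \<phi> x) = (LINT x|lborel. U x * (\<eta> x * partial_deriv i \<phi> x))"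
    by (intro Bochner_Integration.integral_cong) (auto simp: algebra_simps)
  ultimately show "(LINT x|lborel. \<eta> x * U x * partial_deriv i \<phi> x) = - (LINT x|lborel. (\<eta> x * V i x + partial_deriv i \<eta> x * U x) * \<phi> x)"
    by simp
qed

lemma taylor2_has_derivative:
  fixes f :: "'a::euclidean_space \<Rightarrow> real"
  assumes "taylor2 f D C" shows "(f has_derivative (\<lambda>h. D x \<bullet> h)) (at x)"
  unfolding has_derivative_at_alt
proof (intro conjI allI impI bounded_linear_inner_right)
  fix e :: real assume e: "e > 0"
  have C: "norm (D x) \<le> C" and T: "\<bar>f y - f x - D x \<bullet> (y - x)\<bar> \<le> C * (norm (y - x))\<^sup>2" for y
    using assms by (auto simp: taylor2_def)
  have C0: "C \<ge> 0" using C norm_ge_zero order_trans by blast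
  have "norm (f y - f x - D x \<bullet> (y - x)) \<le> e * norm (y - x)" if y: "norm (y - x) < e / (C + 1)" for y
  proof -
    have "C * norm (y - x) \<le> (C + 1) * norm (y - x)" by (intro mult_right_mono) auto
    also have "\<dots> \<le> e" using y C0 by (simp add: field_simps)
    finally have "C * norm (y - x) * norm (y - x) \<le> e * norm (y - x)" by (rule mult_right_mono) simp
    with T[of y] show ?thesis by (simp add: power2_eq_square)
  qed
  then show "\<exists>d>0. \<forall>y. norm (y - x) < d \<longrightarrow> norm (f y - f x - D x \<bullet> (y - x)) \<le> e * norm (y - x)"
    using e C0 by (intro exI[of _ "e / (C + 1)"]) auto
qed

lemma taylor2_measurable:
  fixes f :: "'a::euclidean_space \<Rightarrow> real"
  assumes "taylor2 f D C" shows "f \<in> borel_measurable borel" "(\<lambda>x. D x \<bullet> i) \<in> borel_measurable borel"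
  using gradient_measurable[of UNIV f D] taylor2_has_derivative[OF assms] by auto

lemma taylor2_add: "taylor2 f D C \<Longrightarrow> taylor2 f' D' C' \<Longrightarrow> taylor2 (\<lambda>x. f x + f' x) (\<lambda>x. D x + D' x) (C + C')"
  unfolding taylor2_def
proof (intro conjI allI; elim conjE)
  fix x assume "\<forall>x. norm (D x) \<le> C" "\<forall>x. norm (D' x) \<le> C'"
  then show "norm (D x + D' x) \<le> C + C'" using norm_triangle_mono by blast
next
  fix x y assume a: "\<forall>x y. \<bar>f y - f x - D x \<bullet> (y - x)\<bar> \<le> C * (norm (y - x))\<^sup>2"
    "\<forall>x y. \<bar>f' y - f' x - D' x \<bullet> (y - x)\<bar> \<le> C' * (norm (y - x))\<^sup>2"
  show "\<bar>f y + f' y - (f x + f' x) - (D x + D' x) \<bullet> (y - x)\<bar> \<le> (C + C') * (norm (y - x))\<^sup>2"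
    using a[rule_format, where y=y and x=x] by (simp add: inner_add_left distrib_right)
qed

text \<open>
Approximation is asked for on \<open>\<Omega>\<close> only, whereas the approximants are regular on the whole space: they are going
to be evaluated at nodes outside \<open>\<Omega>\<close>.
\<close>

definition C11_approximable :: "real \<Rightarrow> 'a::euclidean_space set \<Rightarrow> ('a \<Rightarrow> real) \<Rightarrow> ('a \<Rightarrow> 'a \<Rightarrow> real) \<Rightarrow> bool" where
  "C11_approximable p \<Omega> U V \<longleftrightarrow> (\<forall>e>0. \<exists>\<phi> D C. taylor2 \<phi> D C \<and>
     pmass p (\<lambda>x. indicator \<Omega> x * (\<phi> x - U x)) \<le> ennreal e \<and>
     (\<forall>i\<in>Basis. pmass p (\<lambda>x. indicator \<Omega> x * (D x \<bullet> i - V i x)) \<le> ennreal e))"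

lemma pmass_sum_error:
  fixes a b c d :: "'a::euclidean_space \<Rightarrow> real"
  assumes [measurable]: "a \<in> borel_measurable borel" "b \<in> borel_measurable borel" "c \<in> borel_measurable borel"
    "d \<in> borel_measurable borel" "\<Omega> \<in> sets borel" and p: "p \<ge> 0" and e: "e > 0"
    and 1: "pmass p (\<lambda>x. indicator \<Omega> x * (a x - b x)) \<le> ennreal (e / (2 * 2 powr p))"
    and 2: "pmass p (\<lambda>x. indicator \<Omega> x * (c x - d x)) \<le> ennreal (e / (2 * 2 powr p))"
  shows "pmass p (\<lambda>x. indicator \<Omega> x * ((a x + c x) - (b x + d x))) \<le> ennreal e"
proof -
  have eq: "(\<lambda>x. indicator \<Omega> x * ((a x + c x) - (b x + d x))) = (\<lambda>x. indicator \<Omega> x * (a x - b x) + indicator \<Omega> x * (c x - d x))"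
    by (auto simp: algebra_simps)
  have "pmass p (\<lambda>x. indicator \<Omega> x * ((a x + c x) - (b x + d x))) \<le> 
     ennreal (2 powr p) * (pmass p (\<lambda>x. indicator \<Omega> x * (a x - b x)) + pmass p (\<lambda>x. indicator \<Omega> x * (c x - d x)))"
    unfolding eq by (rule pmass_add) (use p in auto)
  also have "\<dots> \<le> ennreal (2 powr p) * (ennreal (e / (2 * 2 powr p)) + ennreal (e / (2 * 2 powr p)))"
    using 1 2 by (intro mult_left_mono add_mono) auto
  also have "\<dots> = ennreal e" using e by (simp flip: ennreal_plus ennreal_mult)
  finally show ?thesis .
qed

lemma C11_approximable_add:
  assumes \<Omega>: "\<Omega> \<in> sets borel" and p: "p \<ge> 0"
    and m: "U \<in> borel_measurable borel" "U' \<in> borel_measurable borel" 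
      "\<And>i. i \<in> Basis \<Longrightarrow> V i \<in> borel_measurable borel" "\<And>i. i \<in> Basis \<Longrightarrow> V' i \<in> borel_measurable borel"
    and a: "C11_approximable p \<Omega> U V" "C11_approximable p \<Omega> U' V'"
  shows "C11_approximable p \<Omega> (\<lambda>x. U x + U' x) (\<lambda>i x. V i x + V' i x)"
  unfolding C11_approximable_def
proof (intro allI impI)
  fix e :: real assume e: "e > 0"
  then have e': "e / (2 * 2 powr p) > 0" by simp
  obtain \<phi> D C where 1: "taylor2 \<phi> D C" "pmass p (\<lambda>x. indicator \<Omega> x * (\<phi> x - U x)) \<le> ennreal (e / (2 * 2 powr p))"
     "\<And>i. i \<in> Basis \<Longrightarrow> pmass p (\<lambda>x. indicator \<Omega> x * (D x \<bullet> i - V i x)) \<le> ennreal (e / (2 * 2 powr p))"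
    using a(1) e' unfolding C11_approximable_def by blast
  obtain \<phi>' D' C' where 2: "taylor2 \<phi>' D' C'" "pmass p (\<lambda>x. indicator \<Omega> x * (\<phi>' x - U' x)) \<le> ennreal (e / (2 * 2 powr p))"
     "\<And>i. i \<in> Basis \<Longrightarrow> pmass p (\<lambda>x. indicator \<Omega> x * (D' x \<bullet> i - V' i x)) \<le> ennreal (e / (2 * 2 powr p))"
    using a(2) e' unfolding C11_approximable_def by blast
  show "\<exists>\<phi> D C. taylor2 \<phi> D C \<and> pmass p (\<lambda>x. indicator \<Omega> x * (\<phi> x - (U x + U' x))) \<le> ennreal e \<and>
     (\<forall>i\<in>Basis. pmass p (\<lambda>x. indicator \<Omega> x * (D x \<bullet> i - (V i x + V' i x))) \<le> ennreal e)"
  proof (intro exI conjI ballI)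
    show "taylor2 (\<lambda>x. \<phi> x + \<phi>' x) (\<lambda>x. D x + D' x) (C + C')" by (rule taylor2_add[OF 1(1) 2(1)])
    show "pmass p (\<lambda>x. indicator \<Omega> x * (\<phi> x + \<phi>' x - (U x + U' x))) \<le> ennreal e"
      by (rule pmass_sum_error) (use \<Omega> p m e 1 2 taylor2_measurable[OF 1(1)] taylor2_measurable[OF 2(1)] in auto)
    fix i :: 'a assume i: "i \<in> Basis"
    show "pmass p (\<lambda>x. indicator \<Omega> x * ((D x + D' x) \<bullet> i - (V i x + V' i x))) \<le> ennreal e"
      unfolding inner_add_left
      by (rule pmass_sum_error) (use \<Omega> p m i e 1 2 taylor2_measurable[OF 1(1)] taylor2_measurable[OF 2(1)] in auto)
  qed
qed

section \<open>Density under the segment condition\<close>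

lemma smooth_on_supp_has_derivative:
  "smooth_on_supp K f \<Longrightarrow> (f has_derivative (\<lambda>h. grad f x \<bullet> h)) (at x)"
  by (rule has_derivative_grad[of 0]) (simp only: smooth_on_supp_def)

lemma mollifier_smooth_0: "r > 0 \<Longrightarrow> smooth_on_supp (cball 0 r) (mollifier r :: 'a::euclidean_space \<Rightarrow> real)"
  using mollifier_smooth[of r "0::'a"] by simp

lemma grad_mollifier_measurable [measurable]: 
  assumes r: "r > 0" shows "grad (mollifier r :: 'a::euclidean_space \<Rightarrow> real) \<in> borel_measurable borel"
proof -
  have "partial_deriv i (mollifier r :: 'a \<Rightarrow> real) \<in> borel_measurable borel" if "i \<in> Basis" for i
    using smooth_on_supp_continuous[OF smooth_on_supp_partial_deriv[OF mollifier_smooth_0[OF r] closed_cball that]]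
    by (rule borel_measurable_continuous_onI)
  then show ?thesis unfolding grad_def[abs_def] by (intro borel_measurable_sum borel_measurable_scaleR) auto
qed

lemma mollified_integrable:
  assumes r: "r > 0" and U: "integrable lborel U"
  shows "integrable lborel (\<lambda>z. U z * mollifier r (z - c))"
    and "integrable lborel (\<lambda>z::'a::euclidean_space. U z *\<^sub>R grad (mollifier r) (z - c))"
proof -
  show "integrable lborel (\<lambda>z. U z * mollifier r (z - c))"
    by (rule integrable_mult_smooth_on_supp[OF U mollifier_smooth[OF r] compact_cball])
  obtain B where B: "\<And>x::'a. norm (grad (mollifier r) x) \<le> B" 
    using smooth_on_supp_grad_bounded[OF mollifier_smooth_0[OF r] compact_cball] by metis
  have [measurable]: "U \<in> borel_measurable borel" using U by auto
  note [measurable] = grad_mollifier_measurable[OF r, where 'a='a]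
  show "integrable lborel (\<lambda>z::'a. U z *\<^sub>R grad (mollifier r) (z - c))"
  proof (rule Bochner_Integration.integrable_bound[where f="\<lambda>x. B * U x"])
    show "AE x in lborel. norm (U x *\<^sub>R grad (mollifier r) (x - c)) \<le> norm (B * U x)"
    proof (intro AE_I2)
      fix x show "norm (U x *\<^sub>R grad (mollifier r) (x - c)) \<le> norm (B * U x)"
        using B[of "x - c"] by (auto simp: abs_mult mult.commute[of "\<bar>B\<bar>"] intro!: mult_left_mono)
    qed
  qed (use U in auto)
qed

text \<open>
Integrating the second-order Taylor estimate of the kernel against \<open>U\<close> gives the one of the average, which
contains its differentiability.
\<close>

lemma mollified_taylor2:
  fixes U :: "'a::euclidean_space \<Rightarrow> real"
  assumes r: "r > 0" and U: "integrable lborel U"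
  obtains C where "taylor2 (\<lambda>x. LINT z|lborel. U z * mollifier r (z - (x + s)))
     (\<lambda>x. - (LINT z|lborel. U z *\<^sub>R grad (mollifier r) (z - (x + s)))) C"
proof -
  obtain C where C: "taylor2 (mollifier r :: 'a \<Rightarrow> real) (grad (mollifier r)) C"
    by (rule smooth_on_supp_taylor2[OF mollifier_smooth_0[OF r] compact_cball])
  note I = mollified_integrable[OF r U]
  let ?F = "\<lambda>x. LINT z|lborel. U z * mollifier r (z - (x + s))"
  let ?D = "\<lambda>x. - (LINT z|lborel. U z *\<^sub>R grad (mollifier r) (z - (x + s)))"
  have iU: "integrable lborel (\<lambda>z. \<bar>U z\<bar>)" using U by (rule integrable_abs)
  have "taylor2 ?F ?D (C * (LINT z|lborel. \<bar>U z\<bar>))"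
    unfolding taylor2_def
  proof (intro conjI allI)
    fix x :: 'a
    have "norm (?D x) \<le> (LINT z|lborel. norm (U z *\<^sub>R grad (mollifier r) (z - (x + s))))"
      unfolding norm_minus_cancel by (rule integral_norm_bound)
    also have "\<dots> \<le> (LINT z|lborel. C * \<bar>U z\<bar>)"
    proof (rule integral_mono)
      fix z show "norm (U z *\<^sub>R grad (mollifier r) (z - (x + s))) \<le> C * \<bar>U z\<bar>"
        using C unfolding taylor2_def by (auto simp: mult.commute[of C] intro!: mult_left_mono)
    qed (rule integrable_norm[OF I(2)], use iU in simp)
    finally show "norm (?D x) \<le> C * (LINT z|lborel. \<bar>U z\<bar>)" by simp
  next
    fix x y :: 'a
    let ?R = "\<lambda>z. mollifier r (z - (y + s)) - mollifier r (z - (x + s)) - grad (mollifier r) (z - (x + s)) \<bullet> ((z - (y + s)) - (z - (x + s)))"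
    have R: "\<bar>?R z\<bar> \<le> C * (norm (y - x))\<^sup>2" for z
      using C[unfolded taylor2_def, THEN conjunct2, rule_format, of "z - (y + s)" "z - (x + s)"]
      by (simp add: norm_minus_commute)
    have eqR: "U z * ?R z = U z * mollifier r (z - (y + s)) - U z * mollifier r (z - (x + s)) 
        + (U z *\<^sub>R grad (mollifier r) (z - (x + s))) \<bullet> (y - x)" for z
    proof -
      have "(z - (y + s)) - (z - (x + s)) = - (y - x)" by simp
      then show ?thesis by (simp only: inner_minus_right inner_scaleR_left) (simp add: algebra_simps)
    qed
    have iR: "integrable lborel (\<lambda>z. U z * ?R z)"
      unfolding eqR by (intro Bochner_Integration.integrable_add Bochner_Integration.integrable_diff I integrable_inner_left)
    have eqF: "?F y - ?F x - ?D x \<bullet> (y - x) = (LINT z|lborel. U z * ?R z)"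
      unfolding eqR
      by (subst Bochner_Integration.integral_add, intro Bochner_Integration.integrable_diff I, intro integrable_inner_left I,
          subst Bochner_Integration.integral_diff, rule I, rule I, subst integral_inner_left, rule I) simp
    have "\<bar>LINT z|lborel. U z * ?R z\<bar> \<le> (LINT z|lborel. \<bar>U z * ?R z\<bar>)" by (rule integral_abs_bound)
    also have "\<dots> \<le> (LINT z|lborel. (C * (norm (y - x))\<^sup>2) * \<bar>U z\<bar>)"
    proof (rule integral_mono)
      fix z show "\<bar>U z * ?R z\<bar> \<le> (C * (norm (y - x))\<^sup>2) * \<bar>U z\<bar>"
        using mult_left_mono[OF R[of z] abs_ge_zero[of "U z"]]
        by (simp only: abs_mult mult.commute[of "C * (norm (y - x))\<^sup>2"])
    qed (rule integrable_abs[OF iR], use iU in simp)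
    also have "\<dots> = C * (LINT z|lborel. \<bar>U z\<bar>) * (norm (y - x))\<^sup>2" by simp
    finally show "\<bar>?F y - ?F x - ?D x \<bullet> (y - x)\<bar> \<le> C * (LINT z|lborel. \<bar>U z\<bar>) * (norm (y - x))\<^sup>2"
      unfolding eqF .
  qed
  then show ?thesis using that by blast
qed

text \<open>
If the kernel centred at \<open>c\<close> is supported in \<open>\<Omega>\<close>, it is a test function and the weak derivative may be
moved onto \<open>U\<close>. If it misses the set \<open>S\<close> that carries \<open>U\<close> and \<open>V\<close>, both sides vanish.
\<close>

lemma mollified_gradient:
  fixes U :: "'a::euclidean_space \<Rightarrow> real"
  assumes r: "r > 0" and UV: "sobolev_pair p \<Omega> U V" and i: "i \<in> Basis" and U: "integrable lborel U"
    and S: "\<And>x. x \<notin> S \<Longrightarrow> U x = 0" "\<And>x. x \<notin> S \<Longrightarrow> V i x = 0"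
    and c: "cball c r \<subseteq> \<Omega> \<or> cball c r \<inter> S = {}"
  shows "(- (LINT z|lborel. U z *\<^sub>R grad (mollifier r) (z - c))) \<bullet> i = (LINT z|lborel. V i z * mollifier r (z - c))"
proof -
  let ?\<rho> = "\<lambda>z. mollifier r (z - c)"
  have sm: "smooth_on_supp (cball c r) ?\<rho>" by (rule mollifier_smooth[OF r])
  have pd: "partial_deriv i ?\<rho> z = grad (mollifier r) (z - c) \<bullet> i" for z
  proof -
    have "(mollifier r has_derivative (\<lambda>h. grad (mollifier r) (z - c) \<bullet> h)) (at (z - c))"
      by (rule smooth_on_supp_has_derivative[OF mollifier_smooth_0[OF r]])
    then have "(?\<rho> has_derivative (\<lambda>h. grad (mollifier r) (z - c) \<bullet> h)) (at z)"
      by (rule has_derivative_compose[rotated]) (auto intro!: derivative_eq_intros)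
    then show ?thesis by (rule partial_deriv_eqI)
  qed
  have "(- (LINT z|lborel. U z *\<^sub>R grad (mollifier r) (z - c))) \<bullet> i = - (LINT z|lborel. U z * partial_deriv i ?\<rho> z)"
    unfolding pd using mollified_integrable(2)[OF r U, of c] by (simp flip: integral_inner_left)
  also have "\<dots> = (LINT z|lborel. V i z * ?\<rho> z)"
    using c
  proof
    assume "cball c r \<subseteq> \<Omega>"
    then have "test_function \<Omega> ?\<rho>" using sm compact_cball unfolding test_function_smooth_on_supp by blast
    then show ?thesis using UV i unfolding sobolev_pair_def by (metis minus_minus)
  next
    assume disj: "cball c r \<inter> S = {}"
    have "U z * partial_deriv i ?\<rho> z = 0" "V i z * ?\<rho> z = 0" for z
      using disj S[of z] sm smooth_on_supp_partial_deriv[OF sm closed_cball i] unfolding smooth_on_supp_def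
      by (cases "z \<in> S"; blast intro: mult_eq_0_iff[THEN iffD2])+
    then show ?thesis by (simp only:) simp
  qed
  finally show ?thesis .
qed

lemma Lp_shift_continuous_finite:
  assumes "finite F" and \<Omega>: "bounded \<Omega>" and p: "p \<ge> 1" and "\<And>f. f \<in> F \<Longrightarrow> Lp_supp p \<Omega> f" and e: "e > 0"
  shows "\<exists>d>0. \<forall>f\<in>F. \<forall>z. norm z < d \<longrightarrow> pmass p (\<lambda>x. f (x + z) - f x) \<le> ennreal e"
  using assms(1,4)
proof (induction F)
  case (insert f F)
  obtain d1 where d1: "d1 > 0" "\<forall>f\<in>F. \<forall>z. norm z < d1 \<longrightarrow> pmass p (\<lambda>x. f (x + z) - f x) \<le> ennreal e"
    using insert by auto
  have f: "f \<in> borel_measurable borel" "pmass p f < \<infinity>" "\<And>x. x \<notin> \<Omega> \<Longrightarrow> f x = 0" 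
    using insert.prems[of f] by (auto simp: Lp_supp_def)
  obtain d2 where d2: "d2 > 0" "\<And>z. norm z < d2 \<Longrightarrow> pmass p (\<lambda>x. f (x + z) - f x) \<le> ennreal e"
    using shift_continuous_Lp[OF f(1) p f(2) \<Omega> f(3) e] by metis
  show ?case using d1 d2 by (intro exI[of _ "min d1 d2"]) auto
qed (auto intro: exI[of _ 1])

lemma pmass_mollify_le:
  fixes f :: "'a::euclidean_space \<Rightarrow> real"
  assumes f: "integrable lborel f" and p: "p \<ge> 1" and r: "r > 0" and d: "norm s + r \<le> d"
    and E: "\<And>z. norm z < d \<Longrightarrow> pmass p (\<lambda>x. f (x + z) - f x) \<le> E"
  shows "pmass p (\<lambda>x. (LINT z|lborel. f z * mollifier r (z - (x + s))) - f x) \<le> E"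
proof -
  obtain B where B: "\<And>x::'a. mollifier r x \<le> B" using mollifier_bounded[OF r] by metis
  note [measurable] = mollifier_measurable[OF r, where 'a='a]
  let ?\<rho> = "\<lambda>w. mollifier r (w - s)"
  have "pmass p (\<lambda>x. (LINT z|lborel. f z * ?\<rho> (z - x)) - f x) \<le> E"
  proof (rule pmass_average_le[OF f p, where d=d and B=B])
    show "integrable lborel ?\<rho>" "(LINT x|lborel. ?\<rho> x) = 1"
      using integral_lborel_shift[of "mollifier r" "- s"] mollifier_props[OF r, where 'a='a] by auto
    show "norm w < d" if "?\<rho> w \<noteq> 0" for w
      using mollifier_supp[OF r that] d norm_triangle_sub[of w s] by linarith
  qed (use B mollifier_nonneg[OF r] E in auto)
  moreover have "z - x - s = z - (x + s)" for z x by simp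
  ultimately show ?thesis by simp
qed

text \<open>
The heart of the density theorem. The kernel is centred at \<open>x + t y\<close>. When \<open>x \<in> \<Omega>\<close> lies in the larger ball,
the segment condition puts \<open>x + t y\<close> into \<open>\<Omega>\<close>, with a uniform distance from the boundary by compactness, so the
kernel fits into \<open>\<Omega>\<close>. When \<open>x\<close> lies outside the larger ball, the kernel misses the smaller one, which carries \<open>U\<close>.
\<close>

lemma C11_approximable_local:
  fixes U :: "'a::euclidean_space \<Rightarrow> real"
  assumes \<Omega>: "open \<Omega>" "bounded \<Omega>" and p: "p \<ge> 1" and UV: "sobolev_pair p \<Omega> U V"
    and S: "\<And>x. x \<notin> cball c r \<Longrightarrow> U x = 0" "\<And>i x. i \<in> Basis \<Longrightarrow> x \<notin> cball c r \<Longrightarrow> V i x = 0" and rR: "r < R"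
    and seg: "\<And>z t. z \<in> closure \<Omega> \<Longrightarrow> z \<in> cball c R \<Longrightarrow> 0 < t \<Longrightarrow> t < 1 \<Longrightarrow> z + t *\<^sub>R y \<in> \<Omega>"
  shows "C11_approximable p \<Omega> U V"
  unfolding C11_approximable_def
proof (intro allI impI)
  fix e :: real assume e: "e > 0"
  have LU: "Lp_supp p \<Omega> U" and LV: "Lp_supp p \<Omega> (V i)" if "i \<in> Basis" for i
    using UV that by (auto simp: sobolev_pair_def)
  have LU: "Lp_supp p \<Omega> U" using UV by (simp add: sobolev_pair_def)
  have "\<exists>d>0. \<forall>f\<in>insert U (V ` Basis). \<forall>z. norm z < d \<longrightarrow> pmass p (\<lambda>x. f (x + z) - f x) \<le> ennreal e"
    by (rule Lp_shift_continuous_finite[OF _ \<Omega>(2) p _ e]) (use LU LV in auto)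
  then obtain d0 where d0: "d0 > 0" "\<And>z. norm z < d0 \<Longrightarrow> pmass p (\<lambda>x. U (x + z) - U x) \<le> ennreal e"
     "\<And>i z. i \<in> Basis \<Longrightarrow> norm z < d0 \<Longrightarrow> pmass p (\<lambda>x. V i (x + z) - V i x) \<le> ennreal e" by auto
  define d where "d = min d0 (R - r)"
  have d: "d > 0" "d \<le> d0" "d \<le> R - r" using d0 rR by (auto simp: d_def)
  \<comment> \<open>Short enough that the shift \<open>t y\<close> uses at most half of \<open>d\<close>, leaving the other half for the kernel radius.\<close>
  define t where "t = min (1/2) (d / (2 * (norm y + 1)))"
  have t: "0 < t" "t < 1" using d by (auto simp: t_def intro!: divide_pos_pos add_nonneg_pos)
  define s where "s = t *\<^sub>R y"
  have "norm s \<le> d / 2"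
  proof -
    have "norm s = t * norm y" using t by (simp add: s_def)
    also have "\<dots> \<le> d / (2 * (norm y + 1)) * (norm y + 1)" 
      using d by (intro mult_mono) (auto simp: t_def)
    also have "\<dots> = d / 2" by (simp add: field_simps add_nonneg_eq_0_iff)
    finally show ?thesis .
  qed
  let ?K = "closure \<Omega> \<inter> cball c R"
  have "compact ((\<lambda>z. z + s) ` ?K)"
    using \<Omega>(2) by (intro compact_continuous_image continuous_intros compact_Int_closed) (auto simp: compact_closure)
  moreover have "(\<lambda>z. z + s) ` ?K \<subseteq> \<Omega>" using seg t by (auto simp: s_def)
  ultimately obtain \<epsilon>1 where \<epsilon>1: "\<epsilon>1 > 0" "(\<Union>x\<in>(\<lambda>z. z + s) ` ?K. cball x \<epsilon>1) \<subseteq> \<Omega>"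
    using compact_subset_open_imp_cball_epsilon_subset[OF _ \<Omega>(1)] by metis
  define \<epsilon> where "\<epsilon> = min \<epsilon>1 (d / 2)"
  have \<epsilon>: "\<epsilon> > 0" "\<epsilon> \<le> \<epsilon>1" "norm s + \<epsilon> \<le> d" using \<epsilon>1 d \<open>norm s \<le> d / 2\<close> by (auto simp: \<epsilon>_def)
  have iU: "integrable lborel U" by (rule Lp_supp_integrable[OF LU \<Omega>(2) p])
  let ?F = "\<lambda>x. LINT z|lborel. U z * mollifier \<epsilon> (z - (x + s))"
  let ?D = "\<lambda>x. - (LINT z|lborel. U z *\<^sub>R grad (mollifier \<epsilon>) (z - (x + s)))"
  obtain C where C: "taylor2 ?F ?D C" by (rule mollified_taylor2[OF \<epsilon>(1) iU])
  show "\<exists>\<phi> D C. taylor2 \<phi> D C \<and> pmass p (\<lambda>x. indicator \<Omega> x * (\<phi> x - U x)) \<le> ennreal e \<and>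
     (\<forall>i\<in>Basis. pmass p (\<lambda>x. indicator \<Omega> x * (D x \<bullet> i - V i x)) \<le> ennreal e)"
  proof (intro exI conjI ballI)
    show "taylor2 ?F ?D C" by (rule C)
    have "pmass p (\<lambda>x. indicator \<Omega> x * (?F x - U x)) \<le> pmass p (\<lambda>x. ?F x - U x)"
      using p by (intro pmass_mono) (auto simp: indicator_def)
    also have "\<dots> \<le> ennreal e"
      by (rule pmass_mollify_le[OF iU p \<epsilon>(1,3)]) (use d0 d in auto)
    finally show "pmass p (\<lambda>x. indicator \<Omega> x * (?F x - U x)) \<le> ennreal e" .
    fix i :: 'a assume i: "i \<in> Basis"
    have iV: "integrable lborel (V i)" by (rule Lp_supp_integrable[OF LV[OF i] \<Omega>(2) p])
    have "?D x \<bullet> i = (LINT z|lborel. V i z * mollifier \<epsilon> (z - (x + s)))" if x: "x \<in> \<Omega>" for x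
    proof (rule mollified_gradient[OF \<epsilon>(1) UV i iU, where S="cball c r"])
      show "cball (x + s) \<epsilon> \<subseteq> \<Omega> \<or> cball (x + s) \<epsilon> \<inter> cball c r = {}"
      proof (cases "x \<in> cball c R")
        case True
        then have "x \<in> ?K" using x closure_subset by blast
        then have "cball (x + s) \<epsilon>1 \<subseteq> \<Omega>" using \<epsilon>1(2) by blast
        then show ?thesis using \<epsilon>(2) by (meson order_trans subset_cball)
      next
        case False
        have "z \<notin> cball c r" if z: "z \<in> cball (x + s) \<epsilon>" for z
        proof
          assume "z \<in> cball c r"
          moreover have "dist c x \<le> dist c z + dist z (x + s) + dist (x + s) x"
            using dist_triangle[of c x z] dist_triangle[of z x "x + s"] by linarith
          ultimately show False using z False \<epsilon>(3) d(3) by (auto simp: dist_norm norm_minus_commute)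
        qed
        then show ?thesis by blast
      qed
    qed (use S i in auto)
    then have "pmass p (\<lambda>x. indicator \<Omega> x * (?D x \<bullet> i - V i x)) \<le> pmass p (\<lambda>x. (LINT z|lborel. V i z * mollifier \<epsilon> (z - (x + s))) - V i x)"
      using p by (intro pmass_mono) (auto simp: indicator_def)
    also have "\<dots> \<le> ennreal e"
      by (rule pmass_mollify_le[OF iV p \<epsilon>(1,3)]) (use d0 d i in auto)
    finally show "pmass p (\<lambda>x. indicator \<Omega> x * (?D x \<bullet> i - V i x)) \<le> ennreal e" .
  qed
qed

lemma partial_deriv_one_minus:
  assumes "C_k (Suc 0) f" shows "partial_deriv i (\<lambda>x. 1 - f x) x = - partial_deriv i f x"
  using frechet_derivativeI[OF has_derivative_diff[OF has_derivative_const C_k_differentiable[OF assms]]]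
  by (simp add: partial_deriv_def)

text \<open>
Induction over the balls that cover the support: split off \<open>\<eta> U\<close> for a cutoff \<open>\<eta>\<close> that is \<open>1\<close> on one ball;
the remainder \<open>(1 - \<eta>) U\<close> is carried by the other balls. The balls are open because \<open>\<eta>\<close> is then constant near
each of their points, so that the derivative of \<open>\<eta>\<close> vanishes there as well. As \<open>\<eta>\<close> reaches out to radius \<open>2r\<close>, the segment property is
asked for on radius \<open>3r\<close>, which leaves room for the shift.
\<close>

lemma C11_approximable_cover:
  fixes U :: "'a::euclidean_space \<Rightarrow> real"
  assumes \<Omega>: "open \<Omega>" "bounded \<Omega>" and p: "p \<ge> 1" and "finite A"
    and seg: "\<And>c. c \<in> A \<Longrightarrow> r c > 0" "\<And>c z t. c \<in> A \<Longrightarrow> z \<in> closure \<Omega> \<Longrightarrow> z \<in> cball c (3 * r c) \<Longrightarrow> 0 < t \<Longrightarrow> t < 1 \<Longrightarrow> z + t *\<^sub>R y c \<in> \<Omega>"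
    and "sobolev_pair p \<Omega> U V" "\<And>x. x \<notin> (\<Union>c\<in>A. ball c (r c)) \<Longrightarrow> U x = 0" 
      "\<And>i x. i \<in> Basis \<Longrightarrow> x \<notin> (\<Union>c\<in>A. ball c (r c)) \<Longrightarrow> V i x = 0"
  shows "C11_approximable p \<Omega> U V"
  using assms(4-)
proof (induction A arbitrary: U V)
  case empty
  then have "U = (\<lambda>x. 0)" "\<And>i. i \<in> Basis \<Longrightarrow> V i = (\<lambda>x. 0)" by auto
  then show ?case unfolding C11_approximable_def
    by (intro allI impI exI[of _ "\<lambda>x. 0"] exI[of _ 0]) (auto simp: taylor2_def pmass_def)
next
  case (insert c A)
  have r: "r c > 0" using insert.prems by simp
  define \<eta> where "\<eta> = cutoff c (r c)"
  define \<kappa> where "\<kappa> x = 1 - \<eta> x" for x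
  have C: "C_k n \<eta>" for n unfolding \<eta>_def by (rule C_k_cutoff)
  have "C_k n (\<lambda>x. 1 + (- 1) * \<eta> x)" for n by (intro C_k_add C_k_mult C_k_const C)
  then have C': "C_k n \<kappa>" for n by (simp add: \<kappa>_def[abs_def])
  have S: "smooth_on_supp (cball c (2 * r c)) \<eta>"
    using C cutoff_eq_0[OF r, of _ c] by (auto simp: smooth_on_supp_def \<eta>_def dist_norm norm_minus_commute)
  have pdk: "partial_deriv i \<kappa> x = - partial_deriv i \<eta> x" for i x
    unfolding \<kappa>_def[abs_def] using C[of "Suc 0"] by (rule partial_deriv_one_minus)
  obtain B1 where B1: "\<And>x. \<bar>\<eta> x\<bar> \<le> B1" using smooth_on_supp_bounded[OF S compact_cball] by metis
  obtain B2 where B2: "\<And>x. norm (grad \<eta> x) \<le> B2" using smooth_on_supp_grad_bounded[OF S compact_cball] by metis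
  define B where "B = max (1 + \<bar>B1\<bar>) B2"
  have B: "\<bar>\<eta> x\<bar> \<le> B" "\<bar>\<kappa> x\<bar> \<le> B" for x
    using B1[of x] by (auto simp: B_def \<kappa>_def abs_if split: if_splits)
  have Bd: "\<bar>partial_deriv i \<eta> x\<bar> \<le> B" "\<bar>partial_deriv i \<kappa> x\<bar> \<le> B" if "i \<in> Basis" for i x
    using B2[of x] Basis_le_norm[OF that, of "grad \<eta> x"] unfolding pdk grad_inner_Basis[OF that] by (auto simp: B_def)
  have \<eta>1: "partial_deriv i \<eta> x = 0" if "x \<in> ball c (r c)" for i x
  proof -
    have "((\<lambda>x. 1) has_derivative (\<lambda>h. 0 \<bullet> h)) (at x)" by simp
    then have "(\<eta> has_derivative (\<lambda>h. 0 \<bullet> h)) (at x)"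
      by (rule has_derivative_transform_within_open[where s="ball c (r c)"])
        (use that cutoff_eq_1[OF r, of _ c] in \<open>auto simp: \<eta>_def dist_norm norm_minus_commute\<close>)
    from partial_deriv_eqI[OF this, of i] show ?thesis by simp
  qed
  let ?U1 = "\<lambda>x. \<eta> x * U x" and ?V1 = "\<lambda>i x. \<eta> x * V i x + partial_deriv i \<eta> x * U x"
  let ?U2 = "\<lambda>x. \<kappa> x * U x" and ?V2 = "\<lambda>i x. \<kappa> x * V i x + partial_deriv i \<kappa> x * U x"
  have P1: "sobolev_pair p \<Omega> ?U1 ?V1"
    by (rule sobolev_pair_mult[OF insert.prems(3) \<Omega>(2) p C B(1) Bd(1)])
  have P2: "sobolev_pair p \<Omega> ?U2 ?V2"
    by (rule sobolev_pair_mult[OF insert.prems(3) \<Omega>(2) p C' B(2) Bd(2)])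
  have "C11_approximable p \<Omega> ?U1 ?V1"
  proof (rule C11_approximable_local[OF \<Omega> p P1, where c=c and r="2 * r c" and R="3 * r c" and y="y c"])
    show "?U1 x = 0" if "x \<notin> cball c (2 * r c)" for x using S that by (simp add: smooth_on_supp_def)
    show "?V1 i x = 0" if "i \<in> Basis" "x \<notin> cball c (2 * r c)" for i x 
      using S smooth_on_supp_partial_deriv[OF S closed_cball that(1)] that by (simp add: smooth_on_supp_def)
  qed (use r insert.prems in auto)
  moreover have "C11_approximable p \<Omega> ?U2 ?V2"
  proof (rule insert.IH[OF _ _ P2])
    fix x assume x: "x \<notin> (\<Union>c\<in>A. ball c (r c))"
    have "\<kappa> x = 0" if "x \<in> ball c (r c)"
      using that cutoff_eq_1[OF r, of x c] by (auto simp: \<kappa>_def \<eta>_def dist_norm norm_minus_commute)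
    moreover have "U x = 0" if "x \<notin> ball c (r c)" using x that by (intro insert.prems) auto
    ultimately show "?U2 x = 0" by auto
    fix i :: 'a assume i: "i \<in> Basis"
    have "V i x = 0" if "x \<notin> ball c (r c)" using x that i by (intro insert.prems) auto
    then show "?V2 i x = 0" using \<open>x \<in> ball c (r c) \<Longrightarrow> \<kappa> x = 0\<close> \<open>x \<notin> ball c (r c) \<Longrightarrow> U x = 0\<close> \<eta>1[of x i]
      by (cases "x \<in> ball c (r c)") (auto simp: pdk)
  qed (use insert.prems in auto)
  ultimately have "C11_approximable p \<Omega> (\<lambda>x. ?U1 x + ?U2 x) (\<lambda>i x. ?V1 i x + ?V2 i x)"
    using P1 P2 p \<Omega>(1) by (intro C11_approximable_add) (auto simp: sobolev_pair_def Lp_supp_def)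
  moreover have "(\<lambda>x. ?U1 x + ?U2 x) = U" "(\<lambda>i x. ?V1 i x + ?V2 i x) = V"
    by (auto simp: fun_eq_iff \<kappa>_def[of] pdk algebra_simps)
  ultimately show ?case by simp
qed

text \<open>
At interior points the zero vector serves as direction, so boundary and interior points are treated alike.
\<close>

lemma segment_condition_closure:
  fixes \<Omega> :: "'a::euclidean_space set"
  assumes \<Omega>: "open \<Omega>" and seg: "segment_condition \<Omega>" and x: "x \<in> closure \<Omega>"
  shows "\<exists>r>0. \<exists>y. \<forall>z t. z \<in> closure \<Omega> \<longrightarrow> z \<in> cball x (3 * r) \<longrightarrow> 0 < t \<longrightarrow> t < 1 \<longrightarrow> z + t *\<^sub>R y \<in> \<Omega>"
proof (cases "x \<in> \<Omega>")
  case True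
  then obtain r0 where r0: "r0 > 0" "cball x r0 \<subseteq> \<Omega>" using \<Omega> open_contains_cball by blast
  show ?thesis by (rule exI[of _ "r0 / 3"]) (use r0 in \<open>auto intro!: exI[of _ 0]\<close>)
next
  case False
  then have "x \<in> frontier \<Omega>" using x \<Omega> by (simp add: frontier_def interior_open)
  then obtain U y where U: "open U" "x \<in> U" "\<And>z t. z \<in> closure \<Omega> \<inter> U \<Longrightarrow> 0 < t \<Longrightarrow> t < 1 \<Longrightarrow> z + t *\<^sub>R y \<in> \<Omega>"
    using seg unfolding segment_condition_def by metis
  then obtain r0 where r0: "r0 > 0" "cball x r0 \<subseteq> U" using open_contains_cball by blast
  show ?thesis
  proof (intro exI conjI)
    show "r0 / 3 > 0" using r0 by simp
    show "\<forall>z t. z \<in> closure \<Omega> \<longrightarrow> z \<in> cball x (3 * (r0 / 3)) \<longrightarrow> 0 < t \<longrightarrow> t < 1 \<longrightarrow> z + t *\<^sub>R y \<in> \<Omega>"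
      using U(3) r0(2) by auto
  qed
qed

lemma sobolev_pair_C11_approximable:
  fixes U :: "'a::euclidean_space \<Rightarrow> real"
  assumes \<Omega>: "open \<Omega>" "bounded \<Omega>" and seg: "segment_condition \<Omega>" and p: "p \<ge> 1" and UV: "sobolev_pair p \<Omega> U V"
  shows "C11_approximable p \<Omega> U V"
proof -
  obtain r y where ry: "\<And>x. x \<in> closure \<Omega> \<Longrightarrow> r x > 0"
     "\<And>x z t. x \<in> closure \<Omega> \<Longrightarrow> z \<in> closure \<Omega> \<Longrightarrow> z \<in> cball x (3 * r x) \<Longrightarrow> 0 < t \<Longrightarrow> t < 1 \<Longrightarrow> z + t *\<^sub>R y x \<in> \<Omega>"
    using segment_condition_closure[OF \<Omega>(1) seg] by metis
  have "compact (closure \<Omega>)" using \<Omega>(2) by (simp add: compact_closure)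
  moreover have "closure \<Omega> \<subseteq> (\<Union>x\<in>closure \<Omega>. ball x (r x))" using ry(1) by force
  ultimately obtain A where A: "A \<subseteq> closure \<Omega>" "finite A" "closure \<Omega> \<subseteq> (\<Union>x\<in>A. ball x (r x))"
    using compactE_image[of "closure \<Omega>" "closure \<Omega>" "\<lambda>x. ball x (r x)"] by (metis open_ball)
  show ?thesis
  proof (rule C11_approximable_cover[OF \<Omega> p A(2) _ _ UV, where r=r and y=y])
    have "x \<notin> \<Omega>" if "x \<notin> (\<Union>c\<in>A. ball c (r c))" for x using that A(3) closure_subset by blast
    then show "U x = 0" "i \<in> Basis \<Longrightarrow> V i x = 0" if "x \<notin> (\<Union>c\<in>A. ball c (r c))" for x i 
      using that UV by (auto simp: sobolev_pair_def Lp_supp_def)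
  qed (use ry A in auto)
qed

section \<open>Gaussian sums over the nodes\<close>

definition node_sum_const :: "nat \<Rightarrow> real" where
  "node_sum_const d = (\<Sum>n. exp (- real n) * (real n + 2) ^ d)"

definition moment_const :: "real \<Rightarrow> real \<Rightarrow> nat \<Rightarrow> real \<Rightarrow> real" where
  "moment_const \<gamma> T m \<kappa> = fact m * exp ((\<kappa> + 2)\<^sup>2 / (4 * \<gamma>)) * T"

lemma power_le_fact_exp:
  fixes x :: real assumes "x \<ge> 0" shows "x ^ m \<le> fact m * exp x"
proof -
  have "(\<Sum>n\<in>{m}. x ^ n /\<^sub>R fact n) \<le> (\<Sum>n. x ^ n /\<^sub>R fact n)"
    by (rule sum_le_suminf[OF summable_exp_generic]) (use assms in auto)
  then show ?thesis by (simp add: exp_def field_simps)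
qed

lemma summable_node_sum: "summable (\<lambda>n. exp (- real n) * (real n + 2) ^ d)"
proof (rule summable_comparison_test')
  show "summable (\<lambda>n. (2 ^ d * fact d * exp 1) * exp (- 1 / 2 :: real) ^ n)"
    by (intro summable_mult summable_geometric) simp
  fix n :: nat
  have "(real n + 2) ^ d = 2 ^ d * ((real n + 2) / 2) ^ d" by (simp add: power_divide)
  also have "\<dots> \<le> 2 ^ d * (fact d * exp ((real n + 2) / 2))"
    by (intro mult_left_mono power_le_fact_exp) auto
  finally have "exp (- real n) * (real n + 2) ^ d \<le> exp (- real n) * (2 ^ d * (fact d * exp ((real n + 2) / 2)))"
    by (intro mult_left_mono) auto
  also have "\<dots> = 2 ^ d * fact d * exp (- real n + (real n + 2) / 2)" by (simp only: exp_add mult_ac)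
  also have "- real n + (real n + 2) / 2 = 1 + real n * (- 1 / 2)" by (simp add: field_simps)
  also have "exp (1 + real n * (- 1 / 2)) = exp 1 * exp (- 1 / 2 :: real) ^ n" by (simp only: exp_add exp_of_nat_mult)
  finally show "norm (exp (- real n) * (real n + 2) ^ d) \<le> (2 ^ d * fact d * exp 1) * exp (- 1 / 2 :: real) ^ n"
    by (simp add: mult_ac)
qed

text \<open>
The parameter \<open>T\<close>, which bounds the sum of \<open>exp (- \<bar>x\<^sub>a - x\<bar>/h)\<close> over the nodes, depends on \<open>\<tau>\<close> and the dimension
only. It is a parameter so that every constant below is visibly a function of \<open>\<gamma>\<close> and \<open>T\<close>, hence the same for all
schemes of a sequence.
\<close>

locale lme_nodes =
  fixes I :: "'i set" and X :: "'i \<Rightarrow> 'a::euclidean_space" and h \<gamma> \<tau> T :: real and A :: "'a set"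
  assumes fin: "finite I" and inj: "inj_on X I" and h: "h > 0" and \<gamma>: "\<gamma> > 0"
    and cov: "h_covering h (X ` I) A" and dens: "h_density_bounded h (X ` I) \<tau>"
    and T: "T = \<tau> * node_sum_const DIM('a)"
begin

text \<open>
Polynomial growth of the number of nodes, by counting in measure. Attach to every node the ball of radius \<open>h\<close>
around it; the density bound says that no point lies in more than \<open>\<tau>\<close> of these balls, and the balls of the nodes
counted here lie in a ball of radius \<open>(n + 1) h\<close>. Comparing volumes gives the bound.
\<close>

lemma node_count:
  "real (card {a \<in> I. norm (X a - x) \<le> real n * h}) \<le> \<tau> * (real n + 1) ^ DIM('a)"
proof -
  let ?N = "{a \<in> I. norm (X a - x) \<le> real n * h}"
  let ?B = "cball x ((real n + 1) * h)"
  let ?v = "unit_ball_vol (real DIM('a))"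
  have fN: "finite ?N" using fin by simp
  have fin_ball: "emeasure lborel (cball c r) < \<infinity>" for c :: 'a and r by (rule emeasure_bounded_finite) simp
  have iI: "integrable lborel (indicator (cball c r) :: 'a \<Rightarrow> real)" for c r
    using fin_ball[of c r] by (auto intro!: integrable_real_indicator)
  have ptw: "(\<Sum>a\<in>?N. indicator (cball (X a) h) z) \<le> \<tau> * indicator ?B z" for z :: 'a
  proof (cases "z \<in> ?B")
    case True
    have "(\<Sum>a\<in>?N. indicator (cball (X a) h) z) = real (card {a \<in> ?N. z \<in> cball (X a) h})"
      using fN by (simp add: indicator_def sum.If_cases Int_def)
    also have "card {a \<in> ?N. z \<in> cball (X a) h} = card (X ` {a \<in> ?N. z \<in> cball (X a) h})"
      by (rule card_image[symmetric]) (rule inj_on_subset[OF inj], auto)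
    also have "card (X ` {a \<in> ?N. z \<in> cball (X a) h}) \<le> card (X ` I \<inter> cball z h)"
      using fin by (intro card_mono) (auto simp: dist_commute)
    also have "real (card (X ` I \<inter> cball z h)) \<le> \<tau>" using dens by (simp add: h_density_bounded_def)
    finally show ?thesis using True by simp
  next
    case False
    have "z \<notin> cball (X a) h" if "a \<in> ?N" for a
    proof
      assume "z \<in> cball (X a) h"
      then have "norm (X a - z) \<le> h" "norm (X a - x) \<le> real n * h" using that by (auto simp: dist_norm)
      then have "norm (x - z) \<le> (real n + 1) * h" 
        using norm_triangle_ineq4[of "X a - z" "X a - x"] by (simp add: algebra_simps norm_minus_commute)
      then show False using False by (simp add: dist_norm)
    qed
    then show ?thesis using False by simp
  qed
  have "real (card ?N) * (?v * h ^ DIM('a)) = (\<Sum>a\<in>?N. measure lborel (cball (X a) h))"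
    using h by (simp add: content_cball)
  also have "\<dots> = (\<Sum>a\<in>?N. LINT z|lborel. indicator (cball (X a) h) z)"
    using fin_ball by simp
  also have "\<dots> = (LINT z|lborel. (\<Sum>a\<in>?N. indicator (cball (X a) h) z))"
    by (rule Bochner_Integration.integral_sum[symmetric]) (rule iI)
  also have "\<dots> \<le> (LINT z|lborel. \<tau> * indicator ?B z)"
    by (rule integral_mono) (use iI ptw in auto)
  also have "\<dots> = \<tau> * measure lborel ?B" using fin_ball by simp
  also have "measure lborel ?B = ?v * ((real n + 1) * h) ^ DIM('a)" using h by (subst content_cball) auto
  finally have "(?v * h ^ DIM('a)) * real (card ?N) \<le> (?v * h ^ DIM('a)) * (\<tau> * (real n + 1) ^ DIM('a))"
    by (simp add: power_mult_distrib mult_ac)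
  then show ?thesis using h by (subst (asm) mult_le_cancel_left_pos) auto
qed

lemma exp_sum_le: "(\<Sum>a\<in>I. exp (- (norm (X a - x) / h))) \<le> T"
proof -
  let ?\<rho> = "\<lambda>a. norm (X a - x) / h"
  let ?f = "\<lambda>a n. exp (- real n) * (if ?\<rho> a \<le> real n + 1 then 1 else 0)"
  have sumexp: "summable (\<lambda>n. exp (- real n))"
    using summable_geometric[of "exp (- 1::real)"] by (simp add: exp_of_nat_mult[symmetric])
  have sm: "summable (?f a)" for a
    by (rule summable_comparison_test'[OF sumexp]) auto
  have "exp (- ?\<rho> a) \<le> (\<Sum>n. ?f a n)" for a
  proof -
    define n where "n = nat \<lfloor>?\<rho> a\<rfloor>"
    have n: "real n \<le> ?\<rho> a" "?\<rho> a \<le> real n + 1" using h by (auto simp: n_def)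
    have "exp (- ?\<rho> a) \<le> (\<Sum>n\<in>{n}. ?f a n)" using n by simp
    also have "\<dots> \<le> (\<Sum>n. ?f a n)" by (rule sum_le_suminf[OF sm]) auto
    finally show ?thesis .
  qed
  then have "(\<Sum>a\<in>I. exp (- ?\<rho> a)) \<le> (\<Sum>a\<in>I. \<Sum>n. ?f a n)" by (rule sum_mono)
  also have "\<dots> = (\<Sum>n. \<Sum>a\<in>I. ?f a n)" by (rule suminf_sum[symmetric]) (rule sm)
  also have "\<dots> \<le> (\<Sum>n. \<tau> * (exp (- real n) * (real n + 2) ^ DIM('a)))"
  proof (rule suminf_le)
    fix n
    have "(\<Sum>a\<in>I. ?f a n) = exp (- real n) * real (card {a \<in> I. ?\<rho> a \<le> real n + 1})"
      using fin by (simp add: sum_distrib_left[symmetric] sum.If_cases Int_def)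
    also have "{a \<in> I. ?\<rho> a \<le> real n + 1} = {a \<in> I. norm (X a - x) \<le> real (Suc n) * h}"
      using h by (auto simp: field_simps)
    also have "exp (- real n) * real (card {a \<in> I. norm (X a - x) \<le> real (Suc n) * h}) \<le> exp (- real n) * (\<tau> * (real (Suc n) + 1) ^ DIM('a))"
      by (intro mult_left_mono node_count) auto
    finally show "(\<Sum>a\<in>I. ?f a n) \<le> \<tau> * (exp (- real n) * (real n + 2) ^ DIM('a))" by (simp add: mult_ac add_ac)
  qed (auto intro!: summable_sum sm summable_mult summable_node_sum)
  also have "\<dots> = T" unfolding T node_sum_const_def by (rule suminf_mult[OF summable_node_sum])
  finally show ?thesis .
qed

text \<open>
Every vertex of a covering simplex is near the point that the simplex contains, because the size is the diameter
of an enclosing ball.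
\<close>

lemma near_node:
  assumes "y \<in> A" obtains a where "a \<in> I" "norm (X a - y) \<le> h"
proof -
  obtain C where C: "C \<subseteq> X ` I" "card C = DIM('a) + 1" "set_size (convex hull C) < h" "y \<in> convex hull C"
    using cov assms unfolding h_covering_def by blast
  have "finite C" using C(2) card.infinite by fastforce
  then have "bounded (convex hull C)" by (simp add: finite_imp_bounded bounded_convex_hull)
  then obtain c r where "r \<ge> 0" "convex hull C \<subseteq> cball c r" unfolding bounded_subset_cball by auto
  then have ne: "{2 * r | r. r \<ge> 0 \<and> (\<exists>c. convex hull C \<subseteq> cball c r)} \<noteq> {}" by blast
  obtain v where "v \<in> {2 * r | r. r \<ge> 0 \<and> (\<exists>c. convex hull C \<subseteq> cball c r)}" "v < h"
    using cInf_lessD[OF ne C(3)[unfolded set_size_def]] by blast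
  then obtain r c where r: "2 * r < h" "convex hull C \<subseteq> cball c r" by auto
  obtain w where w: "w \<in> C" using C(2) by fastforce
  then have "w \<in> cball c r" "y \<in> cball c r" using r(2) C(4) hull_subset[of C convex] by auto
  then have "norm (w - y) \<le> 2 * r" using dist_triangle[of w y c] by (simp add: dist_norm norm_minus_commute)
  then show ?thesis using that C(1) w r(1) by force
qed

lemma in_hull: "y \<in> A \<Longrightarrow> y \<in> convex hull (X ` I)"
  using cov hull_mono unfolding h_covering_def by blast

text \<open>
The covering condition is applied to the point at distance \<open>2h\<close> from \<open>x\<close> in the direction of \<open>v\<close>. A node within
\<open>h\<close> of it is still at least \<open>h\<close> ahead of \<open>x\<close> in that direction, and at most \<open>3h\<close> away.
\<close>

lemma directional_node:
  assumes deep: "cball x (2 * h) \<subseteq> A"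
  obtains a where "a \<in> I" "v \<bullet> (X a - x) \<ge> norm v * h" "norm (X a - x) \<le> 3 * h"
proof (cases "v = 0")
  case True
  have "x \<in> A" using deep h by auto
  then obtain a where "a \<in> I" "norm (X a - x) \<le> h" by (rule near_node)
  then show ?thesis using that[of a] True h by auto
next
  case False
  define e where "e = v /\<^sub>R norm v"
  have e: "norm e = 1" "e \<bullet> e = 1" using False by (auto simp: e_def dot_square_norm power2_eq_square)
  have "x + (2 * h) *\<^sub>R e \<in> A" using deep e h by (auto simp: dist_norm)
  then obtain a where a: "a \<in> I" "norm (X a - (x + (2 * h) *\<^sub>R e)) \<le> h" by (rule near_node)
  let ?d = "X a - (x + (2 * h) *\<^sub>R e)"
  have eq: "X a - x = ?d + (2 * h) *\<^sub>R e" by simp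
  have "norm (X a - x) \<le> norm ?d + norm ((2 * h) *\<^sub>R e)" unfolding eq by (rule norm_triangle_ineq)
  then have 1: "norm (X a - x) \<le> 3 * h" using a e h by simp
  have "\<bar>e \<bullet> ?d\<bar> \<le> h" using Cauchy_Schwarz_ineq2[of e ?d] e a by simp
  moreover have "e \<bullet> (X a - x) = e \<bullet> ?d + 2 * h * (e \<bullet> e)" by (simp add: inner_diff_right inner_add_right)
  ultimately have "e \<bullet> (X a - x) \<ge> h" unfolding e(2) by linarith
  then have "norm v * (e \<bullet> (X a - x)) \<ge> norm v * h" by (rule mult_left_mono) simp
  moreover have "norm v * (e \<bullet> (X a - x)) = v \<bullet> (X a - x)" using False by (simp add: e_def)
  ultimately show ?thesis using that[of a] a 1 by simp
qed

definition "\<beta> = \<gamma> / h\<^sup>2"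

lemma \<beta>_pos: "\<beta> > 0" using \<gamma> h by (simp add: \<beta>_def)

text \<open>
The summands of the partition function \<open>Z(x,\<lambda>)\<close>, with \<open>\<nu> = - \<lambda>\<close>.
\<close>

definition tilt :: "'a \<Rightarrow> 'a \<Rightarrow> 'i \<Rightarrow> real" where
  "tilt x \<nu> a = exp (- \<beta> * (norm (X a - x))\<^sup>2 + \<nu> \<bullet> (X a - x))"

lemma tilt_pos: "tilt x \<nu> a > 0" by (simp add: tilt_def)

text \<open>
For \<open>\<rho> = \<bar>x\<^sub>a - x\<bar>/h\<close> the weight is at most \<open>exp (- \<gamma> \<rho>\<^sup>2 + \<kappa> \<rho>)\<close>. Multiplying by \<open>\<rho>\<^sup>m\<close>, which is at most
\<open>m! exp \<rho>\<close>, and completing the square leaves a multiple of \<open>exp (- \<rho>)\<close>, whose sum over the nodes is bounded.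
\<close>

lemma tilt_moment_le:
  assumes "norm \<nu> * h \<le> \<kappa>"
  shows "(\<Sum>a\<in>I. tilt x \<nu> a * norm (X a - x) ^ m) \<le> h ^ m * moment_const \<gamma> T m \<kappa>"
proof -
  have "tilt x \<nu> a * norm (X a - x) ^ m \<le> h ^ m * fact m * exp ((\<kappa> + 2)\<^sup>2 / (4 * \<gamma>)) * exp (- (norm (X a - x) / h))" for a
  proof -
    define \<rho> where "\<rho> = norm (X a - x) / h"
    have \<rho>: "\<rho> \<ge> 0" "norm (X a - x) = h * \<rho>" using h by (auto simp: \<rho>_def)
    have "\<nu> \<bullet> (X a - x) \<le> norm \<nu> * norm (X a - x)" by (rule norm_cauchy_schwarz)
    also have "\<dots> = (norm \<nu> * h) * \<rho>" by (simp add: \<rho>)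
    also have "\<dots> \<le> \<kappa> * \<rho>" using assms \<rho> by (intro mult_right_mono) auto
    finally have "tilt x \<nu> a \<le> exp (- \<gamma> * \<rho>\<^sup>2 + \<kappa> * \<rho>)"
      using h by (simp add: tilt_def \<beta>_def \<rho> power_mult_distrib)
    moreover have "norm (X a - x) ^ m \<le> h ^ m * (fact m * exp \<rho>)"
      using power_le_fact_exp[OF \<rho>(1), of m] h by (simp add: \<rho>(2) power_mult_distrib)
    ultimately have "tilt x \<nu> a * norm (X a - x) ^ m \<le> exp (- \<gamma> * \<rho>\<^sup>2 + \<kappa> * \<rho>) * (h ^ m * (fact m * exp \<rho>))"
      by (intro mult_mono) auto
    also have "\<dots> = h ^ m * fact m * exp (- \<gamma> * \<rho>\<^sup>2 + \<kappa> * \<rho> + \<rho>)" by (simp add: exp_add mult_ac)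
    also have "\<dots> \<le> h ^ m * fact m * exp ((\<kappa> + 2)\<^sup>2 / (4 * \<gamma>) - \<rho>)"
    proof -
      have "0 \<le> (2 * \<gamma> * \<rho> - (\<kappa> + 2))\<^sup>2 / (4 * \<gamma>)" using \<gamma> by simp
      also have "\<dots> = \<gamma> * \<rho>\<^sup>2 - (\<kappa> + 2) * \<rho> + (\<kappa> + 2)\<^sup>2 / (4 * \<gamma>)"
        using \<gamma> by (simp add: power2_eq_square field_simps)
      finally have "- \<gamma> * \<rho>\<^sup>2 + \<kappa> * \<rho> + \<rho> \<le> (\<kappa> + 2)\<^sup>2 / (4 * \<gamma>) - \<rho>" by (simp add: algebra_simps)
      then show ?thesis using h by (intro mult_left_mono) auto
    qed
    also have "\<dots> = h ^ m * fact m * exp ((\<kappa> + 2)\<^sup>2 / (4 * \<gamma>)) * exp (- \<rho>)" by (simp only: diff_conv_add_uminus exp_add mult.assoc)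
    finally show ?thesis unfolding \<rho>_def .
  qed
  then have "(\<Sum>a\<in>I. tilt x \<nu> a * norm (X a - x) ^ m) \<le> (\<Sum>a\<in>I. h ^ m * fact m * exp ((\<kappa> + 2)\<^sup>2 / (4 * \<gamma>)) * exp (- (norm (X a - x) / h)))"
    by (rule sum_mono)
  also have "\<dots> = h ^ m * fact m * exp ((\<kappa> + 2)\<^sup>2 / (4 * \<gamma>)) * (\<Sum>a\<in>I. exp (- (norm (X a - x) / h)))"
    by (simp add: sum_distrib_left)
  also have "\<dots> \<le> h ^ m * fact m * exp ((\<kappa> + 2)\<^sup>2 / (4 * \<gamma>)) * T"
    using h by (intro mult_left_mono exp_sum_le) auto
  finally show ?thesis by (simp add: moment_const_def mult_ac)
qed

text \<open>
The partition function grows exponentially in the dual variable: one node far ahead in the direction of \<open>\<nu>\<close>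
contributes at least \<open>exp (- 9 \<gamma> + h \<bar>\<nu>\<bar>)\<close>, where \<open>9 \<gamma>\<close> comes from its distance of at most \<open>3h\<close>.
\<close>

lemma tilt_sum_ge:
  assumes deep: "cball x (2 * h) \<subseteq> A"
  shows "(\<Sum>a\<in>I. tilt x \<nu> a) \<ge> exp (- 9 * \<gamma> + norm \<nu> * h)"
proof -
  obtain a where a: "a \<in> I" "\<nu> \<bullet> (X a - x) \<ge> norm \<nu> * h" "norm (X a - x) \<le> 3 * h"
    by (rule directional_node[OF deep])
  have "(norm (X a - x))\<^sup>2 \<le> (3 * h)\<^sup>2" using a(3) by (intro power_mono) auto
  then have "\<beta> * (norm (X a - x))\<^sup>2 \<le> \<beta> * (3 * h)\<^sup>2" using \<beta>_pos by (intro mult_left_mono) auto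
  also have "\<dots> = 9 * \<gamma>" using h by (simp add: \<beta>_def power2_eq_square)
  finally have "exp (- 9 * \<gamma> + norm \<nu> * h) \<le> tilt x \<nu> a" using a(2) by (simp add: tilt_def)
  also have "\<dots> \<le> (\<Sum>a\<in>I. tilt x \<nu> a)"
    by (rule member_le_sum[OF a(1)]) (use fin tilt_pos in \<open>auto intro: less_imp_le\<close>)
  finally show ?thesis .
qed

definition "dual_bound = 9 * \<gamma> + ln (moment_const \<gamma> T 0 0)"

text \<open>
Outside the ball \<open>h \<bar>\<nu>\<bar> \<le> dual_bound\<close> the partition function exceeds its value at \<open>0\<close>; hence a minimiser over
this ball is a global one, and there the gradient vanishes.
\<close>

lemma dual_minimizer:
  assumes deep: "cball x (2 * h) \<subseteq> A"
  obtains \<nu> where "norm \<nu> * h \<le> dual_bound" "(\<Sum>a\<in>I. tilt x \<nu> a *\<^sub>R (X a - x)) = 0"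
proof -
  let ?Z = "\<lambda>\<nu>. \<Sum>a\<in>I. tilt x \<nu> a"
  have Z0: "?Z 0 \<le> moment_const \<gamma> T 0 0" using tilt_moment_le[of 0 0 x 0] by simp
  have "exp (- 9 * \<gamma>) \<le> ?Z 0" using tilt_sum_ge[OF deep, of 0] by simp
  then have M: "moment_const \<gamma> T 0 0 \<ge> exp (- 9 * \<gamma>)" using Z0 by linarith
  then have Mpos: "moment_const \<gamma> T 0 0 > 0" using exp_gt_zero less_le_trans by blast
  have "- 9 * \<gamma> \<le> ln (moment_const \<gamma> T 0 0)" using M Mpos by (subst ln_ge_iff) auto
  then have k0: "dual_bound \<ge> 0" by (simp add: dual_bound_def)
  have cont: "continuous_on S ?Z" for S unfolding tilt_def by (intro continuous_intros)
  have kh: "0 \<le> dual_bound / h" using k0 h by simp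
  then have "cball (0::'a) (dual_bound / h) \<noteq> {}" by (simp only: cball_eq_empty not_less)
  then obtain \<nu> where \<nu>: "\<nu> \<in> cball 0 (dual_bound / h)" "\<And>\<mu>. \<mu> \<in> cball 0 (dual_bound / h) \<Longrightarrow> ?Z \<nu> \<le> ?Z \<mu>"
    using continuous_attains_inf[OF compact_cball _ cont] by metis
  have min: "?Z \<nu> \<le> ?Z \<mu>" for \<mu>
  proof (cases "\<mu> \<in> cball 0 (dual_bound / h)")
    case False
    then have "dual_bound < norm \<mu> * h" using h by (simp add: field_simps)
    have "?Z \<nu> \<le> ?Z 0" using \<nu>(2)[of 0] kh by simp
    also have "\<dots> \<le> moment_const \<gamma> T 0 0" by (rule Z0)
    also have "\<dots> = exp (- 9 * \<gamma> + dual_bound)" using Mpos by (simp add: dual_bound_def)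
    also have "\<dots> \<le> exp (- 9 * \<gamma> + norm \<mu> * h)" using \<open>dual_bound < norm \<mu> * h\<close> by simp
    also have "\<dots> \<le> ?Z \<mu>" by (rule tilt_sum_ge[OF deep])
    finally show ?thesis .
  qed (rule \<nu>(2))
  have "((\<lambda>\<nu>. tilt x \<nu> a) has_derivative (\<lambda>v. tilt x \<nu> a * (v \<bullet> (X a - x)))) (at \<nu>)" for a
    unfolding tilt_def by (auto intro!: derivative_eq_intros)
  then have "(?Z has_derivative (\<lambda>v. \<Sum>a\<in>I. tilt x \<nu> a * (v \<bullet> (X a - x)))) (at \<nu>)"
    by (rule has_derivative_sum)
  then have "(\<lambda>v. \<Sum>a\<in>I. tilt x \<nu> a * (v \<bullet> (X a - x))) = (\<lambda>v. 0)"
    by (rule differential_zero_maxmin[of \<nu> UNIV, rotated 2]) (use min in auto)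
  moreover have "(\<Sum>a\<in>I. tilt x \<nu> a * (v \<bullet> (X a - x))) = v \<bullet> (\<Sum>a\<in>I. tilt x \<nu> a *\<^sub>R (X a - x))" for v
    by (simp add: inner_sum_right)
  ultimately have "v \<bullet> (\<Sum>a\<in>I. tilt x \<nu> a *\<^sub>R (X a - x)) = 0" for v by metis
  then have "(\<Sum>a\<in>I. tilt x \<nu> a *\<^sub>R (X a - x)) = 0" using inner_eq_zero_iff by blast
  moreover have "norm \<nu> * h \<le> dual_bound" using \<nu>(1) h by (simp add: field_simps)
  ultimately show ?thesis using that by blast
qed
end

section \<open>Shape functions as an exponential family\<close>

context lme_nodes begin

text \<open>
The same weights written without reference to \<open>x\<close>: after multiplication by a factor that does not depend on the
node, \<open>tilt x \<nu>\<close> becomes \<open>gibbs \<mu>\<close> for \<open>\<mu> = \<nu> + 2 \<beta> x\<close>. In this form the normalised weights are a fixed exponential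
family in \<open>\<mu>\<close>, and the evaluation point enters only through the requirement that the mean be \<open>x\<close>.
\<close>

definition gibbs :: "'a \<Rightarrow> 'i \<Rightarrow> real" where
  "gibbs \<mu> a = exp (- \<beta> * (norm (X a))\<^sup>2 + \<mu> \<bullet> X a)"

definition prob :: "'a \<Rightarrow> 'i \<Rightarrow> real" where
  "prob \<mu> a = gibbs \<mu> a / (\<Sum>b\<in>I. gibbs \<mu> b)"

definition mean :: "'a \<Rightarrow> 'a" where
  "mean \<mu> = (\<Sum>a\<in>I. prob \<mu> a *\<^sub>R X a)"

lemma gibbs_tilt: "gibbs (\<nu> + (2 * \<beta>) *\<^sub>R x) a = tilt x \<nu> a * exp (\<beta> * (norm x)\<^sup>2 + \<nu> \<bullet> x)"
proof -
  have "- \<beta> * (norm (X a))\<^sup>2 + (\<nu> + (2 * \<beta>) *\<^sub>R x) \<bullet> X a 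
      = (- \<beta> * (norm (X a - x))\<^sup>2 + \<nu> \<bullet> (X a - x)) + (\<beta> * (norm x)\<^sup>2 + \<nu> \<bullet> x)"
    by (simp add: power2_norm_eq_inner inner_diff_left inner_diff_right inner_add_left inner_commute algebra_simps)
  then show ?thesis unfolding gibbs_def tilt_def by (simp only: exp_add)
qed

lemma prob_tilt: "prob (\<nu> + (2 * \<beta>) *\<^sub>R x) a = tilt x \<nu> a / (\<Sum>b\<in>I. tilt x \<nu> b)"
  unfolding prob_def gibbs_tilt by (simp add: sum_distrib_right[symmetric])

lemma gibbs_pos: "gibbs \<mu> a > 0" by (simp add: gibbs_def)

lemma gibbs_sum_pos: "I \<noteq> {} \<Longrightarrow> (\<Sum>b\<in>I. gibbs \<mu> b) > 0"
  using fin gibbs_pos by (intro sum_pos) auto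

lemma prob_pos: "I \<noteq> {} \<Longrightarrow> prob \<mu> a > 0"
  using gibbs_pos gibbs_sum_pos by (simp add: prob_def)

lemma prob_sum: "I \<noteq> {} \<Longrightarrow> (\<Sum>a\<in>I. prob \<mu> a) = 1"
  using gibbs_sum_pos[of \<mu>] by (simp add: prob_def sum_divide_distrib[symmetric])

definition "moment_bound m = moment_const \<gamma> T m dual_bound * exp (9 * \<gamma>)"
definition "variance_bound = exp (- 9 * \<gamma> - 3 * dual_bound) / moment_const \<gamma> T 0 dual_bound"

lemma nonempty: "cball x (2 * h) \<subseteq> A \<Longrightarrow> I \<noteq> {}"
  using directional_node[of x 0] by blast

text \<open>
The Gibbs weights with mean \<open>x\<close>, with the two estimates that govern everything: moments of the expected order
in \<open>h\<close>, and a covariance bounded below, since in every direction there is a node at distance between \<open>h\<close>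
and \<open>3h\<close> whose weight is bounded below.
\<close>

lemma dual_point:
  assumes deep: "cball x (2 * h) \<subseteq> A"
  obtains \<mu> where "mean \<mu> = x" "\<And>m. (\<Sum>a\<in>I. prob \<mu> a * norm (X a - x) ^ m) \<le> h ^ m * moment_bound m"
    "\<And>v. (\<Sum>a\<in>I. prob \<mu> a * (v \<bullet> (X a - x))\<^sup>2) \<ge> variance_bound * (norm v * h)\<^sup>2" "variance_bound > 0"
proof -
  obtain \<nu> where \<nu>: "norm \<nu> * h \<le> dual_bound" "(\<Sum>a\<in>I. tilt x \<nu> a *\<^sub>R (X a - x)) = 0"
    by (rule dual_minimizer[OF deep])
  define Z where "Z = (\<Sum>b\<in>I. tilt x \<nu> b)"
  define \<mu> where "\<mu> = \<nu> + (2 * \<beta>) *\<^sub>R x"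
  have ne: "I \<noteq> {}" by (rule nonempty[OF deep])
  have p: "prob \<mu> a = tilt x \<nu> a / Z" for a unfolding \<mu>_def Z_def by (rule prob_tilt)
  have "exp (- 9 * \<gamma>) \<le> exp (- 9 * \<gamma> + norm \<nu> * h)" using h by simp
  also have "\<dots> \<le> Z" unfolding Z_def by (rule tilt_sum_ge[OF deep])
  finally have Zge: "exp (- 9 * \<gamma>) \<le> Z" .
  then have Zpos: "Z > 0" using exp_gt_zero less_le_trans by blast
  have Zle: "Z \<le> moment_const \<gamma> T 0 dual_bound" unfolding Z_def using tilt_moment_le[OF \<nu>(1), of x 0] by simp
  then have low: "variance_bound > 0" using Zpos by (simp add: variance_bound_def)
  have "(\<Sum>a\<in>I. prob \<mu> a *\<^sub>R (X a - x)) = (\<Sum>a\<in>I. tilt x \<nu> a *\<^sub>R (X a - x)) /\<^sub>R Z"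
    by (simp add: p scaleR_sum_right divide_inverse mult.commute)
  also have "\<dots> = 0" using \<nu>(2) by simp
  finally have "mean \<mu> - x = 0"
    unfolding mean_def using prob_sum[OF ne, of \<mu>] by (simp add: scaleR_diff_right sum_subtractf scaleR_sum_left[symmetric])
  then have 1: "mean \<mu> = x" by simp
  have 2: "(\<Sum>a\<in>I. prob \<mu> a * norm (X a - x) ^ m) \<le> h ^ m * moment_bound m" for m
  proof -
    have "(\<Sum>a\<in>I. prob \<mu> a * norm (X a - x) ^ m) = (\<Sum>a\<in>I. tilt x \<nu> a * norm (X a - x) ^ m) / Z"
      by (simp add: p sum_divide_distrib)
    also have "\<dots> \<le> (\<Sum>a\<in>I. tilt x \<nu> a * norm (X a - x) ^ m) / exp (- 9 * \<gamma>)"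
      using Zge less_imp_le[OF tilt_pos] by (intro divide_left_mono sum_nonneg mult_pos_pos Zpos) auto
    also have "\<dots> = (\<Sum>a\<in>I. tilt x \<nu> a * norm (X a - x) ^ m) * exp (9 * \<gamma>)" by (simp add: exp_minus divide_inverse)
    also have "\<dots> \<le> (h ^ m * moment_const \<gamma> T m dual_bound) * exp (9 * \<gamma>)"
      by (intro mult_right_mono tilt_moment_le \<nu>) auto
    finally show ?thesis by (simp add: moment_bound_def mult.assoc)
  qed
  have 3: "(\<Sum>a\<in>I. prob \<mu> a * (v \<bullet> (X a - x))\<^sup>2) \<ge> variance_bound * (norm v * h)\<^sup>2" for v
  proof -
    obtain a where a: "a \<in> I" "v \<bullet> (X a - x) \<ge> norm v * h" "norm (X a - x) \<le> 3 * h"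
      by (rule directional_node[OF deep])
    have "(norm (X a - x))\<^sup>2 \<le> (3 * h)\<^sup>2" using a(3) by (intro power_mono) auto
    then have "\<beta> * (norm (X a - x))\<^sup>2 \<le> \<beta> * (3 * h)\<^sup>2" using \<beta>_pos by (intro mult_left_mono) auto
    also have "\<dots> = 9 * \<gamma>" using h by (simp add: \<beta>_def power2_eq_square)
    finally have "\<beta> * (norm (X a - x))\<^sup>2 \<le> 9 * \<gamma>" .
    moreover have "- (3 * dual_bound) \<le> \<nu> \<bullet> (X a - x)"
    proof -
      have "\<bar>\<nu> \<bullet> (X a - x)\<bar> \<le> norm \<nu> * norm (X a - x)" by (rule Cauchy_Schwarz_ineq2)
      also have "\<dots> \<le> norm \<nu> * (3 * h)" using a(3) by (intro mult_left_mono) auto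
      also have "\<dots> \<le> 3 * dual_bound" using \<nu>(1) by simp
      finally show ?thesis by linarith
    qed
    ultimately have "exp (- 9 * \<gamma> - 3 * dual_bound) \<le> tilt x \<nu> a" by (simp add: tilt_def)
    then have "variance_bound \<le> prob \<mu> a"
      unfolding variance_bound_def p using Zpos Zle by (intro frac_le) (auto intro: less_imp_le[OF tilt_pos])
    moreover have "(norm v * h)\<^sup>2 \<le> (v \<bullet> (X a - x))\<^sup>2" using a(2) h by (intro power_mono) auto
    ultimately have "variance_bound * (norm v * h)\<^sup>2 \<le> prob \<mu> a * (v \<bullet> (X a - x))\<^sup>2"
      using low prob_pos[OF ne, of \<mu> a] by (intro mult_mono) auto
    also have "\<dots> \<le> (\<Sum>a\<in>I. prob \<mu> a * (v \<bullet> (X a - x))\<^sup>2)"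
      by (rule member_le_sum[OF a(1)]) (use fin less_imp_le[OF prob_pos[OF ne, of \<mu>]] in auto)
    finally show ?thesis .
  qed
  show ?thesis by (rule that[OF 1 2 3 low])
qed

lemma ln_prob: "I \<noteq> {} \<Longrightarrow> ln (prob \<mu> a) = - \<beta> * (norm (X a))\<^sup>2 + \<mu> \<bullet> X a - ln (\<Sum>b\<in>I. gibbs \<mu> b)"
  unfolding prob_def using gibbs_pos[of \<mu> a] gibbs_sum_pos[of \<mu>] by (simp add: ln_div) (simp add: gibbs_def)

text \<open>
If \<open>p\<close> and \<open>p'\<close> have the same mean, then the sum of \<open>(p - p') (ln p - ln p')\<close> is zero; each summand is nonnegative,
so \<open>p = p'\<close>. Then \<open>\<mu> - \<mu>'\<close> has the same inner product with all nodes, which is impossible for a nonzero vector as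
there are nodes on both sides of \<open>x\<close>.
\<close>

lemma mean_inj:
  assumes deep: "cball x (2 * h) \<subseteq> A" and eq: "mean \<mu> = mean \<mu>'"
  shows "\<mu> = \<mu>'"
proof -
  have ne: "I \<noteq> {}" by (rule nonempty[OF deep])
  let ?p = "prob \<mu>" and ?p' = "prob \<mu>'"
  define K where "K = ln (\<Sum>b\<in>I. gibbs \<mu> b) - ln (\<Sum>b\<in>I. gibbs \<mu>' b)"
  have d: "(\<mu> - \<mu>') \<bullet> X a = ln (?p a) - ln (?p' a) + K" for a
    by (simp add: ln_prob[OF ne] K_def inner_diff_left)
  have "(\<Sum>a\<in>I. (?p a - ?p' a) * (ln (?p a) - ln (?p' a))) = (\<Sum>a\<in>I. (?p a - ?p' a) * ((\<mu> - \<mu>') \<bullet> X a - K))"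
    unfolding d by simp
  also have "\<dots> = (\<mu> - \<mu>') \<bullet> (mean \<mu> - mean \<mu>') - K * ((\<Sum>a\<in>I. ?p a) - (\<Sum>a\<in>I. ?p' a))"
    by (simp add: mean_def inner_diff_right inner_sum_right algebra_simps sum_subtractf sum.distrib sum_distrib_left)
  also have "\<dots> = 0" by (simp add: eq prob_sum[OF ne])
  finally have s0: "(\<Sum>a\<in>I. (?p a - ?p' a) * (ln (?p a) - ln (?p' a))) = 0" .
  have nn: "(s - t) * (ln s - ln t) \<ge> 0 \<and> ((s - t) * (ln s - ln t) = 0 \<longrightarrow> s = t)" if "s > 0" "t > 0" for s t :: real
    using that by (cases s t rule: linorder_cases) (auto simp: mult_nonpos_nonpos ln_inj_iff)
  have pe: "?p a = ?p' a" if "a \<in> I" for a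
    using s0 fin that nn[OF prob_pos[OF ne, of \<mu>] prob_pos[OF ne, of \<mu>']]
    by (subst (asm) sum_nonneg_eq_0_iff) auto
  have const: "(\<mu> - \<mu>') \<bullet> X a = K" if "a \<in> I" for a using d[of a] pe[OF that] by simp
  obtain a where a: "a \<in> I" "(\<mu> - \<mu>') \<bullet> (X a - x) \<ge> norm (\<mu> - \<mu>') * h" by (rule directional_node[OF deep])
  obtain b where b: "b \<in> I" "(- (\<mu> - \<mu>')) \<bullet> (X b - x) \<ge> norm (- (\<mu> - \<mu>')) * h" by (rule directional_node[OF deep])
  have "0 = (\<mu> - \<mu>') \<bullet> (X a - x) + (- (\<mu> - \<mu>')) \<bullet> (X b - x)"
    using const[OF a(1)] const[OF b(1)] unfolding inner_minus_left by (simp only: inner_diff_right)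
  then have "norm (\<mu> - \<mu>') * h \<le> 0" using a(2) b(2) unfolding norm_minus_cancel by linarith
  then have "norm (\<mu> - \<mu>') \<le> 0" using h by (simp add: mult_le_0_iff)
  then show ?thesis by simp
qed

text \<open>
For weights with the prescribed mean, \<open>\<beta>\<close> times the objective equals the relative entropy with respect to
the Gibbs weights up to a constant. The relative entropy is nonnegative and vanishes only at the Gibbs weights
themselves.
\<close>

lemma lme_minimizer_eq_prob:
  assumes ne: "I \<noteq> {}" and min: "lme_minimizer \<beta> I X (mean \<mu>) w" and a: "a \<in> I"
  shows "w a = prob \<mu> a"
proof -
  let ?p = "prob \<mu>"
  let ?x = "mean \<mu>"
  define L where "L = ln (\<Sum>b\<in>I. gibbs \<mu> b)"
  have obj: "\<beta> * lme_objective \<beta> I X ?x v = (\<Sum>a\<in>I. v a * (ln (v a) - ln (?p a))) + (\<mu> \<bullet> ?x - L - \<beta> * (norm ?x)\<^sup>2)"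
    if v: "lme_feasible I X ?x v" for v
  proof -
    have v1: "(\<Sum>a\<in>I. v a) = 1" "(\<Sum>a\<in>I. v a *\<^sub>R X a) = ?x" using v by (auto simp: lme_feasible_def)
    have lin: "(\<Sum>a\<in>I. v a * (c \<bullet> X a)) = c \<bullet> ?x" for c
      by (simp add: v1(2)[symmetric] inner_sum_right)
    have "(\<Sum>a\<in>I. v a * (norm (?x - X a))\<^sup>2) = (\<Sum>a\<in>I. v a * (norm ?x)\<^sup>2 - 2 * (v a * (?x \<bullet> X a)) + v a * (norm (X a))\<^sup>2)"
      by (intro sum.cong) (auto simp: power2_norm_eq_inner inner_diff_left inner_diff_right inner_commute algebra_simps)
    also have "\<dots> = (\<Sum>a\<in>I. v a * (norm (X a))\<^sup>2) - (norm ?x)\<^sup>2"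
      by (simp add: sum.distrib sum_subtractf sum_distrib_left[symmetric] sum_distrib_right[symmetric] v1 lin power2_norm_eq_inner)
    finally have 1: "(\<Sum>a\<in>I. v a * (norm (?x - X a))\<^sup>2) = (\<Sum>a\<in>I. v a * (norm (X a))\<^sup>2) - (norm ?x)\<^sup>2" .
    have "(\<Sum>a\<in>I. v a * ln (?p a)) = (\<Sum>a\<in>I. v a * (\<mu> \<bullet> X a) - \<beta> * (v a * (norm (X a))\<^sup>2) - L * v a)"
      by (intro sum.cong) (auto simp: ln_prob[OF ne] L_def algebra_simps)
    also have "\<dots> = \<mu> \<bullet> ?x - \<beta> * (\<Sum>a\<in>I. v a * (norm (X a))\<^sup>2) - L"
      by (simp add: sum_subtractf lin v1 sum_distrib_left[symmetric])
    finally have 2: "(\<Sum>a\<in>I. v a * ln (?p a)) = \<mu> \<bullet> ?x - \<beta> * (\<Sum>a\<in>I. v a * (norm (X a))\<^sup>2) - L" .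
    show ?thesis unfolding lme_objective_def 1 right_diff_distrib sum_subtractf 2
      using \<beta>_pos by (simp add: algebra_simps)
  qed
  have fp: "lme_feasible I X ?x ?p"
    using prob_pos[OF ne, of \<mu>] prob_sum[OF ne] by (auto simp: lme_feasible_def mean_def intro: less_imp_le)
  have fw: "lme_feasible I X ?x w" using min by (simp add: lme_minimizer_def)
  have "\<beta> * lme_objective \<beta> I X ?x w \<le> \<beta> * lme_objective \<beta> I X ?x ?p"
    using min fp \<beta>_pos by (intro mult_left_mono) (auto simp: lme_minimizer_def)
  then have "(\<Sum>a\<in>I. w a * (ln (w a) - ln (?p a))) \<le> 0" unfolding obj[OF fw] obj[OF fp] by simp
  moreover have "(\<Sum>a\<in>I. w a - ?p a) = 0"
    using fw prob_sum[OF ne] by (simp add: lme_feasible_def sum_subtractf)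
  ultimately have le: "(\<Sum>a\<in>I. w a * (ln (w a) - ln (?p a)) - (w a - ?p a)) \<le> 0" by (simp add: sum_subtractf)
  \<comment> \<open>Adding \<open>t - s\<close>, whose sum over the nodes is zero, makes the relative entropy nonnegative node by node.\<close>
  have kl: "s * (ln s - ln t) - (s - t) \<ge> 0 \<and> (s * (ln s - ln t) - (s - t) = 0 \<longrightarrow> s = t)" if "s \<ge> 0" "t > 0" for s t :: real
  proof (cases "s = 0")
    case False
    then have s: "s > 0" using that by simp
    have eq: "s * (ln s - ln t) - (s - t) = s * ((t / s - 1) - ln (t / s))"
      using s that by (simp add: ln_div field_simps)
    have "ln (t / s) \<le> t / s - 1" using s that by (intro ln_le_minus_one) auto
    moreover have "ln (t / s) = t / s - 1 \<Longrightarrow> t / s = 1" using s that by (intro ln_eq_minus_one) auto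
    ultimately show ?thesis unfolding eq using s by auto
  qed (use that in auto)
  have w0: "w a \<ge> 0" if "a \<in> I" for a using fw that by (simp add: lme_feasible_def)
  have "(\<Sum>a\<in>I. w a * (ln (w a) - ln (?p a)) - (w a - ?p a)) = 0"
    using le kl[OF w0 prob_pos[OF ne, of \<mu>]] by (intro antisym sum_nonneg) auto
  then have "w a * (ln (w a) - ln (?p a)) - (w a - ?p a) = 0"
    using fin a kl[OF w0 prob_pos[OF ne, of \<mu>]] by (subst (asm) sum_nonneg_eq_0_iff) auto
  then show ?thesis using kl[OF w0[OF a] prob_pos[OF ne, of \<mu> a]] by blast
qed

lemma prob_has_derivative:
  assumes ne: "I \<noteq> {}"
  shows "((\<lambda>\<mu>. prob \<mu> a) has_derivative (\<lambda>v. prob \<mu> a * (v \<bullet> (X a - mean \<mu>)))) (at \<mu>)"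
proof -
  let ?Z = "\<lambda>\<mu>. \<Sum>b\<in>I. gibbs \<mu> b"
  have g: "((\<lambda>\<mu>. gibbs \<mu> a) has_derivative (\<lambda>v. gibbs \<mu> a * (v \<bullet> X a))) (at \<mu>)" for a
    unfolding gibbs_def by (auto intro!: derivative_eq_intros)
  have Z: "(?Z has_derivative (\<lambda>v. \<Sum>b\<in>I. gibbs \<mu> b * (v \<bullet> X b))) (at \<mu>)"
    by (rule has_derivative_sum) (rule g)
  have Zp: "?Z \<mu> \<noteq> 0" using gibbs_sum_pos[OF ne, of \<mu>] by simp
  have m: "v \<bullet> mean \<mu> = (\<Sum>b\<in>I. gibbs \<mu> b * (v \<bullet> X b)) / ?Z \<mu>" for v
    by (simp add: mean_def prob_def inner_sum_right sum_divide_distrib)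
  show ?thesis
    unfolding prob_def
    by (rule has_derivative_eq_rhs[OF has_derivative_divide[OF g Z Zp]])
      (use Zp in \<open>auto simp: fun_eq_iff inner_diff_right m field_simps power2_eq_square\<close>)
qed

definition cov_map :: "'a \<Rightarrow> 'a \<Rightarrow> 'a" where
  "cov_map \<mu> v = (\<Sum>a\<in>I. (prob \<mu> a * (v \<bullet> (X a - mean \<mu>))) *\<^sub>R (X a - mean \<mu>))"

lemma prob_centered: "I \<noteq> {} \<Longrightarrow> (\<Sum>a\<in>I. prob \<mu> a * (v \<bullet> (X a - mean \<mu>))) = 0"
  using prob_sum[of \<mu>]
  by (simp add: inner_diff_right right_diff_distrib sum_subtractf sum_distrib_right[symmetric]) (simp add: mean_def inner_sum_right)

lemma mean_has_derivative:
  assumes ne: "I \<noteq> {}"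
  shows "(mean has_derivative cov_map \<mu>) (at \<mu>)"
proof -
  have "((\<lambda>\<mu>. \<Sum>a\<in>I. prob \<mu> a *\<^sub>R X a) has_derivative (\<lambda>v. \<Sum>a\<in>I. (prob \<mu> a * (v \<bullet> (X a - mean \<mu>))) *\<^sub>R X a)) (at \<mu>)"
    by (intro has_derivative_sum has_derivative_scaleR_left prob_has_derivative ne)
  moreover have "(\<Sum>a\<in>I. (prob \<mu> a * (v \<bullet> (X a - mean \<mu>))) *\<^sub>R X a) = cov_map \<mu> v" for v
    using prob_centered[OF ne, of \<mu> v]
    by (simp add: cov_map_def scaleR_diff_right sum_subtractf scaleR_sum_left[symmetric])
  ultimately show ?thesis unfolding mean_def[abs_def] by simp
qed
text \<open>
The derivative of the mean map is the covariance operator. It is bounded below by a multiple of \<open>h\<^sup>2\<close>, so the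
inverse function theorem applies, and its inverse is bounded by a multiple of \<open>1/h\<^sup>2\<close>.
\<close>

lemma inverse_mean_derivative:
  assumes deep: "cball x (2 * h) \<subseteq> A" and \<mu>: "mean \<mu> = x"
    and low: "\<And>v. (\<Sum>a\<in>I. prob \<mu> a * (v \<bullet> (X a - x))\<^sup>2) \<ge> variance_bound * (norm v * h)\<^sup>2" "variance_bound > 0"
  obtains J where "(inv mean has_derivative J) (at x)" "\<And>v. cov_map \<mu> (J v) = v"
    "\<And>v. norm (J v) \<le> norm v / (variance_bound * h\<^sup>2)"
proof -
  have ne: "I \<noteq> {}" by (rule nonempty[OF deep])
  have injm: "inj mean" using mean_inj[OF deep] by (auto intro: injI)
  have D: "(mean has_derivative cov_map \<mu>) (at \<nu>)" if "\<nu> = \<mu>" for \<nu> using mean_has_derivative[OF ne] that by simp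
  have lin: "linear (cov_map \<mu>)" using D[OF refl] by (rule has_derivative_linear)
  have coer: "variance_bound * (norm v * h)\<^sup>2 \<le> cov_map \<mu> v \<bullet> v" for v
    using low(1)[of v] by (simp add: cov_map_def \<mu> inner_sum_left power2_eq_square inner_commute[of v] mult.assoc)
  have "v = 0" if "cov_map \<mu> v = 0" for v
  proof -
    have "variance_bound * (norm v * h)\<^sup>2 \<le> 0" using coer[of v] that by simp
    then show ?thesis using low(2) h by (simp add: mult_le_0_iff)
  qed
  then have "inj (cov_map \<mu>)" using lin by (simp add: linear_injective_0)
  then obtain J where J: "linear J" "\<And>v. J (cov_map \<mu> v) = v" "\<And>v. cov_map \<mu> (J v) = v"
    using linear_injective_isomorphism[OF lin] by blast
  have "continuous_on UNIV mean"
    using mean_has_derivative[OF ne] by (meson has_derivative_continuous continuous_at_imp_continuous_on)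
  then have "(inv mean has_derivative J) (at (mean \<mu>))"
    by (intro has_derivative_inverse_strong[where S=UNIV and f="mean" and f'="cov_map \<mu>"] D)
      (auto simp: injm J fun_eq_iff)
  moreover have "norm (J v) \<le> norm v / (variance_bound * h\<^sup>2)" for v
  proof (cases "J v = 0")
    case False
    have "(variance_bound * h\<^sup>2 * norm (J v)) * norm (J v) = variance_bound * (norm (J v) * h)\<^sup>2" by (simp add: power2_eq_square)
    also have "\<dots> \<le> v \<bullet> J v" using coer[of "J v"] by (simp add: J)
    also have "\<dots> \<le> norm v * norm (J v)" by (rule norm_cauchy_schwarz)
    finally have "variance_bound * h\<^sup>2 * norm (J v) \<le> norm v" using False by simp
    then show ?thesis using low(2) h by (simp add: field_simps)
  qed (use low(2) in simp)
  ultimately show ?thesis using that J(3) \<mu> by blast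
qed

lemma linear_functional_error:
  assumes L: "linear L" and b: "\<And>v. \<bar>L v - d \<bullet> v\<bar> \<le> K * norm (v :: 'a)"
  obtains g where "\<And>v. L v = g \<bullet> v" "norm (g - d) \<le> K"
proof -
  define g where "g = (\<Sum>i\<in>Basis. L i *\<^sub>R i)"
  have g: "L v = g \<bullet> v" for v
  proof -
    have "L v = L (\<Sum>i\<in>Basis. (v \<bullet> i) *\<^sub>R i)" by (simp add: euclidean_representation)
    also have "\<dots> = (\<Sum>i\<in>Basis. (v \<bullet> i) * L i)" by (simp add: linear_sum[OF L] linear_scale[OF L])
    finally show ?thesis by (simp add: g_def inner_sum_left inner_commute[of v] mult.commute)
  qed
  have "norm (g - d) * norm (g - d) \<le> K * norm (g - d)"
    using b[of "g - d"] unfolding g by (simp add: inner_diff_left[symmetric] dot_square_norm power2_eq_square)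
  moreover have "K \<ge> 0"
  proof -
    obtain i :: 'a where "i \<in> Basis" using nonempty_Basis by blast
    then show ?thesis using b[of i] by simp
  qed
  ultimately have "norm (g - d) \<le> K" by (cases "g = d") auto
  with g show ?thesis using that by blast
qed

text \<open>
Expand \<open>\<phi>\<close> at the nodes around \<open>x\<close>. Because the weights sum to \<open>1\<close> and have mean \<open>x\<close>, the constant and linear terms
reproduce \<open>\<phi>(x)\<close> and the gradient exactly; the quadratic remainders contribute a second moment to the value, and a
third moment divided by the covariance bound to the gradient.
\<close>

lemma lme_interpolant_error:
  assumes lme: "lme_scheme \<beta> I W X" and \<phi>: "taylor2 \<phi> D C" and deep: "cball x (3 * h) \<subseteq> A"
  shows "\<bar>(\<Sum>a\<in>I. \<phi> (X a) * W a x) - \<phi> x\<bar> \<le> C * moment_bound 2 * h\<^sup>2"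
    and "\<exists>g. ((\<lambda>y. \<Sum>a\<in>I. \<phi> (X a) * W a y) has_derivative (\<lambda>v. g \<bullet> v)) (at x) \<and> norm (g - D x) \<le> C * moment_bound 3 / variance_bound * h"
proof -
  have C: "C \<ge> 0" using \<phi> norm_ge_zero order_trans unfolding taylor2_def by blast
  \<comment> \<open>Differentiability at \<open>x\<close> needs the Gibbs form of the weights on a neighbourhood of \<open>x\<close>.\<close>
  have deep2: "cball y (2 * h) \<subseteq> A" if "y \<in> ball x h" for y
  proof
    fix z assume "z \<in> cball y (2 * h)"
    then have "z \<in> cball x (3 * h)" using that dist_triangle[of x z y] by simp
    then show "z \<in> A" using deep by blast
  qed
  have dx: "cball x (2 * h) \<subseteq> A" using deep2[of x] h by simp
  have ne: "I \<noteq> {}" by (rule nonempty[OF dx])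
  have injm: "inj mean" using mean_inj[OF dx] by (auto intro: injI)
  have W: "W a y = prob (inv mean y) a" if y: "y \<in> ball x h" and a: "a \<in> I" for y a
  proof -
    obtain \<mu> where \<mu>: "mean \<mu> = y" using dual_point[OF deep2[OF y]] by metis
    then have i: "inv mean y = \<mu>" using inv_f_f[OF injm] by blast
    have "y \<in> A" using deep2[OF y] h by auto
    then have "lme_minimizer \<beta> I X (mean \<mu>) (\<lambda>a. W a y)"
      using lme in_hull \<mu> unfolding lme_scheme_def by blast
    from lme_minimizer_eq_prob[OF ne this a] show ?thesis by (simp add: i)
  qed
  obtain \<mu> where \<mu>: "mean \<mu> = x" "\<And>m. (\<Sum>a\<in>I. prob \<mu> a * norm (X a - x) ^ m) \<le> h ^ m * moment_bound m"
    "\<And>v. (\<Sum>a\<in>I. prob \<mu> a * (v \<bullet> (X a - x))\<^sup>2) \<ge> variance_bound * (norm v * h)\<^sup>2" "variance_bound > 0"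
    using dual_point[OF dx] by blast
  have i\<mu>: "inv mean x = \<mu>" using \<mu>(1) inv_f_f[OF injm] by blast
  define R where "R a = \<phi> (X a) - \<phi> x - D x \<bullet> (X a - x)" for a
  have R: "\<bar>R a\<bar> \<le> C * norm (X a - x) ^ 2" for a using \<phi> by (simp add: R_def taylor2_def)
  have \<phi>R: "\<phi> (X a) = \<phi> x + D x \<bullet> (X a - x) + R a" for a by (simp add: R_def)
  have p0: "prob \<mu> a \<ge> 0" for a using prob_pos[OF ne, of \<mu> a] by simp
  have cen: "(\<Sum>a\<in>I. prob \<mu> a * (v \<bullet> (X a - x))) = 0" for v using prob_centered[OF ne, of \<mu> v] \<mu>(1) by simp
  have "(\<Sum>a\<in>I. \<phi> (X a) * W a x) = (\<Sum>a\<in>I. prob \<mu> a * \<phi> x + prob \<mu> a * (D x \<bullet> (X a - x)) + prob \<mu> a * R a)"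
    using W[of x] h by (intro sum.cong) (auto simp: i\<mu> \<phi>R algebra_simps)
  also have "\<dots> = \<phi> x + (\<Sum>a\<in>I. prob \<mu> a * R a)"
    by (simp add: sum.distrib cen sum_distrib_right[symmetric] prob_sum[OF ne])
  finally have "\<bar>(\<Sum>a\<in>I. \<phi> (X a) * W a x) - \<phi> x\<bar> \<le> (\<Sum>a\<in>I. prob \<mu> a * \<bar>R a\<bar>)"
    using sum_abs[of "\<lambda>a. prob \<mu> a * R a" I] p0 by (simp add: abs_mult)
  also have "\<dots> \<le> (\<Sum>a\<in>I. prob \<mu> a * (C * norm (X a - x) ^ 2))"
    by (intro sum_mono mult_left_mono R p0)
  also have "\<dots> = C * (\<Sum>a\<in>I. prob \<mu> a * norm (X a - x) ^ 2)" by (simp add: sum_distrib_left mult_ac)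
  also have "\<dots> \<le> C * (h ^ 2 * moment_bound 2)" by (intro mult_left_mono \<mu>(2) C)
  finally show "\<bar>(\<Sum>a\<in>I. \<phi> (X a) * W a x) - \<phi> x\<bar> \<le> C * moment_bound 2 * h\<^sup>2" by (simp add: mult_ac)
  obtain J where J: "(inv mean has_derivative J) (at x)" "\<And>v. cov_map \<mu> (J v) = v"
    "\<And>v. norm (J v) \<le> norm v / (variance_bound * h\<^sup>2)"
    using inverse_mean_derivative[OF dx \<mu>(1) \<mu>(3,4)] by blast
  define L where "L v = (\<Sum>a\<in>I. \<phi> (X a) * (prob \<mu> a * (J v \<bullet> (X a - x))))" for v
  have "((\<lambda>y. prob (inv mean y) a) has_derivative (\<lambda>v. prob \<mu> a * (J v \<bullet> (X a - x)))) (at x)" for a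
    using has_derivative_compose[OF J(1) prob_has_derivative[OF ne, of a "inv mean x"]] by (simp add: i\<mu> \<mu>(1))
  then have "((\<lambda>y. \<Sum>a\<in>I. \<phi> (X a) * prob (inv mean y) a) has_derivative L) (at x)"
    unfolding L_def by (intro has_derivative_sum has_derivative_mult_right)
  then have der: "((\<lambda>y. \<Sum>a\<in>I. \<phi> (X a) * W a y) has_derivative L) (at x)"
    by (rule has_derivative_transform_within_open[where s="ball x h"]) (use h W in auto)
  have "\<bar>L v - D x \<bullet> v\<bar> \<le> (C * moment_bound 3 / variance_bound * h) * norm v" for v
  proof -
    have "L v = (\<Sum>a\<in>I. \<phi> x * (prob \<mu> a * (J v \<bullet> (X a - x))) + 
        D x \<bullet> ((prob \<mu> a * (J v \<bullet> (X a - x))) *\<^sub>R (X a - x)) + R a * (prob \<mu> a * (J v \<bullet> (X a - x))))"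
      unfolding L_def by (intro sum.cong) (auto simp: \<phi>R algebra_simps)
    also have "\<dots> = D x \<bullet> cov_map \<mu> (J v) + (\<Sum>a\<in>I. R a * (prob \<mu> a * (J v \<bullet> (X a - x))))"
      by (simp add: sum.distrib sum_distrib_left[symmetric] cen inner_sum_right[symmetric] cov_map_def \<mu>(1) del: inner_scaleR_right)
    finally have "\<bar>L v - D x \<bullet> v\<bar> = \<bar>\<Sum>a\<in>I. R a * (prob \<mu> a * (J v \<bullet> (X a - x)))\<bar>" by (simp add: J)
    also have "\<dots> \<le> (\<Sum>a\<in>I. \<bar>R a * (prob \<mu> a * (J v \<bullet> (X a - x)))\<bar>)" by (rule sum_abs)
    also have "\<dots> \<le> (\<Sum>a\<in>I. (C * norm (J v)) * (prob \<mu> a * norm (X a - x) ^ 3))"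
    proof (rule sum_mono)
      fix a
      have "\<bar>R a\<bar> * (prob \<mu> a * \<bar>J v \<bullet> (X a - x)\<bar>) \<le> (C * norm (X a - x) ^ 2) * (prob \<mu> a * (norm (J v) * norm (X a - x)))"
        using C p0 by (intro mult_mono R mult_left_mono Cauchy_Schwarz_ineq2) auto
      then show "\<bar>R a * (prob \<mu> a * (J v \<bullet> (X a - x)))\<bar> \<le> (C * norm (J v)) * (prob \<mu> a * norm (X a - x) ^ 3)"
        using p0[of a] by (simp add: abs_mult power2_eq_square power3_eq_cube mult_ac)
    qed
    also have "\<dots> = (C * norm (J v)) * (\<Sum>a\<in>I. prob \<mu> a * norm (X a - x) ^ 3)" by (simp add: sum_distrib_left)
    also have "\<dots> \<le> (C * (norm v / (variance_bound * h\<^sup>2))) * (h ^ 3 * moment_bound 3)"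
    proof (intro mult_mono \<mu>(2) mult_left_mono J C)
      show "0 \<le> (\<Sum>a\<in>I. prob \<mu> a * norm (X a - x) ^ 3)" using p0 by (intro sum_nonneg) auto
    qed (use C \<mu>(4) in auto)
    also have "\<dots> = (C * moment_bound 3 / variance_bound * h) * norm v"
      using h \<mu>(4) by (simp add: power2_eq_square power3_eq_cube field_simps)
    finally show ?thesis .
  qed
  then obtain g where g: "\<And>v. L v = g \<bullet> v" "norm (g - D x) \<le> C * moment_bound 3 / variance_bound * h"
    using linear_functional_error[OF has_derivative_linear[OF der]] by metis
  then have "L = (\<lambda>v. g \<bullet> v)" by auto
  then show "\<exists>g. ((\<lambda>y. \<Sum>a\<in>I. \<phi> (X a) * W a y) has_derivative (\<lambda>v. g \<bullet> v)) (at x) \<and> norm (g - D x) \<le> C * moment_bound 3 / variance_bound * h"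
    using der g(2) by blast
qed
end

section \<open>Convergence in the Sobolev space\<close>

lemma borel_measurable_lebesgue_AE_eq:
  fixes f g :: "'a::euclidean_space \<Rightarrow> real"
  assumes g: "g \<in> borel_measurable lebesgue" and ae: "AE x in lebesgue. g x = f x"
  shows "f \<in> borel_measurable lebesgue"
proof (rule measurableI)
  obtain N where N: "N \<in> null_sets lebesgue" "{x \<in> space lebesgue. g x \<noteq> f x} \<subseteq> N"
    using ae unfolding eventually_ae_filter by blast
  fix S :: "real set" assume S: "S \<in> sets borel"
  have "f -` S \<inter> space lebesgue = (g -` S \<inter> space lebesgue - N) \<union> (f -` S \<inter> N)"
  proof -
    have "g x = f x" if "x \<notin> N" for x using N(2) that by auto
    then show ?thesis by auto
  qed
  moreover have "f -` S \<inter> N \<in> null_sets lebesgue"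
    by (rule null_sets_completion_subset[OF _ N(1)]) auto
  ultimately show "f -` S \<inter> space lebesgue \<in> sets lebesgue"
    using measurable_sets[OF g S] N(1) by (metis null_setsD2 sets.Diff sets.Un)
qed simp

lemma Lp_space_borel_representative:
  fixes \<Omega> :: "'a::euclidean_space set"
  assumes \<Omega>: "open \<Omega>" and f: "f \<in> Lp_space p \<Omega>"
  obtains g where "Lp_supp p \<Omega> g" "AE x in lebesgue. x \<in> \<Omega> \<longrightarrow> f x = g x"
proof -
  have m: "(\<lambda>x. indicator \<Omega> x * f x) \<in> borel_measurable lebesgue"
    using f by (simp add: Lp_space_def set_borel_measurable_def)
  obtain g0 where g0: "g0 \<in> borel_measurable lborel" "AE x in lborel. indicator \<Omega> x * f x = g0 x"
    using completion_ex_borel_measurable_real[OF m] by blast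
  have [measurable]: "g0 \<in> borel_measurable borel" "\<Omega> \<in> sets borel" using g0 \<Omega> by auto
  define g where "g x = indicator \<Omega> x * g0 x" for x
  have [measurable]: "g \<in> borel_measurable borel" unfolding g_def by simp
  have ae: "AE x in lebesgue. x \<in> \<Omega> \<longrightarrow> f x = g x"
    using AE_completion[OF g0(2)] by eventually_elim (auto simp: g_def)
  have "pmass p g = (\<integral>\<^sup>+x. ennreal (\<bar>g x\<bar> powr p) \<partial>lebesgue)"
    unfolding pmass_def by (rule nn_integral_completion[symmetric]) 
  also have "\<dots> = (\<integral>\<^sup>+x. ennreal (norm (indicator \<Omega> x *\<^sub>R (\<bar>f x\<bar> powr p))) \<partial>lebesgue)"
    by (rule nn_integral_cong_AE) (use ae in eventually_elim, auto simp: g_def indicator_def)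
  also have "\<dots> < \<infinity>"
    using f by (simp add: Lp_space_def set_integrable_def integrable_iff_bounded)
  finally have "Lp_supp p \<Omega> g" by (auto simp: Lp_supp_def g_def)
  then show ?thesis using that ae by blast
qed

lemma set_integral_powr_eq_pmass:
  fixes \<Omega> :: "'a::euclidean_space set"
  assumes \<Omega>: "open \<Omega>" and g: "(\<lambda>x. indicator \<Omega> x * g x) \<in> borel_measurable borel"
    and ae: "AE x in lebesgue. x \<in> \<Omega> \<longrightarrow> f x = g x"
  shows "(LINT x:\<Omega>|lebesgue. \<bar>f x\<bar> powr p) = enn2real (pmass p (\<lambda>x. indicator \<Omega> x * g x))"
proof -
  note [measurable] = g
  have "(LINT x:\<Omega>|lebesgue. \<bar>f x\<bar> powr p) = enn2real (\<integral>\<^sup>+x. ennreal (indicator \<Omega> x * (\<bar>f x\<bar> powr p)) \<partial>lebesgue)"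
    unfolding set_lebesgue_integral_def
  proof (subst integral_eq_nn_integral)
    have "(\<lambda>x. \<bar>indicator \<Omega> x * g x\<bar> powr p) \<in> borel_measurable lebesgue"
      by (intro measurable_completion) simp
    moreover have "AE x in lebesgue. \<bar>indicator \<Omega> x * g x\<bar> powr p = indicator \<Omega> x *\<^sub>R (\<bar>f x\<bar> powr p)"
      using ae by eventually_elim (auto simp: indicator_def)
    ultimately show "(\<lambda>x. indicator \<Omega> x *\<^sub>R (\<bar>f x\<bar> powr p)) \<in> borel_measurable lebesgue"
      by (rule borel_measurable_lebesgue_AE_eq)
  qed auto
  also have "(\<integral>\<^sup>+x. ennreal (indicator \<Omega> x * (\<bar>f x\<bar> powr p)) \<partial>lebesgue) = (\<integral>\<^sup>+x. ennreal (\<bar>indicator \<Omega> x * g x\<bar> powr p) \<partial>lebesgue)"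
    by (rule nn_integral_cong_AE) (use ae in eventually_elim, auto simp: indicator_def)
  also have "\<dots> = pmass p (\<lambda>x. indicator \<Omega> x * g x)"
    unfolding pmass_def by (rule nn_integral_completion)
  finally show ?thesis .
qed

lemma W1p_space_sobolev_pair:
  fixes \<Omega> :: "'a::euclidean_space set"
  assumes \<Omega>: "open \<Omega>" and u: "u \<in> W1p_space p \<Omega>"
  shows "\<exists>w U V. sobolev_pair p \<Omega> U V \<and> (AE x in lebesgue. x \<in> \<Omega> \<longrightarrow> u x = U x) \<and>
    (\<forall>i\<in>Basis. is_weak_partial \<Omega> i u (w i) \<and> (AE x in lebesgue. x \<in> \<Omega> \<longrightarrow> w i x = V i x))"
proof -
  have "\<forall>i\<in>Basis. \<exists>v\<in>Lp_space p \<Omega>. is_weak_partial \<Omega> i u v" using u by (simp add: W1p_space_def)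
  then obtain w where w: "\<And>i. i \<in> Basis \<Longrightarrow> w i \<in> Lp_space p \<Omega>" "\<And>i. i \<in> Basis \<Longrightarrow> is_weak_partial \<Omega> i u (w i)" by metis
  have "u \<in> Lp_space p \<Omega>" using u by (simp add: W1p_space_def)
  then obtain U where U: "Lp_supp p \<Omega> U" "AE x in lebesgue. x \<in> \<Omega> \<longrightarrow> u x = U x"
    using Lp_space_borel_representative[OF \<Omega>] by blast
  have "\<exists>g. Lp_supp p \<Omega> g \<and> (AE x in lebesgue. x \<in> \<Omega> \<longrightarrow> w i x = g x)" if "i \<in> Basis" for i
    using Lp_space_borel_representative[OF \<Omega> w(1)[OF that]] by blast
  then obtain V where V: "\<And>i. i \<in> Basis \<Longrightarrow> Lp_supp p \<Omega> (V i)" 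
     "\<And>i. i \<in> Basis \<Longrightarrow> AE x in lebesgue. x \<in> \<Omega> \<longrightarrow> w i x = V i x" by metis
  have tr: "(LINT x:\<Omega>|lebesgue. f x * \<phi> x) = (LINT x|lborel. g x * \<phi> x)"
    if g: "Lp_supp p \<Omega> g" and ae: "AE x in lebesgue. x \<in> \<Omega> \<longrightarrow> f x = g x" and \<phi>: "\<phi> \<in> borel_measurable borel" for f g \<phi>
  proof -
    have gm: "(\<lambda>x. g x * \<phi> x) \<in> borel_measurable borel" using g \<phi> by (auto simp: Lp_supp_def)
    have ae': "AE x in lebesgue. indicator \<Omega> x *\<^sub>R (f x * \<phi> x) = g x * \<phi> x"
      using ae by eventually_elim (use g in \<open>auto simp: indicator_def Lp_supp_def\<close>)
    have gl: "(\<lambda>x. g x * \<phi> x) \<in> borel_measurable lebesgue" using gm by (intro measurable_completion) simp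
    have "AE x in lebesgue. g x * \<phi> x = indicator \<Omega> x *\<^sub>R (f x * \<phi> x)" using ae' by eventually_elim (rule sym)
    then have "(\<lambda>x. indicator \<Omega> x *\<^sub>R (f x * \<phi> x)) \<in> borel_measurable lebesgue"
      by (rule borel_measurable_lebesgue_AE_eq[OF gl])
    then have "(LINT x:\<Omega>|lebesgue. f x * \<phi> x) = (LINT x|lebesgue. g x * \<phi> x)"
      unfolding set_lebesgue_integral_def using gl ae' by (intro integral_cong_AE) auto
    then show ?thesis using LINT_lebesgue_eq_lborel(1)[OF gm] by simp
  qed
  have "sobolev_pair p \<Omega> U V"
    unfolding sobolev_pair_def
  proof (intro conjI ballI allI impI U V)
    fix i :: 'a and \<phi> assume i: "i \<in> Basis" and t: "test_function \<Omega> \<phi>"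
    then obtain K where K: "compact K" "smooth_on_supp K \<phi>" by (auto simp: test_function_smooth_on_supp)
    have m: "\<phi> \<in> borel_measurable borel" "partial_deriv i \<phi> \<in> borel_measurable borel"
      using smooth_on_supp_continuous[OF K(2)] smooth_on_supp_continuous[OF smooth_on_supp_partial_deriv[OF K(2) compact_imp_closed[OF K(1)] i]]
      by (auto intro: borel_measurable_continuous_onI)
    show "(LINT x|lborel. U x * partial_deriv i \<phi> x) = - (LINT x|lborel. V i x * \<phi> x)"
      using w(2)[OF i] t tr[OF U m(2)] tr[OF V[OF i] m(1)] by (simp add: is_weak_partial_def)
  qed
  then have "sobolev_pair p \<Omega> U V \<and> (AE x in lebesgue. x \<in> \<Omega> \<longrightarrow> u x = U x) \<and>
    (\<forall>i\<in>Basis. is_weak_partial \<Omega> i u (w i) \<and> (AE x in lebesgue. x \<in> \<Omega> \<longrightarrow> w i x = V i x))"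
    using w(2) U(2) V(2) by blast
  then show ?thesis by (intro exI)
qed

lemma is_weak_partial_diff:
  assumes f: "is_weak_partial \<Omega> i f f'" and g: "is_weak_partial \<Omega> i g g'" and i: "i \<in> Basis"
  shows "is_weak_partial \<Omega> i (\<lambda>x. f x - g x) (\<lambda>x. f' x - g' x)"
  unfolding is_weak_partial_def
proof (intro conjI allI impI)
  have L: "locally_integrable \<Omega> f" "locally_integrable \<Omega> g" "locally_integrable \<Omega> f'" "locally_integrable \<Omega> g'"
    using f g by (auto simp: is_weak_partial_def)
  show "locally_integrable \<Omega> (\<lambda>x. f x - g x)" "locally_integrable \<Omega> (\<lambda>x. f' x - g' x)"
    using L by (auto simp: locally_integrable_def)
  fix \<phi> assume t: "test_function \<Omega> \<phi>"
  then obtain K where K: "compact K" "K \<subseteq> \<Omega>" "smooth_on_supp K \<phi>" by (auto simp: test_function_smooth_on_supp)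
  have K': "smooth_on_supp K (partial_deriv i \<phi>)" 
    by (rule smooth_on_supp_partial_deriv[OF K(3) compact_imp_closed[OF K(1)] i])
  have "(LINT x:\<Omega>|lebesgue. (f x - g x) * partial_deriv i \<phi> x) =
     (LINT x:\<Omega>|lebesgue. f x * partial_deriv i \<phi> x) - (LINT x:\<Omega>|lebesgue. g x * partial_deriv i \<phi> x)"
    unfolding left_diff_distrib
    by (rule set_integral_diff(2)[OF locally_integrable_mult_smooth[OF L(1) K(1,2) K'] locally_integrable_mult_smooth[OF L(2) K(1,2) K']])
  also have "\<dots> = - ((LINT x:\<Omega>|lebesgue. f' x * \<phi> x) - (LINT x:\<Omega>|lebesgue. g' x * \<phi> x))"
    using f g t by (simp add: is_weak_partial_def)
  also have "(LINT x:\<Omega>|lebesgue. f' x * \<phi> x) - (LINT x:\<Omega>|lebesgue. g' x * \<phi> x) = (LINT x:\<Omega>|lebesgue. (f' x - g' x) * \<phi> x)"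
    unfolding left_diff_distrib
    by (rule set_integral_diff(2)[OF locally_integrable_mult_smooth[OF L(3) K] locally_integrable_mult_smooth[OF L(4) K], symmetric])
  finally show "(LINT x:\<Omega>|lebesgue. (f x - g x) * partial_deriv i \<phi> x) = - (LINT x:\<Omega>|lebesgue. (f' x - g' x) * \<phi> x)" .
qed

text \<open>
The selected weak derivative agrees almost everywhere with any known one, so the norm is controlled by the
\<open>p\<close>-th powers of Borel representatives.
\<close>

lemma W1p_norm_le:
  fixes \<Omega> :: "'a::euclidean_space set"
  assumes \<Omega>: "open \<Omega>" and p: "p \<ge> 1" and e: "e \<ge> 0"
    and f: "AE x in lebesgue. x \<in> \<Omega> \<longrightarrow> f x = F x" "(\<lambda>x. indicator \<Omega> x * F x) \<in> borel_measurable borel"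
      "pmass p (\<lambda>x. indicator \<Omega> x * F x) \<le> ennreal e"
    and g: "\<And>i. i \<in> Basis \<Longrightarrow> is_weak_partial \<Omega> i f (g i)"
      "\<And>i. i \<in> Basis \<Longrightarrow> AE x in lebesgue. x \<in> \<Omega> \<longrightarrow> g i x = G i x"
      "\<And>i. i \<in> Basis \<Longrightarrow> (\<lambda>x. indicator \<Omega> x * G i x) \<in> borel_measurable borel"
      "\<And>i. i \<in> Basis \<Longrightarrow> pmass p (\<lambda>x. indicator \<Omega> x * G i x) \<le> ennreal e"
  shows "W1p_norm p \<Omega> f \<le> ((1 + real DIM('a)) * e) powr (1 / p)"
proof -
  have le: "enn2real m \<le> e" if "m \<le> ennreal e" for m using enn2real_mono[OF that] e by simp
  have 1: "(LINT x:\<Omega>|lebesgue. \<bar>f x\<bar> powr p) \<le> e"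
    unfolding set_integral_powr_eq_pmass[OF \<Omega> f(2,1)] by (rule le[OF f(3)])
  have 2: "(LINT x:\<Omega>|lebesgue. \<bar>weak_partial \<Omega> i f x\<bar> powr p) \<le> e" if i: "i \<in> Basis" for i
  proof -
    have "AE x in lebesgue. x \<in> \<Omega> \<longrightarrow> weak_partial \<Omega> i f x = G i x"
      using weak_partial_AE_eq[OF \<Omega> g(1)[OF i]] g(2)[OF i] by eventually_elim auto
    from set_integral_powr_eq_pmass[OF \<Omega> g(3)[OF i] this] show ?thesis using le[OF g(4)[OF i]] by simp
  qed
  have "(\<Sum>i\<in>Basis. LINT x:\<Omega>|lebesgue. \<bar>weak_partial \<Omega> i f x\<bar> powr p) \<le> (\<Sum>i\<in>(Basis::'a set). e)"
    by (rule sum_mono) (rule 2)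
  then have "(LINT x:\<Omega>|lebesgue. \<bar>f x\<bar> powr p) + (\<Sum>i\<in>Basis. LINT x:\<Omega>|lebesgue. \<bar>weak_partial \<Omega> i f x\<bar> powr p) \<le> (1 + real DIM('a)) * e"
    using 1 by (simp add: distrib_right)
  moreover have "0 \<le> (LINT x:\<Omega>|lebesgue. \<bar>f x\<bar> powr p) + (\<Sum>i\<in>Basis. LINT x:\<Omega>|lebesgue. \<bar>weak_partial \<Omega> i f x\<bar> powr p)"
    unfolding set_lebesgue_integral_def by (intro add_nonneg_nonneg sum_nonneg integral_nonneg_AE AE_I2) auto
  ultimately show ?thesis unfolding W1p_norm_def using p by (intro powr_mono2) auto
qed

lemma pmass_indicator_le:
  fixes \<Omega> :: "'a::euclidean_space set"
  assumes \<Omega>: "open \<Omega>" "bounded \<Omega>" and p: "p \<ge> 0" and B: "\<And>x. x \<in> \<Omega> \<Longrightarrow> \<bar>f x\<bar> \<le> \<eta>"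
  shows "pmass p (\<lambda>x. indicator \<Omega> x * f x) \<le> ennreal (\<eta> powr p * measure lborel \<Omega>)"
proof -
  have fin: "emeasure lborel \<Omega> < \<infinity>" by (rule emeasure_bounded_finite[OF \<Omega>(2)])
  have "pmass p (\<lambda>x. indicator \<Omega> x * f x) \<le> (\<integral>\<^sup>+x. ennreal (\<eta> powr p) * indicator \<Omega> x \<partial>lborel)"
    unfolding pmass_def
  proof (rule nn_integral_mono)
    fix x show "ennreal (\<bar>indicator \<Omega> x * f x\<bar> powr p) \<le> ennreal (\<eta> powr p) * indicator \<Omega> x"
      using B[of x] p by (auto simp: indicator_def intro!: ennreal_leI powr_mono2)
  qed
  also have "\<dots> = ennreal (\<eta> powr p) * emeasure lborel \<Omega>"
    using \<Omega>(1) by (simp add: nn_integral_cmult_indicator)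
  also have "\<dots> = ennreal (\<eta> powr p * measure lborel \<Omega>)"
    using fin by (simp add: emeasure_eq_ennreal_measure ennreal_mult)
  finally show ?thesis .
qed

lemma W1p_space_if_differentiable:
  fixes v :: "'a::euclidean_space \<Rightarrow> real"
  assumes \<Omega>: "open \<Omega>" "bounded \<Omega>" and p: "p \<ge> 0" and der: "\<And>x. x \<in> \<Omega> \<Longrightarrow> (v has_derivative (\<lambda>h. G x \<bullet> h)) (at x)"
    and B: "\<And>x. x \<in> \<Omega> \<Longrightarrow> norm (G x) \<le> B" "\<And>x. x \<in> \<Omega> \<Longrightarrow> \<bar>v x\<bar> \<le> B"
  shows "v \<in> W1p_space p \<Omega>"
  unfolding W1p_space_def
proof (intro CollectI conjI ballI)
  note m = gradient_measurable[OF \<Omega>(1) der]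
  show "v \<in> Lp_space p \<Omega>"
    by (rule bounded_measurable_Lp_space[OF \<Omega> set_borel_measurable_lebesgueI[OF m(1)] B(2) p]) 
  fix i :: 'a assume i: "i \<in> Basis"
  have "(\<lambda>x. G x \<bullet> i) \<in> Lp_space p \<Omega>"
  proof (rule bounded_measurable_Lp_space[OF \<Omega> set_borel_measurable_lebesgueI[OF m(2)] _ p])
    fix x assume "x \<in> \<Omega>"
    then show "\<bar>G x \<bullet> i\<bar> \<le> B" using B(1)[of x] Basis_le_norm[OF i, of "G x"] by simp
  qed
  moreover have "is_weak_partial \<Omega> i v (\<lambda>x. G x \<bullet> i)"
    by (rule is_weak_partial_if_differentiable[OF \<Omega> der B i])
  ultimately show "\<exists>w\<in>Lp_space p \<Omega>. is_weak_partial \<Omega> i v w" by blast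
qed

lemma pmass_triangle:
  fixes a b c :: "'a::euclidean_space \<Rightarrow> real"
  assumes [measurable]: "(\<lambda>x. indicator \<Omega> x * a x) \<in> borel_measurable borel" "b \<in> borel_measurable borel" "c \<in> borel_measurable borel" "\<Omega> \<in> sets borel"
    and p: "p \<ge> 0" and e: "e \<ge> 0" "pmass p (\<lambda>x. indicator \<Omega> x * (a x - b x)) \<le> ennreal e" "pmass p (\<lambda>x. indicator \<Omega> x * (b x - c x)) \<le> ennreal e"
  shows "pmass p (\<lambda>x. indicator \<Omega> x * (a x - c x)) \<le> ennreal (2 powr p * (2 * e))"
proof -
  have [measurable]: "(\<lambda>x. indicator \<Omega> x * (a x - b x)) \<in> borel_measurable borel"
    unfolding right_diff_distrib by measurable
  have "(\<lambda>x. indicator \<Omega> x * (a x - c x)) = (\<lambda>x. indicator \<Omega> x * (a x - b x) + indicator \<Omega> x * (b x - c x))"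
    by (auto simp: algebra_simps)
  then have "pmass p (\<lambda>x. indicator \<Omega> x * (a x - c x)) \<le> ennreal (2 powr p) * (pmass p (\<lambda>x. indicator \<Omega> x * (a x - b x)) + pmass p (\<lambda>x. indicator \<Omega> x * (b x - c x)))"
    using pmass_add[of "\<lambda>x. indicator \<Omega> x * (a x - b x)" "\<lambda>x. indicator \<Omega> x * (b x - c x)" p] p by simp
  also have "\<dots> \<le> ennreal (2 powr p) * (ennreal e + ennreal e)" using e by (intro mult_left_mono add_mono) auto
  also have "\<dots> = ennreal (2 powr p * (2 * e))" using e by (simp flip: ennreal_plus ennreal_mult)
  finally show ?thesis .
qed
lemma taylor2_bounded:
  fixes \<phi> :: "'a::euclidean_space \<Rightarrow> real"
  assumes "taylor2 \<phi> D C" "bounded \<Omega>"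
  obtains B where "B \<ge> 0" "\<And>x. x \<in> \<Omega> \<Longrightarrow> \<bar>\<phi> x\<bar> \<le> B"
proof -
  have "continuous_on (closure \<Omega>) \<phi>"
    using taylor2_has_derivative[OF assms(1)] by (meson has_derivative_continuous continuous_at_imp_continuous_on)
  then have "compact (\<phi> ` closure \<Omega>)" using assms(2) by (intro compact_continuous_image) (auto simp: compact_closure)
  then have "bounded (\<phi> ` closure \<Omega>)" by (rule compact_imp_bounded)
  then obtain B where "\<forall>y\<in>\<phi> ` closure \<Omega>. norm y \<le> B" unfolding bounded_iff by blast
  then have "\<bar>\<phi> x\<bar> \<le> \<bar>B\<bar>" if "x \<in> \<Omega>" for x using that closure_subset[of \<Omega>] by force
  then show ?thesis using that[of "\<bar>B\<bar>"] by auto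
qed

text \<open>
The distance from \<open>u\<close> to the spans tends to zero: fix a regular \<open>\<phi>\<close> close to \<open>u\<close> and interpolate it at
the nodes of the \<open>k\<close>-th scheme.
\<close>

lemma lme_span_approximation:
  fixes \<Omega> \<Omega>' :: "'a::euclidean_space set" and I :: "nat \<Rightarrow> 'i set"
  assumes \<Omega>: "is_domain \<Omega>" "segment_condition \<Omega>" and \<Omega>': "is_domain \<Omega>'" "closure \<Omega> \<subseteq> \<Omega>'"
    and h: "\<And>k. h k > 0" "h \<longlonglongrightarrow> 0" and \<gamma>: "\<gamma> > 0"
    and lme: "\<And>k. lme_scheme (\<gamma> / (h k)\<^sup>2) (I k) (W k) (X k)"
    and cov: "\<And>k. h_covering (h k) (X k ` I k) \<Omega>'" and dens: "\<And>k. h_density_bounded (h k) (X k ` I k) \<tau>"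
    and p: "1 \<le> p" and u: "u \<in> W1p_space p \<Omega>" and \<delta>: "\<delta> > 0"
  shows "\<forall>\<^sub>F k in sequentially. \<exists>v \<in> shape_span (I k) (W k). v \<in> W1p_space p \<Omega> \<and> W1p_norm p \<Omega> (\<lambda>x. v x - u x) \<le> \<delta>"
proof -
  have o: "open \<Omega>" "bounded \<Omega>" and o': "open \<Omega>'" using \<Omega>(1) \<Omega>'(1) by (auto simp: is_domain_def)
  have [measurable]: "\<Omega> \<in> sets borel" using o by simp
  obtain w U V where UV: "sobolev_pair p \<Omega> U V" and aeU: "AE x in lebesgue. x \<in> \<Omega> \<longrightarrow> u x = U x"
    and wV: "\<forall>i\<in>Basis. is_weak_partial \<Omega> i u (w i) \<and> (AE x in lebesgue. x \<in> \<Omega> \<longrightarrow> w i x = V i x)"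
    using W1p_space_sobolev_pair[OF o(1) u] by (elim exE conjE)
  have w: "is_weak_partial \<Omega> i u (w i)" and aeV: "AE x in lebesgue. x \<in> \<Omega> \<longrightarrow> w i x = V i x" if "i \<in> Basis" for i
    using wV[rule_format, OF that] by (rule conjunct1, rule conjunct2)
  have [measurable]: "U \<in> borel_measurable borel" using UV by (simp add: sobolev_pair_def Lp_supp_def)
  have mV: "V i \<in> borel_measurable borel" if "i \<in> Basis" for i using UV that by (simp add: sobolev_pair_def Lp_supp_def)
  \<comment> \<open>Each of the \<open>1 + d\<close> terms of the norm is split in two at the price of the factor \<open>2 powr p\<close>.\<close>
  define e where "e = \<delta> powr p / ((1 + real DIM('a)) * (2 powr p * 2))"
  have e: "e > 0" using \<delta> by (auto simp: e_def intro!: divide_pos_pos mult_pos_pos)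
  have eq: "((1 + real DIM('a)) * (2 powr p * (2 * e))) powr (1 / p) = \<delta>"
  proof -
    have "(1 + real DIM('a)) * (2 powr p * 2) \<noteq> 0" by (simp add: add_nonneg_eq_0_iff)
    then have "((1 + real DIM('a)) * (2 powr p * 2)) * e = \<delta> powr p"
      unfolding e_def by (rule nonzero_mult_div_cancel_left[of _ "\<delta> powr p", unfolded times_divide_eq_right[symmetric]])
    then have "(1 + real DIM('a)) * (2 powr p * (2 * e)) = \<delta> powr p" by (simp only: mult.assoc)
    then show ?thesis using \<delta> p by (simp add: powr_powr)
  qed
  obtain \<phi> D C where \<phi>: "taylor2 \<phi> D C" "pmass p (\<lambda>x. indicator \<Omega> x * (\<phi> x - U x)) \<le> ennreal e"
    "\<And>i. i \<in> Basis \<Longrightarrow> pmass p (\<lambda>x. indicator \<Omega> x * (D x \<bullet> i - V i x)) \<le> ennreal e"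
    using sobolev_pair_C11_approximable[OF o \<Omega>(2) p UV] e unfolding C11_approximable_def by blast
  note [measurable] = taylor2_measurable[OF \<phi>(1)]
  obtain B\<phi> where B\<phi>: "B\<phi> \<ge> 0" "\<And>x. x \<in> \<Omega> \<Longrightarrow> \<bar>\<phi> x\<bar> \<le> B\<phi>"
    using taylor2_bounded[OF \<phi>(1) o(2)] by blast
  define T where "T = \<tau> * node_sum_const DIM('a)"
  define c0 where "c0 = C * lme_nodes.moment_bound \<gamma> T 2"
  define c1 where "c1 = C * lme_nodes.moment_bound \<gamma> T 3 / lme_nodes.variance_bound \<gamma> T"
  define \<eta> where "\<eta> k = \<bar>c0\<bar> * (h k)\<^sup>2 + \<bar>c1\<bar> * h k" for k
  have \<eta>0: "\<eta> k \<ge> 0" for k using h(1)[of k] by (simp add: \<eta>_def)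
  have "\<eta> \<longlonglongrightarrow> \<bar>c0\<bar> * 0\<^sup>2 + \<bar>c1\<bar> * 0" unfolding \<eta>_def by (intro tendsto_intros h(2))
  then have "\<eta> \<longlonglongrightarrow> 0" by simp
  then have "(\<lambda>k. \<eta> k powr p * measure lborel \<Omega>) \<longlonglongrightarrow> 0 powr p * measure lborel \<Omega>"
    using p \<eta>0 by (intro tendsto_mult tendsto_const tendsto_powr2) (auto intro: always_eventually)
  then have "(\<lambda>k. \<eta> k powr p * measure lborel \<Omega>) \<longlonglongrightarrow> 0" by simp
  then have small: "\<forall>\<^sub>F k in sequentially. \<eta> k powr p * measure lborel \<Omega> < e"
    using e by (rule order_tendstoD(2))
  have "compact (closure \<Omega>)" using o(2) by (simp add: compact_closure)
  then obtain \<epsilon> where \<epsilon>: "\<epsilon> > 0" "(\<Union>x\<in>closure \<Omega>. cball x \<epsilon>) \<subseteq> \<Omega>'"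
    using compact_subset_open_imp_cball_epsilon_subset[OF _ o' \<Omega>'(2)] by metis
  have "\<forall>\<^sub>F k in sequentially. h k < \<epsilon> / 3" using \<epsilon>(1) by (intro order_tendstoD(2)[OF h(2)]) simp
  with small show ?thesis
  proof eventually_elim
    case (elim k)
    interpret nodes: lme_nodes "I k" "X k" "h k" \<gamma> \<tau> T \<Omega>'
      using lme[of k] h(1)[of k] \<gamma> cov[of k] dens[of k] by unfold_locales (auto simp: lme_scheme_def T_def)
    let ?v = "\<lambda>x. \<Sum>a\<in>I k. \<phi> (X k a) * W k a x"
    have deep: "cball x (3 * h k) \<subseteq> \<Omega>'" if "x \<in> \<Omega>" for x
    proof -
      have "cball x (3 * h k) \<subseteq> cball x \<epsilon>" using elim(2) by (intro subset_cball) simp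
      also have "\<dots> \<subseteq> \<Omega>'" using \<epsilon>(2) that closure_subset by blast
      finally show ?thesis .
    qed
    have sch: "lme_scheme nodes.\<beta> (I k) (W k) (X k)" using lme[of k] by (simp add: nodes.\<beta>_def)
    have hk: "h k \<ge> 0" using h(1)[of k] by simp
    have v\<phi>: "\<bar>?v x - \<phi> x\<bar> \<le> \<eta> k" if "x \<in> \<Omega>" for x
    proof -
      have "\<bar>?v x - \<phi> x\<bar> \<le> c0 * (h k)\<^sup>2" using nodes.lme_interpolant_error(1)[OF sch \<phi>(1) deep[OF that]] by (simp add: c0_def)
      also have "\<dots> \<le> \<bar>c0\<bar> * (h k)\<^sup>2" by (intro mult_right_mono) auto
      also have "\<dots> \<le> \<eta> k" using hk by (simp add: \<eta>_def)
      finally show ?thesis .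
    qed
    have "\<forall>x\<in>\<Omega>. \<exists>g. (?v has_derivative (\<lambda>v. g \<bullet> v)) (at x) \<and> norm (g - D x) \<le> \<eta> k"
    proof
      fix x assume x: "x \<in> \<Omega>"
      obtain g where g: "(?v has_derivative (\<lambda>v. g \<bullet> v)) (at x)" "norm (g - D x) \<le> c1 * h k"
        using nodes.lme_interpolant_error(2)[OF sch \<phi>(1) deep[OF x]] by (auto simp: c1_def)
      note g(2)
      also have "c1 * h k \<le> \<bar>c1\<bar> * h k" using hk by (intro mult_right_mono) auto
      also have "\<dots> \<le> \<eta> k" by (simp add: \<eta>_def)
      finally show "\<exists>g. (?v has_derivative (\<lambda>v. g \<bullet> v)) (at x) \<and> norm (g - D x) \<le> \<eta> k" using g(1) by blast
    qed
    from bchoice[OF this] obtain G where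
      G0: "\<forall>x\<in>\<Omega>. (?v has_derivative (\<lambda>v. G x \<bullet> v)) (at x) \<and> norm (G x - D x) \<le> \<eta> k" by (elim exE)
    have G: "(?v has_derivative (\<lambda>v. G x \<bullet> v)) (at x)" "norm (G x - D x) \<le> \<eta> k" if "x \<in> \<Omega>" for x
      using G0[rule_format, OF that] by (rule conjunct1, rule conjunct2)
    define B where "B = B\<phi> + \<bar>C\<bar> + \<eta> k"
    have BG: "norm (G x) \<le> B" if "x \<in> \<Omega>" for x
    proof -
      have "norm (D x) \<le> \<bar>C\<bar>" using \<phi>(1) abs_ge_self order_trans unfolding taylor2_def by blast
      then show ?thesis using G(2)[OF that] norm_triangle_sub[of "G x" "D x"] B\<phi>(1) unfolding B_def by linarith
    qed
    have Bv: "\<bar>?v x\<bar> \<le> B" if "x \<in> \<Omega>" for x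
      using v\<phi>[OF that] B\<phi>(2)[OF that] unfolding B_def by linarith
    note mG = gradient_measurable[OF o(1) G(1)]
    note [measurable] = mG
    have "?v \<in> shape_span (I k) (W k)" unfolding shape_span_def by (rule CollectI, rule exI, rule refl)
    moreover have "?v \<in> W1p_space p \<Omega>"
      by (rule W1p_space_if_differentiable[OF o _ G(1) BG Bv]) (use p in auto)
    moreover have "W1p_norm p \<Omega> (\<lambda>x. ?v x - u x) \<le> \<delta>"
      unfolding eq[symmetric]
    proof (rule W1p_norm_le[OF o(1) p, where F="\<lambda>x. ?v x - U x" and g="\<lambda>i x. G x \<bullet> i - w i x" and G="\<lambda>i x. G x \<bullet> i - V i x"])
      show "0 \<le> 2 powr p * (2 * e)" using e by simp
      show "AE x in lebesgue. x \<in> \<Omega> \<longrightarrow> ?v x - u x = ?v x - U x" using aeU by eventually_elim auto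
      show "(\<lambda>x. indicator \<Omega> x * (?v x - U x)) \<in> borel_measurable borel"
        unfolding right_diff_distrib[of "indicator _ _"] by measurable
      have near: "pmass p (\<lambda>x. indicator \<Omega> x * f x) \<le> ennreal e" if "\<And>x. x \<in> \<Omega> \<Longrightarrow> \<bar>f x\<bar> \<le> \<eta> k" for f
      proof -
        have "pmass p (\<lambda>x. indicator \<Omega> x * f x) \<le> ennreal (\<eta> k powr p * measure lborel \<Omega>)"
          by (rule pmass_indicator_le[OF o _ that]) (use p in auto)
        also have "\<dots> \<le> ennreal e" using elim(1) by (intro ennreal_leI) simp
        finally show ?thesis .
      qed
      show "pmass p (\<lambda>x. indicator \<Omega> x * (?v x - U x)) \<le> ennreal (2 powr p * (2 * e))"
        by (rule pmass_triangle[OF mG(1) _ _ _ _ _ near[OF v\<phi>] \<phi>(2)]) (use p e in auto)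
      fix i :: 'a assume i: "i \<in> Basis"
      note [measurable] = mV[OF i]
      show "is_weak_partial \<Omega> i (\<lambda>x. ?v x - u x) (\<lambda>x. G x \<bullet> i - w i x)"
        by (rule is_weak_partial_diff[OF is_weak_partial_if_differentiable[OF o G(1) BG Bv i] w[OF i] i])
      show "AE x in lebesgue. x \<in> \<Omega> \<longrightarrow> G x \<bullet> i - w i x = G x \<bullet> i - V i x" using aeV[OF i] by eventually_elim auto
      show "(\<lambda>x. indicator \<Omega> x * (G x \<bullet> i - V i x)) \<in> borel_measurable borel"
        unfolding right_diff_distrib[of "indicator _ _"] by measurable
      have "\<bar>G x \<bullet> i - D x \<bullet> i\<bar> \<le> \<eta> k" if "x \<in> \<Omega>" for x
        using G(2)[OF that] Basis_le_norm[OF i, of "G x - D x"] by (simp add: inner_diff_left)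
      from pmass_triangle[OF mG(2) _ _ _ _ _ near[OF this] \<phi>(3)[OF i]]
      show "pmass p (\<lambda>x. indicator \<Omega> x * (G x \<bullet> i - V i x)) \<le> ennreal (2 powr p * (2 * e))" using p e by simp
    qed
    ultimately show ?case by blast
  qed
qed

theorem corollary3:
  fixes \<Omega> \<Omega>' :: "'a::euclidean_space set"
    and h \<beta> :: "nat \<Rightarrow> real"
    and I :: "nat \<Rightarrow> 'i set"
    and W :: "nat \<Rightarrow> 'i \<Rightarrow> 'a \<Rightarrow> real"
    and X :: "nat \<Rightarrow> 'i \<Rightarrow> 'a"
    and P :: "nat \<Rightarrow> 'a set"
    and \<tau> \<gamma> p :: real
    and u :: "'a \<Rightarrow> real"
  assumes "is_domain \<Omega>" and "segment_condition \<Omega>"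
    and "is_domain \<Omega>'" and "closure \<Omega> \<subseteq> \<Omega>'"
    and "\<And>k. h k > 0" and "h \<longlonglongrightarrow> 0"
    and "\<tau> > 0" and "\<gamma> > 0"
    and "\<And>k. lme_scheme (\<beta> k) (I k) (W k) (X k)"
    and "\<And>k. P k = X k ` I k"
    and "\<And>k. h_covering (h k) (P k) \<Omega>'"
    and "\<And>k. h_density_bounded (h k) (P k) \<tau>"
    and "\<And>k. \<beta> k = \<gamma> / (h k)\<^sup>2"
    and "1 \<le> p"
    and "u \<in> W1p_space p \<Omega>"
  shows "\<exists>v. (\<forall>k. v k \<in> shape_span (I k) (W k)) \<and> W1p_tendsto p \<Omega> v u"
proof -
  let ?E = "\<lambda>v. W1p_norm p \<Omega> (\<lambda>x. v x - u x)"
  let ?S = "\<lambda>k. shape_span (I k) (W k) \<inter> W1p_space p \<Omega>"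
  have o: "open \<Omega>" "bounded \<Omega>" using assms(1) by (auto simp: is_domain_def)
  have nn: "?E v \<ge> 0" for v by (simp add: W1p_norm_def)
  have "(\<lambda>x. 0) \<in> W1p_space p \<Omega>"
    by (rule W1p_space_if_differentiable[OF o, where G="\<lambda>x. 0" and B=0]) (use assms(14) in auto)
  moreover have "(\<lambda>x. 0) \<in> shape_span (I k) (W k)" for k
    unfolding shape_span_def by (rule CollectI, rule exI[of _ "\<lambda>a. 0"]) simp
  ultimately have ne: "?E ` ?S k \<noteq> {}" for k by blast
  have bdd: "bdd_below (?E ` ?S k)" for k using nn by (intro bdd_belowI2[where m=0])
  \<comment> \<open>A near-minimiser for every \<open>k\<close> turns approximability for each fixed error into a single sequence. The zero function makes the sets nonempty also for small \<open>k\<close>, for which the interpolants may not be regular on \<open>\<Omega>\<close>.\<close>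
  have "\<exists>v \<in> ?S k. ?E v < Inf (?E ` ?S k) + inverse (real (Suc k))" for k
    using cInf_lessD[OF ne[of k], of "Inf (?E ` ?S k) + inverse (real (Suc k))"] by auto
  then have "\<forall>k. \<exists>v. v \<in> ?S k \<and> ?E v < Inf (?E ` ?S k) + inverse (real (Suc k))" by blast
  from choice[OF this] obtain v where
    v0: "\<forall>k. v k \<in> ?S k \<and> ?E (v k) < Inf (?E ` ?S k) + inverse (real (Suc k))" by (elim exE)
  have v: "v k \<in> ?S k" "?E (v k) < Inf (?E ` ?S k) + inverse (real (Suc k))" for k
    using v0[rule_format, of k] by (rule conjunct1, rule conjunct2)
  have app: "\<forall>\<^sub>F k in sequentially. \<exists>v \<in> shape_span (I k) (W k). v \<in> W1p_space p \<Omega> \<and> ?E v \<le> \<delta>" if "\<delta> > 0" for \<delta>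
    by (rule lme_span_approximation[OF assms(1-4) assms(5,6,8) _ _ _ assms(14,15) that])
      (use assms(9-13) in auto)
  have "(\<lambda>k. ?E (v k)) \<longlonglongrightarrow> 0"
  proof (rule order_tendstoI)
    fix a :: real assume "a < 0" then show "\<forall>\<^sub>F k in sequentially. a < ?E (v k)"
      using nn less_le_trans by (intro always_eventually) blast
  next
    fix a :: real assume a: "0 < a"
    have "\<forall>\<^sub>F k in sequentially. inverse (real (Suc k)) < a / 2"
      using a by (intro order_tendstoD(2)[OF LIMSEQ_inverse_real_of_nat]) simp
    moreover have "\<forall>\<^sub>F k in sequentially. \<exists>v \<in> shape_span (I k) (W k). v \<in> W1p_space p \<Omega> \<and> ?E v \<le> a / 2"
      using a by (intro app) simp
    ultimately show "\<forall>\<^sub>F k in sequentially. ?E (v k) < a"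
    proof eventually_elim
      case (elim k)
      then obtain s where s: "s \<in> ?S k" "?E s \<le> a / 2" by blast
      have "Inf (?E ` ?S k) \<le> ?E s" using s(1) by (intro cInf_lower bdd) auto
      then show ?case using v(2)[of k] s(2) elim(1) by linarith
    qed
  qed
  then have "W1p_tendsto p \<Omega> v u" using v(1) assms(15) by (auto simp: W1p_tendsto_def)
  then show ?thesis using v(1) by blast
qed

end
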